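(* Let $X$ and $Y$ be $c_1$-digital images and let $f,g:X\to Y$ be continuous functions. If $f$ is homotopic to $g$, then the induced homomorphisms $f_*^{c_1},g_*^{c_1}:H_q^{c_1}(X)\to H_q^{c_1}(Y)$ are equal (for every $q\ge 0$). In particular, if $X$ and $Y$ are homotopy equivalent digital images, then $H_q^{c_1}(X)\cong H_q^{c_1}(Y)$.
   Context: Two points of $\mathbb{Z}^n$ are $c_1$-adjacent if they differ by exactly $1$ in one coordinate and agree in all others. A $c_1$-digital image is a subset $X\subseteq\mathbb{Z}^n$ (for some $n$) with this adjacency. A function between $c_1$-digital images is continuous if adjacent points map to equal or adjacent points. Let $I=\{0,1\}$, $I^q\subset\mathbb{Z}^q$ with $c_1$-adjacency. A singular $q$-cube in $X$ is a continuous map $\sigma:I^q\to X$. Homotopy: write $[0,k]_{\mathbb{Z}}=\{0,1,\dots,k\}$. Continuous maps $f,g:X\to Y$ are homotopic if there are an integer $k>0$ and a function $F:X\times[0,k]_{\mathbb{Z}}\to Y$ such that $F(x,0)=f(x)$ and $F(x,k)=g(x)$ for all $x\in X$; for each $x\in X$ the map $t\mapsto F(x,t)$, $[0,k]_{\mathbb{Z}}\to Y$, is continuous; and for each $t\in[0,k]_{\mathbb{Z}}$ the map $x\mapsto F(x,t)$, $X\to Y$, is continuous. $X$ and $Y$ are homotopy equivalent if there are continuous $f:X\to Y$, $g:Y\to X$ with $g\circ f$ homotopic to $\mathrm{id}_X$ and $f\circ g$ homotopic to $\mathrm{id}_Y$. $c_1$-complex of $X\subseteq\mathbb{Z}^n$: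 an elementary interval is $\{a\}$ (degenerate) or $\{a,a+1\}$ (nondegenerate), $a\in\mathbb{Z}$. An elementary $q$-cube is $Q=J_1\times\cdots\times J_n$ with $J_i$ elementary intervals, exactly $q$ of them nondegenerate. $C_q^{c_1}(X)$ is the free abelian group on the elementary $q$-cubes $Q\subseteq X$. $A_i^{c_1}Q$ (resp. $B_i^{c_1}Q$) is obtained by replacing $J_i$ with $\{\min J_i\}$ (resp. $\{\max J_i\}$). If $k_1<\dots<k_q$ are the indices with $J_{k_i}$ nondegenerate, $\partial_q^{c_1}Q=\sum_{i=1}^q(-1)^i(A_{k_i}^{c_1}Q-B_{k_i}^{c_1}Q)$. $H_q^{c_1}(X)$ is the homology of this chain complex. Orientation: let $\Sigma_q$ be the symmetric group; $\pi\in\Sigma_q$ acts on $I^q$ by $\pi(t_1,\dots,t_q)=(t_{\pi(1)},\dots,t_{\pi(q)})$; $\oplus$ is coordinatewise addition mod 2. An embedding matrix is an $n\times q$ matrix obtained by inserting $n-q$ zero rows into the $q\times q$ identity matrix. Every injective singular $q$-cube $\sigma$ in $X\subseteq\mathbb{Z}^n$ is uniquely of the form $\sigma(t)=M(z\oplus\pi(t))+x$ with $M$ an embedding matrix, $z\in\mathbb{Z}_2^q$, $\pi\in\Sigma_q$, $x\in X$; moreover its image $\sigma(I^q)$ is an elementary $q$-cube. Its orientation is $o^\sigma=(-1)^{\#z}(-1)^\pi$, where $\#z$ is the number of nonzero coordinates of $z$ and $(-1)^\pi$ is the sign of $\pi$. For a singular $q$-cube $\sigma$ set $\beta_q(\sigma)=0$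 if $\sigma$ is noninjective, and $\beta_q(\sigma)=o^\sigma\cdot\sigma(I^q)\in C_q^{c_1}$ if $\sigma$ is injective. Induced map: for an elementary $q$-cube $Q\subseteq X\subseteq\mathbb{Z}^n$ let $\sigma_Q:I^q\to Q$ be $\sigma_Q(t)=Mt+x$, where $x$ is the lexicographically minimal element of $Q$ and $M$ is the $n\times q$ matrix with columns the standard basis vectors $e_{k_1},\dots,e_{k_q}$, $k_1<\dots<k_q$ being the coordinates in which $Q$ is nondegenerate. For continuous $f:X\to Y$, the homomorphism $f_\#^{c_1}:C_q^{c_1}(X)\to C_q^{c_1}(Y)$ is defined on generators by $f_\#^{c_1}(Q)=\beta_q(f\circ\sigma_Q)$. These homomorphisms form a chain map, and $f_*^{c_1}$ denotes the induced homomorphism on homology. *)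

theory Defs
  imports
    "HOL-Algebra.Free_Abelian_Groups"
    "HOL-Combinatorics.Permutations"
    "Jordan_Normal_Form.Matrix"
begin

section \<open>Digital images\<close>

text \<open>\<open>\<int>\<^sup>n\<close> is \<^term>\<open>carrier_vec n :: int vec set\<close>; coordinates are numbered from \<open>0\<close>.\<close>

definition c1_adjacent :: "int vec \<Rightarrow> int vec \<Rightarrow> bool" where
  "c1_adjacent x y \<longleftrightarrow> dim_vec x = dim_vec y \<and>
     (\<exists>i<dim_vec x. \<bar>x $ i - y $ i\<bar> = 1 \<and> (\<forall>j<dim_vec x. j \<noteq> i \<longrightarrow> x $ j = y $ j))"

definition c1_digital_image :: "int vec set \<Rightarrow> bool" where
  "c1_digital_image X \<longleftrightarrow> (\<exists>n. X \<subseteq> carrier_vec n)"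

text \<open>A function between images is represented by a total function; only its values
  on the domain \<open>X\<close> matter.\<close>

definition digitally_continuous :: "int vec set \<Rightarrow> int vec set \<Rightarrow> (int vec \<Rightarrow> int vec) \<Rightarrow> bool" where
  "digitally_continuous X Y f \<longleftrightarrow> f \<in> X \<rightarrow> Y \<and>
     (\<forall>x\<in>X. \<forall>y\<in>X. c1_adjacent x y \<longrightarrow> f x = f y \<or> c1_adjacent (f x) (f y))"

text \<open>The digital interval \<open>[0,k]\<close> as an image in \<open>\<int>\<^sup>1\<close>.\<close>

definition digital_interval :: "int \<Rightarrow> int vec set" where
  "digital_interval k = {s \<in> carrier_vec 1. 0 \<le> s $ 0 \<and> s $ 0 \<le> k}"

definition digitally_homotopic ::
  "int vec set \<Rightarrow> int vec set \<Rightarrow> (int vec \<Rightarrow> int vec) \<Rightarrow> (int vec \<Rightarrow> int vec) \<Rightarrow> bool" where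
  "digitally_homotopic X Y f g \<longleftrightarrow>
     (\<exists>k>0. \<exists>F :: int vec \<Rightarrow> int \<Rightarrow> int vec.
        (\<forall>x\<in>X. F x 0 = f x \<and> F x k = g x) \<and>
        (\<forall>x\<in>X. digitally_continuous (digital_interval k) Y (\<lambda>s. F x (s $ 0))) \<and>
        (\<forall>t\<in>{0..k}. digitally_continuous X Y (\<lambda>x. F x t)))"

definition digitally_homotopy_equivalent :: "int vec set \<Rightarrow> int vec set \<Rightarrow> bool" where
  "digitally_homotopy_equivalent X Y \<longleftrightarrow>
     (\<exists>f g. digitally_continuous X Y f \<and> digitally_continuous Y X g \<and>
        digitally_homotopic X X (g \<circ> f) id \<and> digitally_homotopic Y Y (f \<circ> g) id)"


section \<open>Elementary cubes and the \<open>c\<^sub>1\<close>-complex\<close>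

definition nondegenerate :: "int set \<Rightarrow> bool" where
  "nondegenerate J \<longleftrightarrow> (\<exists>a. J = {a, a + 1})"

definition elementary_interval :: "int set \<Rightarrow> bool" where
  "elementary_interval J \<longleftrightarrow> (\<exists>a. J = {a}) \<or> nondegenerate J"

definition interval_product :: "int set list \<Rightarrow> int vec set" where
  "interval_product Js = {x \<in> carrier_vec (length Js). \<forall>i<length Js. x $ i \<in> Js ! i}"

definition elementary_cube :: "nat \<Rightarrow> int vec set \<Rightarrow> bool" where
  "elementary_cube q Q \<longleftrightarrow>
     (\<exists>Js. (\<forall>J\<in>set Js. elementary_interval J) \<and> card {i. i < length Js \<and> nondegenerate (Js ! i)} = q \<and>
        Q = interval_product Js)"

text \<open>The intervals \<open>J\<^sub>1, \<dots>, J\<^sub>n\<close> of an elementary cube are determined by the cube as a set.\<close>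

definition intervals :: "int vec set \<Rightarrow> int set list" where
  "intervals Q = (THE Js. (\<forall>J\<in>set Js. elementary_interval J) \<and> Q = interval_product Js)"

lemma elementary_interval_nonempty: "elementary_interval J \<Longrightarrow> J \<noteq> {}"
  by (auto simp: elementary_interval_def nondegenerate_def)

lemma interval_product_selection:
  assumes "\<forall>J\<in>set Js. elementary_interval J"
  shows "vec (length Js) (\<lambda>j. SOME b. b \<in> Js ! j) \<in> interval_product Js"
proof -
  have "(SOME b. b \<in> Js ! j) \<in> Js ! j" if "j < length Js" for j
  proof (rule some_in_eq[THEN iffD2])
    show "Js ! j \<noteq> {}"
      using assms that elementary_interval_nonempty nth_mem by blast
  qed
  then show ?thesis
    unfolding interval_product_def by simp
qed

lemma interval_product_projection:
  assumes Js: "\<forall>J\<in>set Js. elementary_interval J" and i: "i < length Js"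
  shows "(\<lambda>x. x $ i) ` interval_product Js = Js ! i"
proof
  show "(\<lambda>x. x $ i) ` interval_product Js \<subseteq> Js ! i"
    using i unfolding interval_product_def by blast
next
  define v where "v = vec (length Js) (\<lambda>j. SOME b. b \<in> Js ! j)"
  have v: "\<forall>j<length Js. v $ j \<in> Js ! j"
    using interval_product_selection[OF Js] unfolding v_def interval_product_def by blast
  show "Js ! i \<subseteq> (\<lambda>x. x $ i) ` interval_product Js"
  proof
    fix a assume a: "a \<in> Js ! i"
    define x where "x = vec (length Js) (\<lambda>j. if j = i then a else v $ j)"
    have "\<forall>j<length Js. x $ j \<in> Js ! j"
      using a v by (simp add: x_def)
    then have "x \<in> interval_product Js"
      by (simp add: interval_product_def x_def)
    moreover have "a = x $ i" using i by (simp add: x_def)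
    ultimately show "a \<in> (\<lambda>x. x $ i) ` interval_product Js" by blast
  qed
qed

lemma intervals_interval_product:
  assumes Js: "\<forall>J\<in>set Js. elementary_interval J"
  shows "intervals (interval_product Js) = Js"
  unfolding intervals_def
proof (rule the_equality)
  show "(\<forall>J\<in>set Js. elementary_interval J) \<and> interval_product Js = interval_product Js"
    using Js by (intro conjI refl)
next
  fix Ks
  assume "(\<forall>J\<in>set Ks. elementary_interval J) \<and> interval_product Js = interval_product Ks"
  then have Ks: "\<forall>J\<in>set Ks. elementary_interval J"
    and eq: "interval_product Js = interval_product Ks" by blast+
  obtain v where "v \<in> interval_product Js"
    using interval_product_selection[OF Js] by blast
  moreover from this have "v \<in> interval_product Ks"
    unfolding eq .
  ultimately have len: "length Ks = length Js"
    unfolding interval_product_def carrier_vec_def by simp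
  show "Ks = Js"
  proof (rule nth_equalityI[OF len])
    fix i assume "i < length Ks"
    then show "Ks ! i = Js ! i"
      using interval_product_projection[OF Ks, of i] interval_product_projection[OF Js, of i]
      unfolding eq len by simp
  qed
qed

text \<open>The indices \<open>k\<^sub>1 < \<dots> < k\<^sub>q\<close> of the nondegenerate intervals.\<close>

definition nondegenerate_coords :: "int vec set \<Rightarrow> nat list" where
  "nondegenerate_coords Q = [i \<leftarrow> [0..<length (intervals Q)]. nondegenerate (intervals Q ! i)]"

definition front_face :: "nat \<Rightarrow> int vec set \<Rightarrow> int vec set" where
  "front_face i Q = interval_product ((intervals Q)[i := {Min (intervals Q ! i)}])"

definition back_face :: "nat \<Rightarrow> int vec set \<Rightarrow> int vec set" where
  "back_face i Q = interval_product ((intervals Q)[i := {Max (intervals Q ! i)}])"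

type_synonym c1_chain = "int vec set \<Rightarrow>\<^sub>0 int"

definition chain_group :: "nat \<Rightarrow> int vec set \<Rightarrow> c1_chain monoid" where
  "chain_group q X = free_Abelian_group {Q. elementary_cube q Q \<and> Q \<subseteq> X}"

text \<open>The dimension \<open>q\<close> is that of the cube, so a single map serves all degrees, and it vanishes
  on \<open>0\<close>-cubes. Since \<open>i\<close> starts at \<open>1\<close> and list positions at \<open>0\<close>, \<open>k\<^sub>i\<close> is at position \<open>i - 1\<close>.\<close>

definition cube_boundary :: "int vec set \<Rightarrow> c1_chain" where
  "cube_boundary Q = (let k = nondegenerate_coords Q in
     \<Sum>i = 1..length k. frag_cmul ((-1) ^ i)
       (frag_of (front_face (k ! (i - 1)) Q) - frag_of (back_face (k ! (i - 1)) Q)))"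

definition chain_boundary :: "c1_chain \<Rightarrow> c1_chain" where
  "chain_boundary = frag_extend cube_boundary"

definition cycles :: "nat \<Rightarrow> int vec set \<Rightarrow> c1_chain set" where
  "cycles q X = {c \<in> carrier (chain_group q X). chain_boundary c = 0}"

definition boundaries :: "nat \<Rightarrow> int vec set \<Rightarrow> c1_chain set" where
  "boundaries q X = chain_boundary ` carrier (chain_group (Suc q) X)"

definition cycle_group :: "nat \<Rightarrow> int vec set \<Rightarrow> c1_chain monoid" where
  "cycle_group q X = subgroup_generated (chain_group q X) (cycles q X)"

definition c1_homology :: "nat \<Rightarrow> int vec set \<Rightarrow> c1_chain set monoid" where
  "c1_homology q X = cycle_group q X Mod boundaries q X"


section \<open>Singular cubes and their orientation\<close>

definition unit_cube :: "nat \<Rightarrow> int vec set" where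
  "unit_cube q = {t \<in> carrier_vec q. \<forall>i<q. t $ i \<in> {0, 1}}"

text \<open>Elements of \<open>\<int>\<^sub>2\<^sup>q\<close> are identified with points of \<^term>\<open>unit_cube q\<close>.\<close>

definition add_mod2 :: "int vec \<Rightarrow> int vec \<Rightarrow> int vec" where
  "add_mod2 z t = vec (dim_vec t) (\<lambda>i. (z $ i + t $ i) mod 2)"

definition permute_coords :: "(nat \<Rightarrow> nat) \<Rightarrow> int vec \<Rightarrow> int vec" where
  "permute_coords \<pi> t = vec (dim_vec t) (\<lambda>i. t $ \<pi> i)"

text \<open>Row \<open>r j\<close> of an embedding matrix is row \<open>j\<close> of the identity matrix; the other rows are zero.\<close>

definition embedding_matrix :: "nat \<Rightarrow> nat \<Rightarrow> int mat \<Rightarrow> bool" where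
  "embedding_matrix n q M \<longleftrightarrow>
     (\<exists>r. strict_mono_on {..<q} r \<and> r ` {..<q} \<subseteq> {..<n} \<and>
        M = mat n q (\<lambda>(i, j). if i = r j then 1 else 0))"

text \<open>The base point \<open>x\<close> below automatically lies in the image of \<open>\<sigma>\<close>: it is the value where
  \<open>\<pi> t = z\<close>.\<close>

definition cube_presentation ::
  "nat \<Rightarrow> (int vec \<Rightarrow> int vec) \<Rightarrow> int mat \<Rightarrow> int vec \<Rightarrow> (nat \<Rightarrow> nat) \<Rightarrow> int vec \<Rightarrow> bool" where
  "cube_presentation q \<sigma> M z \<pi> x \<longleftrightarrow>
     embedding_matrix (dim_vec x) q M \<and> z \<in> unit_cube q \<and> \<pi> permutes {..<q} \<and>
     (\<forall>t\<in>unit_cube q. \<sigma> t = M *\<^sub>v add_mod2 z (permute_coords \<pi> t) + x)"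

definition orientation :: "nat \<Rightarrow> (int vec \<Rightarrow> int vec) \<Rightarrow> int" where
  "orientation q \<sigma> = (THE s. \<exists>M z \<pi> x. cube_presentation q \<sigma> M z \<pi> x \<and>
     s = (-1) ^ card {i. i < q \<and> z $ i \<noteq> 0} * sign \<pi>)"

definition cube_chain :: "nat \<Rightarrow> (int vec \<Rightarrow> int vec) \<Rightarrow> c1_chain" where
  "cube_chain q \<sigma> = (if inj_on \<sigma> (unit_cube q)
     then frag_cmul (orientation q \<sigma>) (frag_of (\<sigma> ` unit_cube q)) else 0)"


section \<open>Induced maps\<close>

definition lex_less :: "int vec \<Rightarrow> int vec \<Rightarrow> bool" where
  "lex_less x y \<longleftrightarrow> (\<exists>i<dim_vec x. x $ i < y $ i \<and> (\<forall>j<i. x $ j = y $ j))"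

definition lex_min :: "int vec set \<Rightarrow> int vec" where
  "lex_min Q = (THE x. x \<in> Q \<and> (\<forall>y\<in>Q. x = y \<or> lex_less x y))"

definition cube_param :: "int vec set \<Rightarrow> int vec \<Rightarrow> int vec" where
  "cube_param Q t = (let n = length (intervals Q) in
     mat_of_cols n (map (unit_vec n) (nondegenerate_coords Q)) *\<^sub>v t + lex_min Q)"

definition chain_map :: "nat \<Rightarrow> (int vec \<Rightarrow> int vec) \<Rightarrow> c1_chain \<Rightarrow> c1_chain" where
  "chain_map q f = frag_extend (\<lambda>Q. cube_chain q (f \<circ> cube_param Q))"

text \<open>The class of a cycle \<open>c\<close> is sent to the class of its image. All representatives \<open>c\<close> of a
  homology class yield the same class, which is therefore the union. The map is restricted to
  the homology group of \<open>X\<close>, so that equality of induced maps is equality of functions.\<close>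

definition induced_map ::
  "nat \<Rightarrow> int vec set \<Rightarrow> int vec set \<Rightarrow> (int vec \<Rightarrow> int vec) \<Rightarrow> c1_chain set \<Rightarrow> c1_chain set" where
  "induced_map q X Y f = (\<lambda>A\<in>carrier (c1_homology q X).
     \<Union>c\<in>A. boundaries q Y #>\<^bsub>cycle_group q Y\<^esub> chain_map q f c)"

end

theory Submission
  imports Defs "Jordan_Normal_Form.Determinant"
begin

text \<open>
  A homotopy is a finite chain of maps in which consecutive maps \<open>f\<close>, \<open>g\<close> send every point to equal or
  adjacent points. For such a pair and an elementary cube \<open>Q\<close>, the map \<open>(t, 0) \<mapsto> f (\<sigma>\<^sub>Q t)\<close>,
  \<open>(t, 1) \<mapsto> g (\<sigma>\<^sub>Q t)\<close> is a singular cube, so the usual prism operator is a chain homotopy, provided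
  that \<open>\<beta>\<close> commutes with the boundary on all singular cubes \<open>\<sigma>\<close>.

  If \<open>\<sigma>\<close> is injective, this is a computation with signs of permutations. If \<open>\<sigma>\<close> is a noninjective
  \<open>(n + 1)\<close>-cube, it says that \<open>w = \<beta>(\<partial>\<sigma>)\<close> vanishes. By induction on \<open>n\<close>, the chain \<open>w\<close> is an \<open>n\<close>-cycle, and
  its cubes are contained in the image of \<open>\<sigma>\<close>, which has fewer than \<open>2\<^sup>n\<^sup>+\<^sup>1\<close> points; but for
  \<open>n \<ge> 1\<close> a nonzero \<open>n\<close>-cycle of \<open>\<int>\<^sup>m\<close> covers at least \<open>2\<^sup>n\<^sup>+\<^sup>1\<close> points.
\<close>

text \<open>The obstacle is degeneracy: a noninjective cube has \<beta> = 0, but its faces may be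
  injective, so their cancellation is not a formal identity. The bound of the counting argument is
  sharp: the boundary of an elementary (n+1)-cube is a nonzero n-cycle on exactly 2^(n+1) points,
  and a noninjective image falls short of that by at least one point. The sign computation for
  injective cubes presupposes rigidity: up to a symmetry of the unit cube such a cube is a
  coordinate embedding, because three corners of a square in Z^n determine the fourth. The statement
  on homotopy equivalence needs, besides the chain homotopy, that chain maps respect composition.
  This is not immediate either, since \<open>f \<circ> cube_param Q\<close> parametrises its image
  only up to a symmetry, whereas \<open>chain_map\<close> evaluates every cube through its standard
  parametrisation.\<close>

section \<open>Elementary cubes in coordinates\<close>

text \<open>Normal form of an elementary cube: \<open>x\<close> is the minimal vertex and also
  carries the ambient dimension, \<open>K\<close> is the set of nondegenerate directions. Passing to
  a face changes one coordinate of \<open>x\<close> by 0 or 1 and deletes one element of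
  \<open>K\<close>.\<close>

definition lattice_cube :: "int vec \<Rightarrow> nat set \<Rightarrow> int vec set" where
  "lattice_cube x K = {y \<in> carrier_vec (dim_vec x).
     \<forall>i<dim_vec x. y $ i = x $ i \<or> (i \<in> K \<and> y $ i = x $ i + 1)}"

text \<open>For \<open>a\<close> in \<open>K\<close> this is the position of \<open>a\<close> in the
  increasing enumeration, counted from 0. The index i of the direction k_i is therefore
  \<open>Suc (rank K k)\<close>, which explains the exponents in the boundary formulas.\<close>

definition rank :: "nat set \<Rightarrow> nat \<Rightarrow> nat" where
  "rank K a = card {b \<in> K. b < a}"

text \<open>The standard parametrisation of \<open>lattice_cube x K\<close>, freed from matrices and
  from the lexicographic minimum; it agrees with \<open>cube_param\<close> on vectors of length
  \<open>card K\<close>, see \<open>cube_param_lattice_cube\<close>.\<close>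

definition chart :: "int vec \<Rightarrow> nat set \<Rightarrow> int vec \<Rightarrow> int vec" where
  "chart x K u = vec (dim_vec x) (\<lambda>a. x $ a + (if a \<in> K then u $ rank K a else 0))"

definition shift :: "int vec \<Rightarrow> nat \<Rightarrow> int \<Rightarrow> int vec" where
  "shift x k e = vec (dim_vec x) (\<lambda>a. if a = k then x $ a + e else x $ a)"

text \<open>The cubical coface map, with positions counted from 0:
  \<open>\<sigma> \<circ> insert_coord i e\<close> is the face of \<sigma> on which coordinate
  \<open>i\<close> has the value \<open>e\<close>.\<close>

definition insert_coord :: "nat \<Rightarrow> int \<Rightarrow> int vec \<Rightarrow> int vec" where
  "insert_coord i e t = vec (Suc (dim_vec t))
     (\<lambda>a. if a < i then t $ a else if a = i then e else t $ (a - 1))"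

abbreviation cube_intervals :: "int vec \<Rightarrow> nat set \<Rightarrow> int set list" where
  "cube_intervals x K \<equiv> map (\<lambda>i. if i \<in> K then {x $ i, x $ i + 1} else {x $ i}) [0..<dim_vec x]"

lemma nondegenerate_pair: "nondegenerate {a, a + 1}"
  by (auto simp: nondegenerate_def)

lemma not_nondegenerate_singleton: "\<not> nondegenerate {a}"
  by (auto simp: nondegenerate_def)

lemma lattice_cube_interval_product: "lattice_cube x K = interval_product (cube_intervals x K)"
  by (auto simp: lattice_cube_def interval_product_def split: if_splits)

lemma elementary_cube_intervals: "\<forall>J\<in>set (cube_intervals x K). elementary_interval J"
  by (auto simp: elementary_interval_def nondegenerate_def)

lemma intervals_lattice_cube: "intervals (lattice_cube x K) = cube_intervals x K"
  unfolding lattice_cube_interval_product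
  by (rule intervals_interval_product[OF elementary_cube_intervals])

lemma nth_cube_intervals:
  "i < dim_vec x \<Longrightarrow> cube_intervals x K ! i = (if i \<in> K then {x $ i, x $ i + 1} else {x $ i})"
  by (cases "i \<in> K") simp_all

lemma elementary_cube_iff:
  "elementary_cube q Q \<longleftrightarrow>
     (\<exists>x K. K \<subseteq> {..<dim_vec x} \<and> card K = q \<and> Q = lattice_cube x K)"
proof
  assume "elementary_cube q Q"
  then obtain Js where Js: "\<forall>J\<in>set Js. elementary_interval J"
    and q: "card {i. i < length Js \<and> nondegenerate (Js ! i)} = q"
    and Q: "Q = interval_product Js"
    unfolding elementary_cube_def by blast
  define x where "x = vec (length Js) (\<lambda>i. Min (Js ! i))"
  define K where "K = {i. i < length Js \<and> nondegenerate (Js ! i)}"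
  have "Js = cube_intervals x K"
  proof (rule nth_equalityI)
    fix i assume i: "i < length Js"
    then have "elementary_interval (Js ! i)"
      using Js by simp
    then consider a where "Js ! i = {a}" | a where "Js ! i = {a, a + 1}"
      unfolding elementary_interval_def nondegenerate_def by blast
    then show "Js ! i = cube_intervals x K ! i"
    proof cases
      case 1
      then show ?thesis using i by (simp add: x_def K_def not_nondegenerate_singleton)
    next
      case 2
      then show ?thesis using i by (simp add: x_def K_def nondegenerate_pair)
    qed
  qed (simp add: x_def)
  then have "Q = lattice_cube x K"
    unfolding Q lattice_cube_interval_product by simp
  then show "\<exists>x K. K \<subseteq> {..<dim_vec x} \<and> card K = q \<and> Q = lattice_cube x K"
    using q by (intro exI[of _ x] exI[of _ K]) (auto simp: K_def x_def)
next
  assume "\<exists>x K. K \<subseteq> {..<dim_vec x} \<and> card K = q \<and> Q = lattice_cube x K"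
  then obtain x K where K: "K \<subseteq> {..<dim_vec x}" "card K = q" "Q = lattice_cube x K"
    by blast
  have "{i. i < length (cube_intervals x K) \<and> nondegenerate (cube_intervals x K ! i)} = K"
    using K(1) by (auto simp: nondegenerate_pair not_nondegenerate_singleton split: if_splits)
  then show "elementary_cube q Q"
    unfolding elementary_cube_def K(3) lattice_cube_interval_product
    using elementary_cube_intervals[of K x] K(2)
    by (intro exI[of _ "cube_intervals x K"] conjI) simp_all
qed

lemma elementary_cubeE:
  assumes "elementary_cube q Q"
  obtains x K where "K \<subseteq> {..<dim_vec x}" "card K = q" "Q = lattice_cube x K"
  using elementary_cube_iff[THEN iffD1, OF assms] by (elim exE conjE) (rule that)

lemma mem_lattice_cube_self: "x \<in> lattice_cube x K"
  by (simp add: lattice_cube_def)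

text \<open>The interval in each direction shows both its minimum and whether it is degenerate. The
  bounds on \<open>K\<close> and \<open>L\<close> are essential, because indices beyond the
  dimension leave the cube unchanged.\<close>

lemma lattice_cube_eq_iff:
  assumes "K \<subseteq> {..<dim_vec x}" "L \<subseteq> {..<dim_vec y}"
  shows "lattice_cube x K = lattice_cube y L \<longleftrightarrow> x = y \<and> K = L"
proof
  assume "lattice_cube x K = lattice_cube y L"
  then have eq: "cube_intervals x K = cube_intervals y L"
    using intervals_lattice_cube[of x K] intervals_lattice_cube[of y L] by simp
  from arg_cong[OF eq, of length] have dim: "dim_vec x = dim_vec y"
    by simp
  have *: "(if i \<in> K then {x $ i, x $ i + 1} else {x $ i}) = (if i \<in> L then {y $ i, y $ i + 1} else {y $ i})"
    if "i < dim_vec x" for i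
    using arg_cong[OF eq, of "\<lambda>xs. xs ! i"] nth_cube_intervals[of i x K]
      nth_cube_intervals[of i y L] that dim
    by (simp only:)
  have "x $ i = y $ i \<and> (i \<in> K \<longleftrightarrow> i \<in> L)" if "i < dim_vec x" for i
    using *[OF that] by (auto simp: doubleton_eq_iff split: if_splits)
  then show "x = y \<and> K = L"
    using dim assms by (auto intro!: eq_vecI)
qed simp

section \<open>Positions in a finite set of directions, and charts\<close>

lemma nth_sorted_list_of_set_rank:
  assumes "finite K" "j < card K"
  shows "sorted_list_of_set K ! j \<in> K" "rank K (sorted_list_of_set K ! j) = j"
proof -
  let ?xs = "sorted_list_of_set K"
  have len: "length ?xs = card K" and set: "set ?xs = K"
    using assms(1) by auto
  show "?xs ! j \<in> K"
    using assms by (metis len set nth_mem)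
  have sl: "sorted_wrt (<) ?xs" by simp
  have "{b \<in> K. b < ?xs ! j} = (!) ?xs ` {..<j}"
  proof (intro equalityI subsetI)
    fix b assume b: "b \<in> {b \<in> K. b < ?xs ! j}"
    then obtain i where i: "i < length ?xs" "b = ?xs ! i"
      by (metis (no_types, lifting) mem_Collect_eq set in_set_conv_nth)
    moreover have "\<not> j \<le> i"
      using b i sorted_wrt_nth_less[OF sl, of j i] by (cases "i = j") auto
    ultimately show "b \<in> (!) ?xs ` {..<j}" by auto
  next
    fix b assume "b \<in> (!) ?xs ` {..<j}"
    then obtain i where "i < j" "b = ?xs ! i" by auto
    then show "b \<in> {b \<in> K. b < ?xs ! j}"
      using sorted_wrt_nth_less[OF sl, of i j] assms len set by (auto simp: nth_mem[of i ?xs, unfolded set])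
  qed
  moreover have "inj_on ((!) ?xs) {..<j}"
    using assms len by (auto simp: inj_on_def nth_eq_iff_index_eq)
  ultimately show "rank K (?xs ! j) = j"
    by (simp add: rank_def card_image)
qed

lemma rank_less: "finite K \<Longrightarrow> a \<in> K \<Longrightarrow> rank K a < card K"
  unfolding rank_def by (rule psubset_card_mono) auto

lemma rank_strict_mono: "finite K \<Longrightarrow> a \<in> K \<Longrightarrow> a < b \<Longrightarrow> rank K a < rank K b"
  unfolding rank_def by (rule psubset_card_mono) auto

lemma rank_eq_iff: "finite K \<Longrightarrow> a \<in> K \<Longrightarrow> b \<in> K \<Longrightarrow> rank K a = rank K b \<longleftrightarrow> a = b"
  by (metis linorder_neqE_nat rank_strict_mono less_irrefl)

lemma bij_betw_rank:
  assumes "finite K" shows "bij_betw (rank K) K {..<card K}"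
  unfolding bij_betw_def
proof
  show "inj_on (rank K) K"
    using assms by (auto simp: inj_on_def rank_eq_iff)
  show "rank K ` K = {..<card K}"
  proof
    show "rank K ` K \<subseteq> {..<card K}" using assms rank_less by auto
    show "{..<card K} \<subseteq> rank K ` K"
      using nth_sorted_list_of_set_rank[OF assms] by (metis (no_types, lifting) image_iff lessThan_iff subsetI)
  qed
qed

lemma obtain_rank:
  assumes "finite K" "j < card K"
  obtains k where "k \<in> K" "rank K k = j"
  using nth_sorted_list_of_set_rank[OF assms] by blast

lemma rank_remove:
  assumes "finite K" "k \<in> K"
  shows "rank (K - {k}) a = (if k < a then rank K a - 1 else rank K a)"
proof (cases "k < a")
  case True
  have "{b \<in> K - {k}. b < a} = {b \<in> K. b < a} - {k}" by auto
  then show ?thesis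
    using True assms by (simp add: rank_def)
next
  case False
  then have "{b \<in> K - {k}. b < a} = {b \<in> K. b < a}" by auto
  then show ?thesis using False by (simp add: rank_def)
qed

lemma dim_chart [simp]: "dim_vec (chart x K u) = dim_vec x"
  by (simp add: chart_def)

lemma dim_shift [simp]: "dim_vec (shift x k e) = dim_vec x"
  by (simp add: shift_def)

lemma dim_insert_coord [simp]: "dim_vec (insert_coord i e t) = Suc (dim_vec t)"
  by (simp add: insert_coord_def)

lemma shift_0 [simp]: "shift x k 0 = x"
  by (auto simp: shift_def)

text \<open>A face of a chart is the chart of a face: deleting \<open>k\<close> from
  \<open>K\<close> lowers the rank of exactly the directions above \<open>k\<close>, and these are
  the positions that \<open>insert_coord\<close> moves up.\<close>

lemma chart_insert_coord:
  assumes K: "finite K" "k \<in> K" and u: "dim_vec u = card K - 1"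
  shows "chart x K (insert_coord (rank K k) e u) = chart (shift x k e) (K - {k}) u"
proof (rule eq_vecI)
  fix a assume "a < dim_vec (chart (shift x k e) (K - {k}) u)"
  then have a: "a < dim_vec x" by simp
  consider "a \<notin> K" | "a = k" | "a \<in> K" "a < k" | "a \<in> K" "k < a" by linarith
  then show "chart x K (insert_coord (rank K k) e u) $ a = chart (shift x k e) (K - {k}) u $ a"
  proof cases
    case 1
    then show ?thesis using a K by (auto simp: chart_def shift_def)
  next
    case 2
    then show ?thesis using a K rank_less[OF K] u
      by (auto simp: chart_def shift_def insert_coord_def)
  next
    case 3
    then show ?thesis using a K rank_less[OF K] rank_strict_mono[OF K(1), of a k] u
      by (auto simp: chart_def shift_def insert_coord_def rank_remove)
  next
    case 4
    then show ?thesis using a K rank_less[OF K(1), of a] rank_strict_mono[OF K, of a] u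
      by (auto simp: chart_def shift_def insert_coord_def rank_remove)
  qed
qed simp

lemma chart_image_unit_cube:
  assumes K: "K \<subseteq> {..<dim_vec x}"
  shows "chart x K ` unit_cube (card K) = lattice_cube x K"
proof -
  have fin: "finite K" using K finite_subset by blast
  show ?thesis
  proof (intro equalityI subsetI)
    fix y assume "y \<in> chart x K ` unit_cube (card K)"
    then obtain u where u: "u \<in> unit_cube (card K)" "y = chart x K u" by auto
    have *: "y $ a = x $ a \<or> a \<in> K \<and> y $ a = x $ a + 1" if a: "a < dim_vec x" for a
    proof (cases "a \<in> K")
      case True
      then have "u $ rank K a = 0 \<or> u $ rank K a = 1"
        using u(1) rank_less[OF fin True] by (auto simp: unit_cube_def)
      then show ?thesis
        using a True by (elim disjE) (simp_all add: u(2) chart_def)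
    qed (use a in \<open>simp add: u(2) chart_def\<close>)
    show "y \<in> lattice_cube x K"
      unfolding lattice_cube_def
    proof (intro CollectI conjI allI impI)
      show "y \<in> carrier_vec (dim_vec x)"
        unfolding u(2) by (rule carrier_vecI[OF dim_chart])
    qed (rule *)
  next
    fix y assume y: "y \<in> lattice_cube x K"
    \<comment> \<open>The inverse of the chart: coordinate j is the offset from \<open>x\<close>
      along the j-th direction.\<close>
    define u where "u = vec (card K) (\<lambda>j. y $ (sorted_list_of_set K ! j) - x $ (sorted_list_of_set K ! j))"
    have "u \<in> unit_cube (card K)"
      unfolding unit_cube_def
    proof (intro CollectI conjI allI impI)
      fix j assume j: "j < card K"
      let ?k = "sorted_list_of_set K ! j"
      have "?k < dim_vec x"
        using nth_sorted_list_of_set_rank(1)[OF fin j] K by auto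
      then have "y $ ?k = x $ ?k \<or> y $ ?k = x $ ?k + 1"
        using y by (auto simp: lattice_cube_def)
      then show "u $ j \<in> {0, 1}"
        using j by (elim disjE) (simp_all add: u_def)
    qed (simp add: u_def)
    moreover have "sorted_list_of_set K ! (rank K a) = a" if "a \<in> K" for a
      using nth_sorted_list_of_set_rank[OF fin rank_less[OF fin that]] rank_eq_iff[OF fin _ that] by blast
    then have "y = chart x K u"
      using y rank_less[OF fin]
      by (intro eq_vecI) (auto simp: chart_def u_def lattice_cube_def)
    ultimately show "y \<in> chart x K ` unit_cube (card K)" by blast
  qed
qed

lemma inj_on_chart:
  assumes K: "K \<subseteq> {..<dim_vec x}"
  shows "inj_on (chart x K) (carrier_vec (card K))"
proof (rule inj_onI)
  have fin: "finite K" using K finite_subset by blast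
  fix u v assume uv: "u \<in> carrier_vec (card K)" "v \<in> carrier_vec (card K)"
    and eq: "chart x K u = chart x K v"
  show "u = v"
  proof (rule eq_vecI)
    fix j assume "j < dim_vec v"
    then have "j < card K" using uv by simp
    then obtain k where k: "k \<in> K" "rank K k = j"
      using obtain_rank[OF fin] by blast
    then have "chart x K u $ k = chart x K v $ k" "k < dim_vec x"
      using eq K by auto
    then show "u $ j = v $ j"
      using k by (simp add: chart_def)
  qed (use uv in simp)
qed

lemma nondegenerate_coords_lattice_cube:
  assumes "K \<subseteq> {..<dim_vec x}"
  shows "nondegenerate_coords (lattice_cube x K) = sorted_list_of_set K"
proof -
  have "nondegenerate_coords (lattice_cube x K) = filter (\<lambda>i. i \<in> K) [0..<dim_vec x]"
    unfolding nondegenerate_coords_def intervals_lattice_cube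
    by (rule filter_cong) (auto simp: nondegenerate_pair not_nondegenerate_singleton)
  moreover have "sorted_list_of_set K = filter (\<lambda>i. i \<in> K) [0..<dim_vec x]"
  proof -
    have "finite K"
      using assms finite_subset by blast
    moreover have "set (filter (\<lambda>i. i \<in> K) [0..<dim_vec x]) = K"
      using assms by auto
    ultimately show ?thesis
      by (intro strict_sorted_equal[symmetric] sorted_wrt_filter) simp_all
  qed
  ultimately show ?thesis by simp
qed

lemma face_interval_product:
  assumes "k \<in> K" "K \<subseteq> {..<dim_vec x}"
  shows "interval_product ((cube_intervals x K)[k := {x $ k + e}]) = lattice_cube (shift x k e) (K - {k})"
proof -
  have "(cube_intervals x K)[k := {x $ k + e}] = cube_intervals (shift x k e) (K - {k})"
    using assms by (intro nth_equalityI) (auto simp: shift_def nth_list_update)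
  then show ?thesis by (simp only: lattice_cube_interval_product)
qed

lemma front_face_lattice_cube:
  assumes "k \<in> K" "K \<subseteq> {..<dim_vec x}"
  shows "front_face k (lattice_cube x K) = lattice_cube x (K - {k})"
  using face_interval_product[OF assms, of 0] assms
  by (auto simp: front_face_def intervals_lattice_cube)

lemma back_face_lattice_cube:
  assumes "k \<in> K" "K \<subseteq> {..<dim_vec x}"
  shows "back_face k (lattice_cube x K) = lattice_cube (shift x k 1) (K - {k})"
  using face_interval_product[OF assms, of 1] assms
  by (auto simp: back_face_def intervals_lattice_cube)

text \<open>Summation over directions instead of list positions leaves the order of \<open>K\<close>
  only in the sign, which is convenient for reindexing by a permutation.\<close>

lemma cube_boundary_lattice_cube:
  assumes K: "K \<subseteq> {..<dim_vec x}"
  shows "cube_boundary (lattice_cube x K) =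
    (\<Sum>k\<in>K. frag_cmul ((-1) ^ Suc (rank K k))
       (frag_of (lattice_cube x (K - {k})) - frag_of (lattice_cube (shift x k 1) (K - {k}))))"
proof -
  have fin: "finite K" using K finite_subset by blast
  let ?xs = "sorted_list_of_set K"
  have bij: "bij_betw (\<lambda>i. ?xs ! (i - 1)) {1..card K} K"
  proof (rule bij_betwI[where g = "\<lambda>k. Suc (rank K k)"])
    show "(\<lambda>i. ?xs ! (i - 1)) \<in> {1..card K} \<rightarrow> K"
      using nth_sorted_list_of_set_rank(1)[OF fin] by auto
    show "(\<lambda>k. Suc (rank K k)) \<in> K \<rightarrow> {1..card K}"
      using rank_less[OF fin] by (auto simp: Suc_le_eq)
    show "Suc (rank K (?xs ! (i - 1))) = i" if "i \<in> {1..card K}" for i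
      using that nth_sorted_list_of_set_rank(2)[OF fin, of "i - 1"] by auto
    show "?xs ! (Suc (rank K k) - 1) = k" if "k \<in> K" for k
      using nth_sorted_list_of_set_rank[OF fin rank_less[OF fin that]] rank_eq_iff[OF fin _ that] by simp
  qed
  have "cube_boundary (lattice_cube x K) =
    (\<Sum>i = 1..card K. frag_cmul ((-1) ^ Suc (rank K (?xs ! (i - 1))))
       (frag_of (lattice_cube x (K - {?xs ! (i - 1)})) -
        frag_of (lattice_cube (shift x (?xs ! (i - 1)) 1) (K - {?xs ! (i - 1)}))))"
    unfolding cube_boundary_def Let_def nondegenerate_coords_lattice_cube[OF K]
  proof (rule sum.cong)
    fix i assume "i \<in> {1..card K}"
    then have i: "i - 1 < card K" "i > 0" by auto
    note nth = nth_sorted_list_of_set_rank[OF fin i(1)]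
    show "frag_cmul ((- 1) ^ i) (frag_of (front_face (?xs ! (i - 1)) (lattice_cube x K)) -
        frag_of (back_face (?xs ! (i - 1)) (lattice_cube x K))) =
      frag_cmul ((-1) ^ Suc (rank K (?xs ! (i - 1))))
       (frag_of (lattice_cube x (K - {?xs ! (i - 1)})) -
        frag_of (lattice_cube (shift x (?xs ! (i - 1)) 1) (K - {?xs ! (i - 1)})))"
      unfolding front_face_lattice_cube[OF nth(1) K] back_face_lattice_cube[OF nth(1) K] nth(2)
      using i(2) by simp
  qed simp
  also have "\<dots> = (\<Sum>k\<in>K. frag_cmul ((-1) ^ Suc (rank K k))
       (frag_of (lattice_cube x (K - {k})) - frag_of (lattice_cube (shift x k 1) (K - {k}))))"
    by (rule sum.reindex_bij_betw[OF bij])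
  finally show ?thesis .
qed

section \<open>Orientation of injective singular cubes\<close>

lemma lex_less_asym:
  assumes "dim_vec x = dim_vec y" "lex_less x y" shows "\<not> lex_less y x"
proof
  assume "lex_less y x"
  then obtain i where i: "y $ i < x $ i" "\<forall>j<i. y $ j = x $ j"
    unfolding lex_less_def by blast
  obtain j where j: "x $ j < y $ j" "\<forall>i<j. x $ i = y $ i"
    using assms(2) unfolding lex_less_def by blast
  show False
    using i j by (cases i j rule: linorder_cases) auto
qed

lemma lex_min_lattice_cube: "lex_min (lattice_cube x K) = x"
proof -
  have min: "x = y \<or> lex_less x y" if y: "y \<in> lattice_cube x K" for y
  proof (rule disjCI)
    assume "\<not> lex_less x y"
    have dim: "dim_vec y = dim_vec x"
      using y by (simp add: lattice_cube_def)
    have "x $ i = y $ i" if "i < dim_vec x" for i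
      using that
    proof (induction i rule: less_induct)
      case (less i)
      then have "\<forall>j<i. x $ j = y $ j" by simp
      then have "\<not> x $ i < y $ i"
        using \<open>\<not> lex_less x y\<close> less.prems unfolding lex_less_def by blast
      moreover have "y $ i = x $ i \<or> y $ i = x $ i + 1"
        using y less.prems unfolding lattice_cube_def by blast
      ultimately show ?case by linarith
    qed
    then show "x = y"
      using dim by (intro eq_vecI) simp_all
  qed
  show ?thesis
    unfolding lex_min_def
  proof (rule the_equality)
    show "x \<in> lattice_cube x K \<and> (\<forall>y\<in>lattice_cube x K. x = y \<or> lex_less x y)"
      using min mem_lattice_cube_self by blast
    fix w assume w: "w \<in> lattice_cube x K \<and> (\<forall>y\<in>lattice_cube x K. w = y \<or> lex_less w y)"
    then have "dim_vec w = dim_vec x" by (simp add: lattice_cube_def)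
    then show "w = x"
      using w min[of w] mem_lattice_cube_self[of x K] lex_less_asym[of w x] by blast
  qed
qed

lemma rank_strict_mono_image:
  assumes r: "strict_mono_on {..<q} r" and j: "j < q"
  shows "rank (r ` {..<q}) (r j) = j"
proof -
  have "{b \<in> r ` {..<q}. b < r j} = r ` {..<j}"
  proof (intro equalityI subsetI)
    fix b assume "b \<in> {b \<in> r ` {..<q}. b < r j}"
    then obtain i where i: "i < q" "b = r i" "r i < r j" by blast
    then have "i < j"
      using strict_mono_on_less[OF r, of i j] j by simp
    then show "b \<in> r ` {..<j}" using i by blast
  next
    fix b assume "b \<in> r ` {..<j}"
    then obtain i where "i < j" "b = r i" by blast
    then show "b \<in> {b \<in> r ` {..<q}. b < r j}"
      using strict_mono_onD[OF r, of i j] j by auto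
  qed
  moreover have "inj_on r {..<j}"
    by (rule inj_on_subset[OF strict_mono_on_imp_inj_on[OF r]]) (use j in auto)
  ultimately show ?thesis by (simp add: rank_def card_image)
qed

text \<open>Row \<open>a\<close> of the product picks the only j with \<open>r j = a\<close>, and
  this j is the rank of \<open>a\<close> in the range of \<open>r\<close>. So an embedding matrix
  amounts to the set of its nonzero rows, and charts can replace matrices.\<close>

lemma embedding_mult_vec:
  assumes r: "strict_mono_on {..<q} r" and u: "u \<in> carrier_vec q"
  shows "mat (dim_vec x) q (\<lambda>(i, j). if i = r j then 1 else 0) *\<^sub>v u + x = chart x (r ` {..<q}) u"
proof (rule eq_vecI)
  fix a assume "a < dim_vec (chart x (r ` {..<q}) u)"
  then have a: "a < dim_vec x" by simp
  have inj: "inj_on r {..<q}" by (rule strict_mono_on_imp_inj_on[OF r])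
  have "(mat (dim_vec x) q (\<lambda>(i, j). if i = r j then 1 else 0) *\<^sub>v u) $ a =
      (\<Sum>j<q. (if a = r j then 1 else 0) * u $ j)"
    using a u by (simp add: scalar_prod_def atLeast0LessThan)
  also have "\<dots> = (if a \<in> r ` {..<q} then u $ rank (r ` {..<q}) a else 0)"
  proof (cases "a \<in> r ` {..<q}")
    case True
    then obtain k where k: "k < q" "a = r k" by blast
    have "(\<Sum>j<q. (if a = r j then 1 else 0) * u $ j) = (\<Sum>j<q. if j = k then u $ j else 0)"
      using k inj by (intro sum.cong) (auto simp: inj_on_eq_iff)
    also have "\<dots> = u $ k" using k by simp
    finally show ?thesis
      using True k rank_strict_mono_image[OF r k(1)] by simp
  next
    case False
    then have "(\<Sum>j<q. (if a = r j then 1 else 0) * u $ j) = 0"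
      by (intro sum.neutral) auto
    then show ?thesis using False by simp
  qed
  finally show "(mat (dim_vec x) q (\<lambda>(i, j). if i = r j then 1 else 0) *\<^sub>v u + x) $ a
      = chart x (r ` {..<q}) u $ a"
    using a by (simp add: chart_def)
qed simp

lemma strict_mono_nth_sorted_list_of_set:
  "strict_mono_on {..<card K} ((!) (sorted_list_of_set K))"
proof (rule strict_mono_onI)
  fix i j assume "i \<in> {..<card K}" "j \<in> {..<card K}" "i < j"
  then show "sorted_list_of_set K ! i < sorted_list_of_set K ! j"
    using sorted_wrt_nth_less[OF strict_sorted_list_of_set[of K], of i j] by simp
qed

lemma image_nth_sorted_list_of_set:
  "finite K \<Longrightarrow> (!) (sorted_list_of_set K) ` {..<card K} = K"
  by (metis atLeast0LessThan list.set_map map_nth set_sorted_list_of_set set_upt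
      length_sorted_list_of_set)

lemma cube_param_lattice_cube:
  assumes K: "K \<subseteq> {..<dim_vec x}" and u: "u \<in> carrier_vec (card K)"
  shows "cube_param (lattice_cube x K) u = chart x K u"
proof -
  let ?xs = "sorted_list_of_set K"
  have fin: "finite K" using K finite_subset by blast
  have "mat_of_cols (dim_vec x) (map (unit_vec (dim_vec x)) ?xs) =
      mat (dim_vec x) (card K) (\<lambda>(i, j). if i = ?xs ! j then 1 else (0::int))"
  proof (rule eq_matI)
    fix i j assume "i < dim_row (mat (dim_vec x) (card K) (\<lambda>(i, j). if i = ?xs ! j then 1 else (0::int)))"
      "j < dim_col (mat (dim_vec x) (card K) (\<lambda>(i, j). if i = ?xs ! j then 1 else (0::int)))"
    then have ij: "i < dim_vec x" "j < card K" by simp_all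
    then have "?xs ! j < dim_vec x"
      using nth_sorted_list_of_set_rank(1)[OF fin] K by auto
    then show "mat_of_cols (dim_vec x) (map (unit_vec (dim_vec x)) ?xs) $$ (i, j) =
        mat (dim_vec x) (card K) (\<lambda>(i, j). if i = ?xs ! j then 1 else (0::int)) $$ (i, j)"
      using ij by (simp add: mat_of_cols_index)
  qed simp_all
  then show ?thesis
    using embedding_mult_vec[OF strict_mono_nth_sorted_list_of_set u, of x]
    by (simp add: cube_param_def Let_def intervals_lattice_cube lex_min_lattice_cube
        nondegenerate_coords_lattice_cube[OF K] image_nth_sorted_list_of_set[OF fin])
qed

section \<open>Symmetries of the unit cube and presentations of singular cubes\<close>

text \<open>\<open>cube_presentation\<close> with the embedding matrix replaced by the set
  \<open>K\<close> of its nonzero rows. For continuous maps, having such a presentation is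
  equivalent to injectivity, by \<open>presents_inj_on\<close> and
  \<open>injective_singular_cube_presents\<close>.\<close>

definition presents ::
  "nat \<Rightarrow> (int vec \<Rightarrow> int vec) \<Rightarrow> int vec \<Rightarrow> nat set \<Rightarrow> int vec \<Rightarrow> (nat \<Rightarrow> nat) \<Rightarrow> bool" where
  "presents q \<sigma> x K z \<pi> \<longleftrightarrow>
     K \<subseteq> {..<dim_vec x} \<and> card K = q \<and> z \<in> unit_cube q \<and> \<pi> permutes {..<q} \<and>
     (\<forall>t\<in>unit_cube q. \<sigma> t = chart x K (add_mod2 z (permute_coords \<pi> t)))"

lemma unit_cube_carrier: "t \<in> unit_cube q \<Longrightarrow> t \<in> carrier_vec q"
  by (simp add: unit_cube_def)

lemma unit_cubeI: "dim_vec t = q \<Longrightarrow> (\<And>i. i < q \<Longrightarrow> t $ i = 0 \<or> t $ i = 1) \<Longrightarrow> t \<in> unit_cube q"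
  unfolding unit_cube_def carrier_dim_vec mem_Collect_eq insert_iff empty_iff by blast

lemma unit_cubeD: "t \<in> unit_cube q \<Longrightarrow> i < q \<Longrightarrow> t $ i = 0 \<or> t $ i = 1"
  by (simp add: unit_cube_def)

lemma dim_unit_cube: "t \<in> unit_cube q \<Longrightarrow> dim_vec t = q"
  by (simp add: unit_cube_def)

lemma add_mod2_in_unit_cube: "dim_vec t = q \<Longrightarrow> add_mod2 z t \<in> unit_cube q"
  by (rule unit_cubeI) (simp_all add: add_mod2_def, presburger)

lemma dim_permute_coords [simp]: "dim_vec (permute_coords \<pi> t) = dim_vec t"
  by (simp add: permute_coords_def)

lemma dim_add_mod2 [simp]: "dim_vec (add_mod2 z t) = dim_vec t"
  by (simp add: add_mod2_def)

lemma unit_cube_eq_image: "unit_cube q = vec q ` ({..<q} \<rightarrow>\<^sub>E {0, 1})"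
proof (intro equalityI subsetI)
  fix t :: "int vec" assume t: "t \<in> unit_cube q"
  have "t = vec q (restrict (($) t) {..<q})"
    using dim_unit_cube[OF t] by (intro eq_vecI) simp_all
  moreover have "restrict (($) t) {..<q} \<in> {..<q} \<rightarrow>\<^sub>E {0, 1}"
    using unit_cubeD[OF t] by auto
  ultimately show "t \<in> vec q ` ({..<q} \<rightarrow>\<^sub>E {0, 1})" by blast
next
  fix t :: "int vec" assume "t \<in> vec q ` ({..<q} \<rightarrow>\<^sub>E {0, 1})"
  then obtain f where f: "f \<in> {..<q} \<rightarrow>\<^sub>E {0, 1}" "t = vec q f" by blast
  show "t \<in> unit_cube q"
  proof (rule unit_cubeI)
    fix i assume "i < q"
    then show "t $ i = 0 \<or> t $ i = 1"
      using PiE_mem[OF f(1), of i] f(2) by simp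
  qed (simp add: f(2))
qed

lemma finite_unit_cube [simp]: "finite (unit_cube q)"
  unfolding unit_cube_eq_image by (intro finite_imageI finite_PiE) auto

lemma card_unit_cube: "card (unit_cube q) = 2 ^ q"
proof -
  have "inj_on (vec q) ({..<q} \<rightarrow>\<^sub>E {0, 1 :: int})"
  proof (rule inj_onI)
    fix f g assume fg: "f \<in> {..<q} \<rightarrow>\<^sub>E {0, 1 :: int}" "g \<in> {..<q} \<rightarrow>\<^sub>E {0, 1}" "vec q f = vec q g"
    show "f = g"
    proof (rule PiE_ext[OF fg(1,2)])
      fix i assume "i \<in> {..<q}"
      then show "f i = g i"
        using arg_cong[OF fg(3), of "\<lambda>v. v $ i"] by simp
    qed
  qed
  then show ?thesis
    by (simp add: unit_cube_eq_image card_image card_PiE numeral_2_eq_2)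
qed

lemma cube_symmetry_inj:
  assumes \<pi>: "\<pi> permutes {..<q}" and z: "z \<in> unit_cube q"
  shows "inj_on (\<lambda>t. add_mod2 z (permute_coords \<pi> t)) (unit_cube q)"
proof (rule inj_onI)
  fix s t assume st: "s \<in> unit_cube q" "t \<in> unit_cube q"
    and eq: "add_mod2 z (permute_coords \<pi> s) = add_mod2 z (permute_coords \<pi> t)"
  show "s = t"
  proof (rule eq_vecI)
    fix i assume "i < dim_vec t"
    then have i: "i < q" using dim_unit_cube[OF st(2)] by simp
    obtain j where j: "j < q" "\<pi> j = i"
      using permutes_image[OF \<pi>] i by (metis (no_types, lifting) imageE lessThan_iff)
    have "(z $ j + s $ i) mod 2 = (z $ j + t $ i) mod 2"
      using arg_cong[OF eq, of "\<lambda>v. v $ j"] j dim_unit_cube[OF st(1)] dim_unit_cube[OF st(2)]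
      by (simp add: add_mod2_def permute_coords_def)
    then show "s $ i = t $ i"
      using unit_cubeD[OF st(1) i] unit_cubeD[OF st(2) i] unit_cubeD[OF z j(1)] by auto
  qed (simp add: dim_unit_cube[OF st(1)] dim_unit_cube[OF st(2)])
qed

lemma cube_symmetry_image:
  assumes \<pi>: "\<pi> permutes {..<q}" and z: "z \<in> unit_cube q"
  shows "(\<lambda>t. add_mod2 z (permute_coords \<pi> t)) ` unit_cube q = unit_cube q"
  by (rule endo_inj_surj[OF finite_unit_cube _ cube_symmetry_inj[OF assms]])
    (auto intro!: add_mod2_in_unit_cube simp: dim_unit_cube)

lemma presents_image:
  assumes "presents q \<sigma> x K z \<pi>"
  shows "\<sigma> ` unit_cube q = lattice_cube x K"
proof -
  have "\<sigma> ` unit_cube q = chart x K ` (\<lambda>t. add_mod2 z (permute_coords \<pi> t)) ` unit_cube q"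
    using assms unfolding presents_def by (auto simp: image_image)
  then show ?thesis
    using assms cube_symmetry_image[of \<pi> q z] chart_image_unit_cube[of K x]
    unfolding presents_def by auto
qed

lemma presents_inj_on:
  assumes "presents q \<sigma> x K z \<pi>"
  shows "inj_on \<sigma> (unit_cube q)"
proof -
  have K: "K \<subseteq> {..<dim_vec x}" "card K = q" and z: "z \<in> unit_cube q" and \<pi>: "\<pi> permutes {..<q}"
    and \<sigma>: "\<And>t. t \<in> unit_cube q \<Longrightarrow> \<sigma> t = chart x K (add_mod2 z (permute_coords \<pi> t))"
    using assms unfolding presents_def by auto
  have "inj_on (chart x K) (unit_cube q)"
    using inj_on_chart[OF K(1)] unit_cube_carrier K(2) by (auto intro: inj_on_subset)
  then have "inj_on (chart x K \<circ> (\<lambda>t. add_mod2 z (permute_coords \<pi> t))) (unit_cube q)"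
    by (intro comp_inj_on cube_symmetry_inj[OF \<pi> z]) (simp add: cube_symmetry_image[OF \<pi> z])
  then show ?thesis
    using \<sigma> by (simp cong: inj_on_cong)
qed

text \<open>The image determines \<open>x\<close> and \<open>K\<close>, so the two symmetries agree
  on all vertices; the zero vertex then yields \<open>z\<close>, and the unit vectors yield \<pi>.
  This makes the definite description in \<open>orientation\<close> meaningful.\<close>

lemma presents_unique:
  assumes 1: "presents q \<sigma> x K z \<pi>" and 2: "presents q \<sigma> x' K' z' \<pi>'"
  shows "z = z'" "\<pi> = \<pi>'"
proof -
  have K: "K \<subseteq> {..<dim_vec x}" "card K = q" and z: "z \<in> unit_cube q" and \<pi>: "\<pi> permutes {..<q}"
    and \<sigma>: "\<And>t. t \<in> unit_cube q \<Longrightarrow> \<sigma> t = chart x K (add_mod2 z (permute_coords \<pi> t))"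
    using 1 unfolding presents_def by auto
  have K': "K' \<subseteq> {..<dim_vec x'}" and z': "z' \<in> unit_cube q" and \<pi>': "\<pi>' permutes {..<q}"
    and \<sigma>': "\<And>t. t \<in> unit_cube q \<Longrightarrow> \<sigma> t = chart x' K' (add_mod2 z' (permute_coords \<pi>' t))"
    using 2 unfolding presents_def by auto
  have "lattice_cube x K = lattice_cube x' K'"
    using presents_image[OF 1] presents_image[OF 2] by simp
  then have x': "x' = x" "K' = K"
    using lattice_cube_eq_iff[OF K(1) K'] by auto
  have eq: "add_mod2 z (permute_coords \<pi> t) = add_mod2 z' (permute_coords \<pi>' t)"
    if t: "t \<in> unit_cube q" for t
  proof (rule inj_onD[OF inj_on_chart[OF K(1)]])
    show "chart x K (add_mod2 z (permute_coords \<pi> t)) = chart x K (add_mod2 z' (permute_coords \<pi>' t))"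
      using \<sigma>[OF t] \<sigma>'[OF t] x' by simp
  qed (simp_all add: carrier_dim_vec K(2) dim_unit_cube[OF t])
  have val: "(z $ j + t $ \<pi> j) mod 2 = (z' $ j + t $ \<pi>' j) mod 2"
    if "t \<in> unit_cube q" "j < q" for t j
    using arg_cong[OF eq[OF that(1)], of "\<lambda>v. v $ j"] that dim_unit_cube[OF that(1)]
    by (simp add: add_mod2_def permute_coords_def)
  have less: "\<pi> j < q" "\<pi>' j < q" if "j < q" for j
    using that permutes_in_image[OF \<pi>] permutes_in_image[OF \<pi>'] by auto
  have zz: "z $ j = z' $ j" if j: "j < q" for j
  proof -
    have "0\<^sub>v q \<in> unit_cube q"
      by (rule unit_cubeI) simp_all
    then show ?thesis
      using val[of "0\<^sub>v q" j] j less[OF j] unit_cubeD[OF z j] unit_cubeD[OF z' j] by auto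
  qed
  then show "z = z'"
    using dim_unit_cube[OF z] dim_unit_cube[OF z'] by (intro eq_vecI) simp_all
  show "\<pi> = \<pi>'"
  proof
    fix j
    show "\<pi> j = \<pi>' j"
    proof (cases "j < q")
      case True
      have "unit_vec q (\<pi> j) \<in> unit_cube q"
        using less[OF True] by (intro unit_cubeI) (auto simp: unit_vec_def)
      then have "(z $ j + 1) mod 2 = (z $ j + unit_vec q (\<pi> j) $ \<pi>' j) mod 2"
        using val[of "unit_vec q (\<pi> j)" j] zz[OF True] True less[OF True] by simp
      then show ?thesis
        using unit_cubeD[OF z True] less[OF True] by (auto split: if_splits)
    next
      case False
      then show ?thesis
        using permutes_not_in[OF \<pi>, of j] permutes_not_in[OF \<pi>', of j] by simp
    qed
  qed
qed

lemma presents_imp_cube_presentation: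
  assumes "presents q \<sigma> x K z \<pi>"
  shows "\<exists>M. cube_presentation q \<sigma> M z \<pi> x"
proof -
  have K: "K \<subseteq> {..<dim_vec x}" "card K = q" and z: "z \<in> unit_cube q" and \<pi>: "\<pi> permutes {..<q}"
    and \<sigma>: "\<And>t. t \<in> unit_cube q \<Longrightarrow> \<sigma> t = chart x K (add_mod2 z (permute_coords \<pi> t))"
    using assms unfolding presents_def by auto
  have fin: "finite K" using K finite_subset by blast
  let ?r = "(!) (sorted_list_of_set K)"
  have r: "strict_mono_on {..<q} ?r" "?r ` {..<q} = K"
    using strict_mono_nth_sorted_list_of_set[of K] image_nth_sorted_list_of_set[OF fin] K by simp_all
  let ?M = "mat (dim_vec x) q (\<lambda>(i, j). if i = ?r j then 1 else (0 :: int))"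
  have "\<sigma> t = ?M *\<^sub>v add_mod2 z (permute_coords \<pi> t) + x" if t: "t \<in> unit_cube q" for t
  proof -
    have "add_mod2 z (permute_coords \<pi> t) \<in> carrier_vec q"
      by (rule carrier_vecI) (simp add: dim_unit_cube[OF t])
    from embedding_mult_vec[OF r(1) this] show ?thesis
      by (simp only: \<sigma>[OF t] r(2))
  qed
  moreover have "embedding_matrix (dim_vec x) q ?M"
    unfolding embedding_matrix_def using r K(1) by (intro exI[of _ ?r]) simp
  ultimately have "cube_presentation q \<sigma> ?M z \<pi> x"
    unfolding cube_presentation_def using z \<pi> by blast
  then show ?thesis by blast
qed

lemma cube_presentation_imp_presents:
  assumes "cube_presentation q \<sigma> M z \<pi> x"
  shows "\<exists>K. presents q \<sigma> x K z \<pi>"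
proof -
  obtain r where r: "strict_mono_on {..<q} r" "r ` {..<q} \<subseteq> {..<dim_vec x}"
    and M: "M = mat (dim_vec x) q (\<lambda>(i, j). if i = r j then 1 else 0)"
    using assms unfolding cube_presentation_def embedding_matrix_def by blast
  have "card (r ` {..<q}) = q"
    using strict_mono_on_imp_inj_on[OF r(1)] by (simp add: card_image)
  moreover have "\<sigma> t = chart x (r ` {..<q}) (add_mod2 z (permute_coords \<pi> t))"
    if t: "t \<in> unit_cube q" for t
  proof -
    have "add_mod2 z (permute_coords \<pi> t) \<in> carrier_vec q"
      by (rule carrier_vecI) (simp add: dim_unit_cube[OF t])
    moreover have "\<sigma> t = M *\<^sub>v add_mod2 z (permute_coords \<pi> t) + x"
      using assms t unfolding cube_presentation_def by blast
    ultimately show ?thesis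
      unfolding M by (simp only: embedding_mult_vec[OF r(1)])
  qed
  ultimately have "presents q \<sigma> x (r ` {..<q}) z \<pi>"
    unfolding presents_def using assms r(2) by (simp add: cube_presentation_def)
  then show ?thesis by blast
qed

text \<open>The determinant of the linear part of t \<mapsto> z \<oplus> \<pi>(t), which is a signed
  permutation matrix.\<close>

definition sym_sign :: "nat \<Rightarrow> int vec \<Rightarrow> (nat \<Rightarrow> nat) \<Rightarrow> int" where
  "sym_sign q z \<pi> = (-1) ^ card {i. i < q \<and> z $ i \<noteq> 0} * sign \<pi>"

lemma orientation_presents:
  assumes "presents q \<sigma> x K z \<pi>"
  shows "orientation q \<sigma> = sym_sign q z \<pi>"
  unfolding orientation_def
proof (rule the_equality)
  show "\<exists>M z' \<pi>' x'. cube_presentation q \<sigma> M z' \<pi>' x' \<and>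
      sym_sign q z \<pi> = (-1) ^ card {i. i < q \<and> z' $ i \<noteq> 0} * sign \<pi>'"
    using presents_imp_cube_presentation[OF assms] unfolding sym_sign_def by blast
next
  fix s
  assume "\<exists>M z' \<pi>' x'. cube_presentation q \<sigma> M z' \<pi>' x' \<and>
      s = (-1) ^ card {i. i < q \<and> z' $ i \<noteq> 0} * sign \<pi>'"
  then obtain M z' \<pi>' x' where "cube_presentation q \<sigma> M z' \<pi>' x'"
    and s: "s = (-1) ^ card {i. i < q \<and> z' $ i \<noteq> 0} * sign \<pi>'" by blast
  then obtain K' where "presents q \<sigma> x' K' z' \<pi>'"
    using cube_presentation_imp_presents by blast
  then show "s = sym_sign q z \<pi>"
    using presents_unique[OF assms] s unfolding sym_sign_def by simp
qed

lemma cube_chain_presents: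
  assumes "presents q \<sigma> x K z \<pi>"
  shows "cube_chain q \<sigma> = frag_cmul (sym_sign q z \<pi>) (frag_of (lattice_cube x K))"
  using presents_inj_on[OF assms] presents_image[OF assms] orientation_presents[OF assms]
  by (simp add: cube_chain_def)

section \<open>Faces of presented cubes and their signs\<close>

lemma insert_coord_insert_index:
  "b < dim_vec t \<Longrightarrow> insert_coord i e t $ insert_index i b = t $ b"
  by (cases "b < i") (simp_all add: insert_coord_def)

lemma insert_coord_same: "i \<le> dim_vec t \<Longrightarrow> insert_coord i e t $ i = e"
  by (simp add: insert_coord_def)

lemma insert_coord_in_unit_cube:
  assumes t: "t \<in> unit_cube q" and e: "e = 0 \<or> e = 1" and i: "i \<le> q"
  shows "insert_coord i e t \<in> unit_cube (Suc q)"
proof (rule unit_cubeI)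
  fix a assume "a < Suc q"
  then show "insert_coord i e t $ a = 0 \<or> insert_coord i e t $ a = 1"
    using e i unit_cubeD[OF t, of a] unit_cubeD[OF t, of "a - 1"] dim_unit_cube[OF t]
    by (auto simp: insert_coord_def)
qed (simp add: dim_unit_cube[OF t])

lemma insert_index_less: "b < q \<Longrightarrow> insert_index j b < Suc q"
  by (simp add: insert_index_def)

lemma delete_index_less: "a \<noteq> j \<Longrightarrow> a < Suc q \<Longrightarrow> j < Suc q \<Longrightarrow> delete_index j a < q"
  by (auto simp: delete_index_def)

lemma card_nonzero_delete:
  assumes j: "j < Suc q"
  shows "card {i. i < Suc q \<and> f i \<noteq> (0::int)} =
    (if f j = 0 then 0 else 1) + card {i. i < q \<and> f (insert_index j i) \<noteq> 0}"
proof -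
  have eq: "{i. i < Suc q \<and> f i \<noteq> 0} - {j} = insert_index j ` {i. i < q \<and> f (insert_index j i) \<noteq> 0}"
  proof (intro equalityI subsetI)
    fix a assume a: "a \<in> {i. i < Suc q \<and> f i \<noteq> 0} - {j}"
    then have "a = insert_index j (delete_index j a)" "delete_index j a < q"
      using j by (simp_all add: insert_delete_index delete_index_less)
    then show "a \<in> insert_index j ` {i. i < q \<and> f (insert_index j i) \<noteq> 0}"
      using a by (metis (mono_tags, lifting) DiffD1 image_eqI mem_Collect_eq)
  next
    fix a assume "a \<in> insert_index j ` {i. i < q \<and> f (insert_index j i) \<noteq> 0}"
    then show "a \<in> {i. i < Suc q \<and> f i \<noteq> 0} - {j}"
      using insert_index_less[of _ q j] by auto
  qed
  have "card ({i. i < Suc q \<and> f i \<noteq> 0} - {j}) = card {i. i < q \<and> f (insert_index j i) \<noteq> 0}"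
    unfolding eq by (rule card_image[OF insert_index_inj_on])
  moreover have "card {i. i < Suc q \<and> f i \<noteq> 0} =
      (if f j = 0 then 0 else 1) + card ({i. i < Suc q \<and> f i \<noteq> 0} - {j})"
  proof (cases "f j = 0")
    case True
    then have "{i. i < Suc q \<and> f i \<noteq> 0} - {j} = {i. i < Suc q \<and> f i \<noteq> 0}" by auto
    then show ?thesis using True by simp
  next
    case False
    then have "j \<in> {i. i < Suc q \<and> f i \<noteq> 0}" using j by simp
    then have "card {i. i < Suc q \<and> f i \<noteq> 0} = Suc (card ({i. i < Suc q \<and> f i \<noteq> 0} - {j}))"
      by (intro card.remove) simp_all
    then show ?thesis using False by simp
  qed
  ultimately show ?thesis by simp
qed

text \<open>Coordinate \<open>\<pi> j\<close> of the argument is the one that moves the image along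
  the direction \<open>k\<close> of rank \<open>j\<close>; fixing it at \<open>e\<close> fixes the
  offset of the image in that direction at \<open>z $ j + e\<close> mod 2. The sign is that of a
  Laplace expansion: \<open>\<pi>'\<close> is the minor of the permutation matrix at row
  \<open>j\<close> and column \<open>\<pi> j\<close>, and the entry removed from \<open>z\<close>
  contributes -1 if it was a flip.\<close>

lemma presents_face:
  assumes \<sigma>: "presents (Suc q) \<sigma> x K z \<pi>" and e: "e = 0 \<or> e = 1" and k: "k \<in> K"
  defines "j \<equiv> rank K k"
  defines "z' \<equiv> vec q (\<lambda>b. z $ insert_index j b)" and "\<pi>' \<equiv> permutation_delete \<pi> j"
  shows "presents q (\<sigma> \<circ> insert_coord (\<pi> j) e) (shift x k ((z $ j + e) mod 2)) (K - {k}) z' \<pi>'"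
    and "sym_sign (Suc q) z \<pi> = (-1) ^ (j + \<pi> j + nat (z $ j)) * sym_sign q z' \<pi>'"
proof -
  have K: "K \<subseteq> {..<dim_vec x}" "card K = Suc q" and z: "z \<in> unit_cube (Suc q)"
    and \<pi>: "\<pi> permutes {..<Suc q}"
    and \<sigma>: "\<And>t. t \<in> unit_cube (Suc q) \<Longrightarrow> \<sigma> t = chart x K (add_mod2 z (permute_coords \<pi> t))"
    using \<sigma> unfolding presents_def by auto
  have fin: "finite K" using K finite_subset by blast
  have j: "j < Suc q"
    unfolding j_def using rank_less[OF fin k] K by simp
  have \<pi>j: "\<pi> j < Suc q"
    using j permutes_in_image[OF \<pi>] by simp
  have \<pi>0: "\<pi> permutes {0..<Suc q}" using \<pi> by (simp add: atLeast0LessThan)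
  have \<pi>': "\<pi>' permutes {..<q}"
    unfolding \<pi>'_def using permutation_delete_permutes[OF \<pi>0 j] by (simp add: atLeast0LessThan)
  have \<pi>_ins: "\<pi> (insert_index j b) = insert_index (\<pi> j) (\<pi>' b)" for b
  proof -
    have "\<pi> (insert_index j b) \<noteq> \<pi> j"
      using permutes_inj[OF \<pi>] by (simp add: inj_eq)
    then show ?thesis
      unfolding \<pi>'_def permutation_delete_def delete_dom_def delete_ran_def
      by (simp add: insert_delete_index)
  qed
  have sym: "add_mod2 z (permute_coords \<pi> (insert_coord (\<pi> j) e t)) =
      insert_coord j ((z $ j + e) mod 2) (add_mod2 z' (permute_coords \<pi>' t))"
    if t: "t \<in> unit_cube q" for t
  proof (rule eq_vecI)
    note dim = dim_unit_cube[OF t]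
    fix a assume "a < dim_vec (insert_coord j ((z $ j + e) mod 2) (add_mod2 z' (permute_coords \<pi>' t)))"
    then have a: "a < Suc q" using dim by simp
    show "add_mod2 z (permute_coords \<pi> (insert_coord (\<pi> j) e t)) $ a =
      insert_coord j ((z $ j + e) mod 2) (add_mod2 z' (permute_coords \<pi>' t)) $ a"
    proof (cases "a = j")
      case True
      then show ?thesis
        using j \<pi>j dim by (simp add: add_mod2_def permute_coords_def insert_coord_same)
    next
      case False
      define b where "b = delete_index j a"
      have b: "b < q" "a = insert_index j b"
        unfolding b_def using False a j by (simp_all add: insert_delete_index delete_index_less)
      have "\<pi>' b < q" using b(1) permutes_in_image[OF \<pi>'] by simp
      then show ?thesis
        using a b dim unfolding b(2)
        by (simp add: insert_coord_insert_index)
          (simp add: add_mod2_def permute_coords_def z'_def \<pi>_ins insert_coord_insert_index)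
    qed
  qed simp
  show "presents q (\<sigma> \<circ> insert_coord (\<pi> j) e) (shift x k ((z $ j + e) mod 2)) (K - {k}) z' \<pi>'"
    unfolding presents_def
  proof (intro conjI ballI)
    show "K - {k} \<subseteq> {..<dim_vec (shift x k ((z $ j + e) mod 2))}" using K by auto
    show "card (K - {k}) = q" using K k fin by simp
    show "z' \<in> unit_cube q"
      unfolding z'_def using unit_cubeD[OF z insert_index_less[of _ q j]] by (intro unit_cubeI) simp_all
    show "\<pi>' permutes {..<q}" by (rule \<pi>')
    fix t assume t: "t \<in> unit_cube q"
    have "(\<sigma> \<circ> insert_coord (\<pi> j) e) t = chart x K (insert_coord j ((z $ j + e) mod 2) (add_mod2 z' (permute_coords \<pi>' t)))"
      using \<sigma>[OF insert_coord_in_unit_cube[OF t e]] \<pi>j sym[OF t] by simp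
    also have "\<dots> = chart (shift x k ((z $ j + e) mod 2)) (K - {k}) (add_mod2 z' (permute_coords \<pi>' t))"
      unfolding j_def using dim_unit_cube[OF t] K by (intro chart_insert_coord[OF fin k]) simp
    finally show "(\<sigma> \<circ> insert_coord (\<pi> j) e) t =
      chart (shift x k ((z $ j + e) mod 2)) (K - {k}) (add_mod2 z' (permute_coords \<pi>' t))" .
  qed
  have "sign \<pi> = (-1) ^ (j + \<pi> j) * (sign \<pi>' :: int)"
    using signof_permutation_insert[OF \<pi>'[folded atLeast0LessThan] j \<pi>j, where 'a = int]
      permutation_insert_delete[OF \<pi>0 j] unfolding \<pi>'_def by simp
  moreover have "card {i. i < q \<and> z $ insert_index j i \<noteq> 0} = card {i. i < q \<and> z' $ i \<noteq> 0}"
    by (rule arg_cong[where f = card]) (auto simp: z'_def)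
  then have "card {i. i < Suc q \<and> z $ i \<noteq> 0} = nat (z $ j) + card {i. i < q \<and> z' $ i \<noteq> 0}"
    using card_nonzero_delete[OF j, of "($) z"] unit_cubeD[OF z j] by auto
  ultimately show "sym_sign (Suc q) z \<pi> = (-1) ^ (j + \<pi> j + nat (z $ j)) * sym_sign q z' \<pi>'"
    unfolding sym_sign_def by (simp add: power_add)
qed

text \<open>The group of singular chains is never formed: the values of a chain-valued
  \<open>h\<close> on the faces are summed directly, and a second boundary arises by taking another
  \<open>singular_boundary\<close> for \<open>h\<close>. The exponent \<open>Suc i\<close>
  compensates for positions counted from 0.\<close>

definition singular_boundary :: "nat \<Rightarrow> ((int vec \<Rightarrow> int vec) \<Rightarrow> c1_chain) \<Rightarrow> (int vec \<Rightarrow> int vec) \<Rightarrow> c1_chain" where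
  "singular_boundary q h \<sigma> = (\<Sum>i<q. frag_cmul ((-1) ^ Suc i)
     (h (\<sigma> \<circ> insert_coord i 0) - h (\<sigma> \<circ> insert_coord i 1)))"

lemma frag_cmul_diff_right: "frag_cmul c (a - b) = frag_cmul c a - frag_cmul c b"
  by (rule poly_mapping_eqI) (simp add: lookup_minus algebra_simps)

text \<open>With j the rank of \<open>k\<close>, face number \<open>\<pi> j\<close> of \<sigma>
  covers a face of the image in direction \<open>k\<close>. The two position signs differ by (-1)^(j
  + \<pi> j), which is the factor in \<open>presents_face\<close>; the remaining factor for
  \<open>z $ j = 1\<close> is absorbed by the exchange of front and back face.\<close>

lemma chain_boundary_presents:
  assumes p: "presents (Suc q) \<sigma> x K z \<pi>"
  shows "chain_boundary (cube_chain (Suc q) \<sigma>) = singular_boundary (Suc q) (cube_chain q) \<sigma>"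
proof -
  have K: "K \<subseteq> {..<dim_vec x}" "card K = Suc q" and z: "z \<in> unit_cube (Suc q)"
    and \<pi>: "\<pi> permutes {..<Suc q}"
    using p unfolding presents_def by auto
  have fin: "finite K" using K finite_subset by blast
  let ?j = "rank K"
  let ?s = "sym_sign (Suc q) z \<pi>"
  let ?F = "\<lambda>e k. frag_of (lattice_cube (shift x k e) (K - {k}))"
  have "bij_betw (\<pi> \<circ> ?j) K {..<Suc q}"
    using bij_betw_rank[OF fin] permutes_imp_bij[OF \<pi>] K(2) by (auto intro: bij_betw_trans)
  then have "singular_boundary (Suc q) (cube_chain q) \<sigma> =
      (\<Sum>k\<in>K. frag_cmul ((-1) ^ Suc (\<pi> (?j k)))
        (cube_chain q (\<sigma> \<circ> insert_coord (\<pi> (?j k)) 0) - cube_chain q (\<sigma> \<circ> insert_coord (\<pi> (?j k)) 1)))"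
    unfolding singular_boundary_def
    by (subst sum.reindex_bij_betw[of "\<pi> \<circ> ?j" K, symmetric]) simp_all
  also have "\<dots> = (\<Sum>k\<in>K. frag_cmul ?s (frag_cmul ((-1) ^ Suc (?j k)) (?F 0 k - ?F 1 k)))"
  proof (rule sum.cong[OF refl])
    fix k assume k: "k \<in> K"
    define s' where "s' = sym_sign q (vec q (\<lambda>b. z $ insert_index (?j k) b)) (permutation_delete \<pi> (?j k))"
    have face: "cube_chain q (\<sigma> \<circ> insert_coord (\<pi> (?j k)) e) = frag_cmul s' (?F ((z $ ?j k + e) mod 2) k)"
      if "e = 0 \<or> e = 1" for e
      unfolding s'_def by (rule cube_chain_presents[OF presents_face(1)[OF p that k]])
    have s: "?s = (-1) ^ (?j k + \<pi> (?j k) + nat (z $ ?j k)) * s'"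
      unfolding s'_def by (rule presents_face(2)[OF p _ k, of 0]) simp
    have "?j k < Suc q" using rank_less[OF fin k] K by simp
    from unit_cubeD[OF z this] show "frag_cmul ((-1) ^ Suc (\<pi> (?j k)))
        (cube_chain q (\<sigma> \<circ> insert_coord (\<pi> (?j k)) 0) - cube_chain q (\<sigma> \<circ> insert_coord (\<pi> (?j k)) 1)) =
      frag_cmul ?s (frag_cmul ((-1) ^ Suc (?j k)) (?F 0 k - ?F 1 k))"
    proof
      assume "z $ ?j k = 0"
      then show ?thesis
        unfolding face[OF disjI1[OF refl]] face[OF disjI2[OF refl]] s
        by (intro poly_mapping_eqI) (simp add: lookup_minus power_add algebra_simps)
    next
      assume "z $ ?j k = 1"
      then show ?thesis
        unfolding face[OF disjI1[OF refl]] face[OF disjI2[OF refl]] s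
        by (intro poly_mapping_eqI) (simp add: lookup_minus power_add algebra_simps)
    qed
  qed
  also have "\<dots> = chain_boundary (cube_chain (Suc q) \<sigma>)"
    unfolding cube_chain_presents[OF p] chain_boundary_def frag_extend_cmul frag_extend_of
      cube_boundary_lattice_cube[OF K(1)] frag_cmul_sum shift_0 ..
  finally show ?thesis by simp
qed

section \<open>Injective singular cubes\<close>

lemma shift_in_carrier: "x \<in> carrier_vec n \<Longrightarrow> shift x k e \<in> carrier_vec n"
  by (rule carrier_vecI) simp

lemma c1_adjacent_iff_shift:
  "c1_adjacent x y \<longleftrightarrow> (\<exists>k e. k < dim_vec x \<and> (e = 1 \<or> e = -1) \<and> y = shift x k e)"
proof
  assume "c1_adjacent x y"
  then obtain k where k: "k < dim_vec x" "\<bar>x $ k - y $ k\<bar> = 1" "dim_vec x = dim_vec y"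
    "\<forall>j<dim_vec x. j \<noteq> k \<longrightarrow> x $ j = y $ j"
    unfolding c1_adjacent_def by blast
  have "y = shift x k (y $ k - x $ k)"
    using k(3,4) by (intro eq_vecI) (auto simp: shift_def)
  moreover have "y $ k - x $ k = 1 \<or> y $ k - x $ k = -1"
    using k(2) by linarith
  ultimately show "\<exists>k e. k < dim_vec x \<and> (e = 1 \<or> e = -1) \<and> y = shift x k e"
    using k(1) by blast
next
  assume "\<exists>k e. k < dim_vec x \<and> (e = 1 \<or> e = -1) \<and> y = shift x k e"
  then obtain k e where "k < dim_vec x" "e = 1 \<or> e = -1" "y = shift x k e" by blast
  then show "c1_adjacent x y"
    unfolding c1_adjacent_def by (intro conjI exI[of _ k]) (auto simp: shift_def)
qed

lemma c1_adjacent_shift: "k < dim_vec x \<Longrightarrow> e = 1 \<or> e = -1 \<Longrightarrow> c1_adjacent x (shift x k e)"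
  unfolding c1_adjacent_iff_shift by blast

lemma c1_adjacent_sym: "c1_adjacent x y \<Longrightarrow> c1_adjacent y x"
  unfolding c1_adjacent_def by (metis abs_minus_commute)

lemma digitally_continuousD:
  assumes "digitally_continuous X Y f"
  shows "x \<in> X \<Longrightarrow> f x \<in> Y"
    "x \<in> X \<Longrightarrow> y \<in> X \<Longrightarrow> c1_adjacent x y \<Longrightarrow> f x = f y \<or> c1_adjacent (f x) (f y)"
  using assms unfolding digitally_continuous_def by blast+

lemma digitally_continuous_comp:
  assumes "digitally_continuous X Y f" "digitally_continuous Y Z g"
  shows "digitally_continuous X Z (g \<circ> f)"
  unfolding digitally_continuous_def
proof (intro conjI ballI impI)
  show "g \<circ> f \<in> X \<rightarrow> Z"
    using digitally_continuousD(1)[OF assms(1)] digitally_continuousD(1)[OF assms(2)] by auto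
  fix x y assume "x \<in> X" "y \<in> X" "c1_adjacent x y"
  then show "(g \<circ> f) x = (g \<circ> f) y \<or> c1_adjacent ((g \<circ> f) x) ((g \<circ> f) y)"
    using digitally_continuousD[OF assms(1)] digitally_continuousD(2)[OF assms(2), of "f x" "f y"]
    by fastforce
qed

lemma digitally_continuous_subset:
  "digitally_continuous X Y f \<Longrightarrow> W \<subseteq> X \<Longrightarrow> digitally_continuous W Y f"
  unfolding digitally_continuous_def by blast

lemma insert_coord_shift:
  assumes "k < dim_vec t" "i \<le> dim_vec t"
  shows "insert_coord i e (shift t k d) = shift (insert_coord i e t) (insert_index i k) d"
  using assms by (intro eq_vecI) (auto simp: insert_coord_def shift_def insert_index_def)

lemma digitally_continuous_insert_coord:
  assumes e: "e = 0 \<or> e = 1" and i: "i \<le> q"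
  shows "digitally_continuous (unit_cube q) (unit_cube (Suc q)) (insert_coord i e)"
  unfolding digitally_continuous_def
proof (intro conjI ballI impI)
  show "insert_coord i e \<in> unit_cube q \<rightarrow> unit_cube (Suc q)"
    using insert_coord_in_unit_cube[OF _ e i] by blast
  fix s t assume s: "s \<in> unit_cube q" and "c1_adjacent s t"
  then obtain k d where "k < dim_vec s" "d = 1 \<or> d = -1" "t = shift s k d"
    unfolding c1_adjacent_iff_shift by blast
  then show "insert_coord i e s = insert_coord i e t \<or> c1_adjacent (insert_coord i e s) (insert_coord i e t)"
    using i by (simp add: insert_coord_shift c1_adjacent_shift insert_index_less dim_unit_cube[OF s])
qed

lemma chart_shift:
  assumes K: "finite K" "k \<in> K" and u: "dim_vec u = card K"
  shows "chart x K (shift u (rank K k) d) = shift (chart x K u) k d"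
  using assms rank_less[OF K(1)] rank_eq_iff[OF K(1) _ K(2)]
  by (intro eq_vecI) (auto simp: chart_def shift_def)

lemma digitally_continuous_chart:
  assumes K: "K \<subseteq> {..<dim_vec x}"
  shows "digitally_continuous (unit_cube (card K)) (lattice_cube x K) (chart x K)"
  unfolding digitally_continuous_def
proof (intro conjI ballI impI)
  have fin: "finite K" using K finite_subset by blast
  show "chart x K \<in> unit_cube (card K) \<rightarrow> lattice_cube x K"
    using chart_image_unit_cube[OF K] by blast
  fix s t assume s: "s \<in> unit_cube (card K)" and "c1_adjacent s t"
  then obtain m d where m: "m < dim_vec s" "d = 1 \<or> d = -1" "t = shift s m d"
    unfolding c1_adjacent_iff_shift by blast
  then obtain k where k: "k \<in> K" "rank K k = m"
    using obtain_rank[OF fin, of m] dim_unit_cube[OF s] by metis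
  have "chart x K t = shift (chart x K s) k d"
    using chart_shift[OF fin k(1) dim_unit_cube[OF s]] k(2) m(3) by simp
  then show "chart x K s = chart x K t \<or> c1_adjacent (chart x K s) (chart x K t)"
    using c1_adjacent_shift[of k "chart x K s" d] k(1) m(2) K by auto
qed

lemma cube_chain_cong:
  assumes "\<And>t. t \<in> unit_cube q \<Longrightarrow> \<sigma> t = \<tau> t"
  shows "cube_chain q \<sigma> = cube_chain q \<tau>"
proof -
  have "cube_presentation q \<sigma> M z \<pi> x \<longleftrightarrow> cube_presentation q \<tau> M z \<pi> x" for M z \<pi> x
    unfolding cube_presentation_def using assms by simp
  then have "orientation q \<sigma> = orientation q \<tau>"
    unfolding orientation_def by simp
  moreover have "inj_on \<sigma> (unit_cube q) = inj_on \<tau> (unit_cube q)"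
    using assms by (rule inj_on_cong)
  moreover have "\<sigma> ` unit_cube q = \<tau> ` unit_cube q"
    using assms by (intro image_cong refl)
  ultimately show ?thesis by (simp add: cube_chain_def)
qed

lemma presents_chart:
  assumes "K \<subseteq> {..<dim_vec x}"
  shows "presents (card K) (chart x K) x K (0\<^sub>v (card K)) id"
  unfolding presents_def
proof (intro conjI ballI)
  show "0\<^sub>v (card K) \<in> unit_cube (card K)"
    by (rule unit_cubeI) simp_all
  fix t assume t: "t \<in> unit_cube (card K)"
  have "add_mod2 (0\<^sub>v (card K)) (permute_coords id t) = t"
  proof (rule eq_vecI)
    fix i assume "i < dim_vec t"
    then show "add_mod2 (0\<^sub>v (card K)) (permute_coords id t) $ i = t $ i"
      using unit_cubeD[OF t, of i] dim_unit_cube[OF t] by (auto simp: add_mod2_def permute_coords_def)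
  qed simp
  then show "chart x K t = chart x K (add_mod2 (0\<^sub>v (card K)) (permute_coords id t))"
    by simp
qed (use assms permutes_id in simp_all)

lemma cube_chain_chart:
  assumes "K \<subseteq> {..<dim_vec x}"
  shows "cube_chain (card K) (chart x K) = frag_of (lattice_cube x K)"
proof -
  have "sym_sign (card K) (0\<^sub>v (card K)) id = 1"
    by (simp add: sym_sign_def cong: conj_cong)
  then show ?thesis
    by (simp add: cube_chain_presents[OF presents_chart[OF assms]])
qed

section \<open>Rigidity of injective singular cubes\<close>

text \<open>The square lemma behind rigidity. If \<open>b\<close> and \<open>c\<close> lie on
  opposite sides of \<open>a\<close> on one line, then \<open>a\<close> is their only common
  neighbour; if they leave \<open>a\<close> in different directions, the only other common neighbour
  is the fourth corner of the square.\<close>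

lemma common_neighbour:
  assumes b: "b = shift a i s" "s = 1 \<or> s = -1" "i < dim_vec a"
    and c: "c = shift a j r" "r = 1 \<or> r = -1" "j < dim_vec a"
    and w: "c1_adjacent b w" "c1_adjacent c w" "w \<noteq> a" and bc: "b \<noteq> c"
  shows "i \<noteq> j \<and> w = shift b j r"
proof -
  obtain k e where k: "k < dim_vec a" "e = 1 \<or> e = -1" "w = shift b k e"
    using w(1) b(1) unfolding c1_adjacent_iff_shift by auto
  obtain l d where l: "l < dim_vec a" "d = 1 \<or> d = -1" "w = shift c l d"
    using w(2) c(1) unfolding c1_adjacent_iff_shift by auto
  have w1: "w $ m = a $ m + (if m = i then s else 0) + (if m = k then e else 0)" if "m < dim_vec a" for m
    using that by (simp add: k(3) b(1) shift_def)
  have w2: "w $ m = a $ m + (if m = j then r else 0) + (if m = l then d else 0)" if "m < dim_vec a" for m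
    using that by (simp add: l(3) c(1) shift_def)
  have eq: "(if m = i then s else 0) + (if m = k then e else 0) =
      (if m = j then r else 0) + (if m = l then d else 0)" if "m < dim_vec a" for m
    using w1[OF that] w2[OF that] by linarith
  have "dim_vec w = dim_vec a" by (simp add: k(3) b(1))
  then have "\<exists>m<dim_vec a. w $ m \<noteq> a $ m"
    using w(3) by (metis eq_vecI)
  then obtain m where m: "m < dim_vec a" "w $ m \<noteq> a $ m" by blast
  \<comment> \<open>Both paths from \<open>a\<close> to \<open>w\<close> consist of two unit steps.
    If the second step undid the first, \<open>w\<close> would equal \<open>a\<close>.\<close>
  have ki: "k \<noteq> i \<or> e = s"
  proof (rule ccontr)
    assume "\<not> (k \<noteq> i \<or> e = s)"
    then have "k = i" "e = - s" using k(2) b(2) by auto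
    then show False using w1[OF m(1)] m(2) by (auto split: if_splits)
  qed
  have lj: "l \<noteq> j \<or> d = r"
  proof (rule ccontr)
    assume "\<not> (l \<noteq> j \<or> d = r)"
    then have "l = j" "d = - r" using l(2) c(2) by auto
    then show False using w2[OF m(1)] m(2) by (auto split: if_splits)
  qed
  have "i \<noteq> j"
  proof
    assume "i = j"
    then have "s = - r" using bc b c by auto
    then show False
      using eq[OF b(3)] \<open>i = j\<close> ki lj b(2) c(2) k(2) l(2) by (auto split: if_splits)
  qed
  moreover have "k = j \<and> e = r"
    using eq[OF b(3)] eq[OF c(3)] \<open>i \<noteq> j\<close> ki lj b(2) c(2) k(2) l(2) by (auto split: if_splits)
  ultimately show ?thesis using k(3) by simp
qed

text \<open>Vertices are indexed by sets of coordinates so that the rigidity proof can proceed by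
  induction on the set.\<close>

definition cube_vertex :: "nat \<Rightarrow> nat set \<Rightarrow> int vec" where
  "cube_vertex q S = vec q (\<lambda>i. if i \<in> S then 1 else 0)"

lemma cube_vertex_in_unit_cube: "cube_vertex q S \<in> unit_cube q"
  by (rule unit_cubeI) (simp_all add: cube_vertex_def)

lemma unit_cube_eq_cube_vertex:
  assumes "t \<in> unit_cube q"
  shows "t = cube_vertex q {i. i < q \<and> t $ i = 1}"
  using unit_cubeD[OF assms] dim_unit_cube[OF assms]
  by (intro eq_vecI) (auto simp: cube_vertex_def)

lemma cube_vertex_adjacent:
  assumes "i < q" "i \<notin> S"
  shows "c1_adjacent (cube_vertex q S) (cube_vertex q (insert i S))"
proof -
  have "cube_vertex q (insert i S) = shift (cube_vertex q S) i 1"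
    using assms by (intro eq_vecI) (auto simp: cube_vertex_def shift_def)
  then show ?thesis
    using assms by (simp add: c1_adjacent_shift cube_vertex_def)
qed

lemma cube_vertex_neq:
  assumes "i < q" "i \<in> S" "i \<notin> T"
  shows "cube_vertex q S \<noteq> cube_vertex q T"
proof
  assume "cube_vertex q S = cube_vertex q T"
  from arg_cong[OF this, of "\<lambda>v. v $ i"] show False
    using assms by (simp add: cube_vertex_def)
qed

text \<open>\<open>p\<close> is the image of the origin, and the edge from the origin in coordinate
  i is sent to direction \<open>d i\<close> with sign \<open>s (d i)\<close>. The other vertices are
  forced by induction: for distinct i, j in \<open>S\<close>, the images of S - {i, j}, S - {i} and
  S - {j} are known, and by injectivity \<open>common_neighbour\<close> leaves one place for the
  image of \<open>S\<close>.\<close>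

lemma injective_singular_cube_vertices:
  assumes \<sigma>: "digitally_continuous (unit_cube q) Y \<sigma>" and inj: "inj_on \<sigma> (unit_cube q)"
  obtains p d s where "inj_on d {..<q}" "d ` {..<q} \<subseteq> {..<dim_vec p}"
    "\<forall>i<q. s (d i) = 1 \<or> s (d i) = (-1::int)"
    "\<forall>S\<subseteq>{..<q}. \<sigma> (cube_vertex q S) =
       vec (dim_vec p) (\<lambda>a. p $ a + (if a \<in> d ` S then s a else 0))"
proof -
  let ?v = "\<lambda>S. \<sigma> (cube_vertex q S)"
  define p where "p = ?v {}"
  have neq: "?v S \<noteq> ?v T" if "i < q" "i \<in> S" "i \<notin> T" for S T i
    using inj_onD[OF inj _ cube_vertex_in_unit_cube cube_vertex_in_unit_cube] cube_vertex_neq[OF that] by blast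
  have adj: "c1_adjacent (?v S) (?v (insert i S))" if "i < q" "i \<notin> S" for S i
    using digitally_continuousD(2)[OF \<sigma> cube_vertex_in_unit_cube cube_vertex_in_unit_cube cube_vertex_adjacent[OF that]]
      neq[of i "insert i S" S] that by auto
  have "\<forall>i. \<exists>k e. i < q \<longrightarrow> k < dim_vec p \<and> (e = 1 \<or> e = -1) \<and> ?v {i} = shift p k e"
    using adj[of _ "{}"] unfolding c1_adjacent_iff_shift p_def by blast
  then obtain d e where de: "\<And>i. i < q \<Longrightarrow> d i < dim_vec p \<and> (e i = 1 \<or> e i = -1) \<and> ?v {i} = shift p (d i) (e i)"
    by metis
  \<comment> \<open>Two edges from the origin cannot share a direction: the image of {i, j} is a
    common neighbour of their ends other than \<open>p\<close>.\<close>
  have inj_d: "inj_on d {..<q}"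
  proof (rule inj_onI, rule ccontr)
    fix i j assume ij: "i \<in> {..<q}" "j \<in> {..<q}" "d i = d j" "i \<noteq> j"
    have "d i \<noteq> d j \<and> ?v {i, j} = shift (?v {i}) (d j) (e j)"
    proof (rule common_neighbour[of "?v {i}" p "d i" "e i" "?v {j}" "d j" "e j"])
      show "c1_adjacent (?v {i}) (?v {i, j})"
        using adj[of j "{i}"] ij by (simp add: insert_commute)
      show "c1_adjacent (?v {j}) (?v {i, j})"
        using adj[of i "{j}"] ij by simp
      show "?v {i, j} \<noteq> p"
        unfolding p_def using neq[of i "{i, j}" "{}"] ij by simp
      show "?v {i} \<noteq> ?v {j}"
        using neq[of i "{i}" "{j}"] ij by simp
    qed (use de ij in auto)
    then show False using ij by blast
  qed
  \<comment> \<open>The sign is indexed by the direction in the image, not by the coordinate of the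
    cube, because the closed formula is read coordinatewise in the image.\<close>
  define s where "s = (\<lambda>a. e (the_inv_into {..<q} d a))"
  have s: "s (d i) = e i" if "i < q" for i
    using that by (simp add: s_def the_inv_into_f_f[OF inj_d])
  let ?B = "\<lambda>S. vec (dim_vec p) (\<lambda>a. p $ a + (if a \<in> d ` S then s a else 0))"
  have B_insert: "?B (insert i S) = shift (?B S) (d i) (e i)" if "S \<subseteq> {..<q}" "i < q" "i \<notin> S" for S i
  proof -
    have "d i \<notin> d ` S"
      using that inj_onD[OF inj_d, of i] by fastforce
    then show ?thesis
      using that s by (intro eq_vecI) (auto simp: shift_def)
  qed
  have B0: "?B {} = p" by (intro eq_vecI) simp_all
  have v: "?v S = ?B S" if "S \<subseteq> {..<q}" for S
  proof -
    have "finite S" using that finite_subset by blast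
    then show ?thesis using that
    proof (induction S rule: finite_psubset_induct)
      case (psubset S)
      show ?case
      proof (cases "S = {}")
        case True
        then show ?thesis using B0 p_def by simp
      next
        case False
        then obtain i where i: "i \<in> S" by blast
        define T where "T = S - {i}"
        have T: "S = insert i T" "i \<notin> T" "i < q" "T \<subset> S" "T \<subseteq> {..<q}"
          using i psubset.prems by (auto simp: T_def)
        show ?thesis
        proof (cases "T = {}")
          case True
          then show ?thesis
            using B_insert[of "{}" i] T(1,3) B0 de[OF T(3)] by simp
        next
          case False
          then obtain j where j: "j \<in> T" by blast
          define U where "U = T - {j}"
          have U: "T = insert j U" "j \<notin> U" "j < q" "U \<subset> S" "U \<subseteq> {..<q}" "i \<notin> U" "i \<noteq> j"
            "insert i U \<subset> S" "insert i U \<subseteq> {..<q}"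
            using j T by (auto simp: U_def)
          have IH: "?v U = ?B U" "?v T = ?B T" "?v (insert i U) = ?B (insert i U)"
            using psubset.IH[OF U(4) U(5)] psubset.IH[OF T(4) T(5)] psubset.IH[OF U(8) U(9)] by auto
          have vT: "?v T = shift (?v U) (d j) (e j)"
            unfolding IH using B_insert[OF U(5,3,2)] U(1) by simp
          have vi: "?v (insert i U) = shift (?v U) (d i) (e i)"
            unfolding IH using B_insert[OF U(5) T(3) U(6)] by simp
          have dimU: "dim_vec (?v U) = dim_vec p" unfolding IH by simp
          have "d j \<noteq> d i \<and> ?v S = shift (?v T) (d i) (e i)"
          proof (rule common_neighbour[OF vT _ _ vi])
            show "c1_adjacent (?v T) (?v S)"
              using adj[OF T(3,2)] T(1) by simp
            show "c1_adjacent (?v (insert i U)) (?v S)"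
              using adj[of j "insert i U"] U T(1) by (simp add: insert_commute)
            show "?v S \<noteq> ?v U" using neq[OF T(3) i U(6)] .
            show "?v T \<noteq> ?v (insert i U)" using neq[OF U(3) j, of "insert i U"] U(2,7) by auto
          qed (use de[OF T(3)] de[OF U(3)] dimU in auto)
          then show ?thesis
            unfolding IH using B_insert[OF T(5,3,2)] T(1) by simp
        qed
      qed
    qed
  qed
  show thesis
  proof (rule that[of d p s])
    show "d ` {..<q} \<subseteq> {..<dim_vec p}" using de by blast
    show "\<forall>i<q. s (d i) = 1 \<or> s (d i) = -1"
      using s de by simp
  qed (use inj_d v in blast)+
qed

text \<open>The map i \<mapsto> rank of \<open>d i\<close> tells where coordinate i goes. A
  presentation records the opposite information, namely which coordinate each position reads, so
  \<pi> is the inverse of this map.\<close>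

lemma injective_singular_cube_presents:
  assumes \<sigma>: "digitally_continuous (unit_cube q) Y \<sigma>" and inj: "inj_on \<sigma> (unit_cube q)"
  obtains x K z \<pi> where "presents q \<sigma> x K z \<pi>"
proof -
  obtain p d s where inj_d: "inj_on d {..<q}" and dp: "d ` {..<q} \<subseteq> {..<dim_vec p}"
    and s: "\<forall>i<q. s (d i) = 1 \<or> s (d i) = (-1::int)"
    and v: "\<forall>S\<subseteq>{..<q}. \<sigma> (cube_vertex q S) =
       vec (dim_vec p) (\<lambda>a. p $ a + (if a \<in> d ` S then s a else 0))"
    by (rule injective_singular_cube_vertices[OF assms])
  define K where "K = d ` {..<q}"
  have K: "finite K" "card K = q" "K \<subseteq> {..<dim_vec p}"
    using inj_d dp by (simp_all add: K_def card_image)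
  define \<rho> where "\<rho> = (\<lambda>i. if i < q then rank K (d i) else i)"
  have "bij_betw d {..<q} K"
    using inj_d by (simp add: bij_betw_def K_def)
  from bij_betw_trans[OF this bij_betw_rank[OF K(1)]]
  have "bij_betw (rank K \<circ> d) {..<q} {..<q}"
    using K(2) by simp
  then have "bij_betw \<rho> {..<q} {..<q}"
    by (rule bij_betw_cong[THEN iffD1, rotated]) (simp add: \<rho>_def)
  then have \<rho>: "\<rho> permutes {..<q}"
    by (rule bij_imp_permutes) (simp add: \<rho>_def)
  define \<pi> where "\<pi> = inv_into UNIV \<rho>"
  have \<pi>: "\<pi> permutes {..<q}"
    unfolding \<pi>_def by (rule permutes_inv[OF \<rho>])
  have \<pi>_rank: "\<pi> (rank K (d i)) = i" if "i < q" for i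
  proof -
    have "\<rho> i = rank K (d i)" using that by (simp add: \<rho>_def)
    then show ?thesis
      unfolding \<pi>_def using permutes_inverses(2)[OF \<rho>, of i] by simp
  qed
  \<comment> \<open>Along a direction of sign -1 the image runs from \<open>p $ a\<close> down to
    \<open>p $ a - 1\<close>. The minimal vertex is lowered there, and \<open>z\<close> flips the
    corresponding position.\<close>
  define x where "x = vec (dim_vec p) (\<lambda>a. if a \<in> K \<and> s a = -1 then p $ a - 1 else p $ a)"
  define z where "z = vec q (\<lambda>j. if s (d (\<pi> j)) = -1 then 1 else (0::int))"
  have "presents q \<sigma> x K z \<pi>"
    unfolding presents_def
  proof (intro conjI ballI)
    show "K \<subseteq> {..<dim_vec x}" using K(3) by (simp add: x_def)
    show "z \<in> unit_cube q" by (rule unit_cubeI) (simp_all add: z_def)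
    fix t assume t: "t \<in> unit_cube q"
    define S where "S = {i. i < q \<and> t $ i = 1}"
    have tS: "\<sigma> t = vec (dim_vec p) (\<lambda>a. p $ a + (if a \<in> d ` S then s a else 0))"
      using v[rule_format, of S] unit_cube_eq_cube_vertex[OF t] by (auto simp: S_def)
    show "\<sigma> t = chart x K (add_mod2 z (permute_coords \<pi> t))"
    proof (rule eq_vecI)
      fix a assume "a < dim_vec (chart x K (add_mod2 z (permute_coords \<pi> t)))"
      then have a: "a < dim_vec p" by (simp add: x_def)
      show "\<sigma> t $ a = chart x K (add_mod2 z (permute_coords \<pi> t)) $ a"
      proof (cases "a \<in> K")
        case False
        then have "a \<notin> d ` S" by (auto simp: K_def S_def)
        then show ?thesis
          using a False by (simp add: tS chart_def x_def)
      next
        case True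
        then obtain i where i: "i < q" "a = d i" by (auto simp: K_def)
        have r: "rank K (d i) < q" using rank_less[OF K(1)] True i K(2) by simp
        have "a \<in> d ` S \<longleftrightarrow> t $ i = 1"
        proof
          assume "a \<in> d ` S"
          then obtain i' where "i' < q" "t $ i' = 1" "d i = d i'" using i by (auto simp: S_def)
          then show "t $ i = 1" using inj_onD[OF inj_d, of i i'] i by simp
        qed (use i in \<open>auto simp: S_def\<close>)
        then have "\<sigma> t $ a = p $ a + (if t $ i = 1 then s a else 0)"
          using a by (simp add: tS)
        moreover have "chart x K (add_mod2 z (permute_coords \<pi> t)) $ a =
            (if s a = -1 then p $ a - 1 else p $ a) + ((if s a = -1 then 1 else 0) + t $ i) mod 2"
          using a True r i(1) \<pi>_rank[OF i(1)] dim_unit_cube[OF t] unfolding i(2)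
          by (simp add: chart_def x_def z_def add_mod2_def permute_coords_def)
        ultimately show ?thesis
          using s[rule_format, OF i(1)] unit_cubeD[OF t i(1)] unfolding i(2) by auto
      qed
    qed (simp add: tS x_def)
  qed (use K(2) \<pi> in simp_all)
  then show thesis by (rule that)
qed

section \<open>Vanishing of the double boundary\<close>

text \<open>The index pairs (i, j) with i \<le> j and (j + 1, i) carry the same value with exponents
  differing by one, and they match the two triangles of the index range bijectively.\<close>

lemma alternating_double_sum:
  fixes H :: "nat \<Rightarrow> nat \<Rightarrow> c1_chain"
  assumes "\<And>i j. i \<le> j \<Longrightarrow> j < n \<Longrightarrow> H (Suc j) i = H i j"
  shows "(\<Sum>i<Suc n. \<Sum>j<n. frag_cmul ((-1) ^ (i + j)) (H i j)) = 0"
proof -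
  define g where "g = (\<lambda>(i, j). frag_cmul ((-1) ^ (i + j)) (H i j))"
  let ?U = "{(i, j). i \<le> j \<and> j < n}" and ?L = "{(i, j). j < i \<and> i < Suc n}"
  have fin: "finite ?U" "finite ?L"
    by (auto intro: finite_subset[of _ "{..<Suc n} \<times> {..<Suc n}"])
  have un: "{..<Suc n} \<times> {..<n} = ?U \<union> ?L" by auto
  have "(\<Sum>i<Suc n. \<Sum>j<n. frag_cmul ((-1) ^ (i + j)) (H i j)) = sum g ({..<Suc n} \<times> {..<n})"
    by (simp add: sum.cartesian_product g_def)
  also have "\<dots> = sum g ?U + sum g ?L"
    unfolding un by (rule sum.union_disjoint[OF fin]) auto
  also have "?L = (\<lambda>(i, j). (Suc j, i)) ` ?U"
  proof (intro equalityI subsetI)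
    fix p assume "p \<in> ?L"
    then obtain i j where "p = (Suc i, j)" "j \<le> i" "i < n"
      by (auto simp: less_Suc_eq_le gr0_conv_Suc elim: less_natE)
    then show "p \<in> (\<lambda>(i, j). (Suc j, i)) ` ?U" by force
  qed auto
  also have "sum g ((\<lambda>(i, j). (Suc j, i)) ` ?U) = (\<Sum>p\<in>?U. g ((\<lambda>(i, j). (Suc j, i)) p))"
    by (subst sum.reindex) (auto simp: inj_on_def)
  also have "\<dots> = (\<Sum>p\<in>?U. - g p)"
    using assms by (intro sum.cong) (auto simp: g_def add.commute)
  finally show ?thesis by (simp add: sum_negf)
qed

lemma insert_coord_insert_coord:
  assumes "i \<le> j" "j \<le> dim_vec t"
  shows "insert_coord (Suc j) d (insert_coord i e t) = insert_coord i e (insert_coord j d t)"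
  using assms by (intro eq_vecI) (auto simp: insert_coord_def)

text \<open>The cubical identity \<open>insert_coord_insert_coord\<close> is the symmetry that
  \<open>alternating_double_sum\<close> asks for. For n = 0 the inner sum is empty, so the truncated
  \<open>n - 1\<close> does no harm.\<close>

lemma singular_boundary_boundary:
  "singular_boundary (Suc n) (singular_boundary n (cube_chain (n - 1))) \<sigma> = 0"
proof -
  define G where "G = (\<lambda>i e j d. cube_chain (n - 1) (\<sigma> \<circ> insert_coord i e \<circ> insert_coord j d))"
  define H where "H = (\<lambda>i j. (G i 0 j 0 - G i 0 j 1) - (G i 1 j 0 - G i 1 j 1))"
  have G: "G (Suc j) d i e = G i e j d" if "i \<le> j" "j < n" for i j d e
    unfolding G_def
  proof (rule cube_chain_cong)
    fix t assume "t \<in> unit_cube (n - 1)"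
    then have "j \<le> dim_vec t"
      using that(2) dim_unit_cube[of t "n - 1"] by linarith
    then show "(\<sigma> \<circ> insert_coord (Suc j) d \<circ> insert_coord i e) t =
        (\<sigma> \<circ> insert_coord i e \<circ> insert_coord j d) t"
      unfolding o_apply by (rule arg_cong[OF insert_coord_insert_coord[OF that(1)]])
  qed
  have "H (Suc j) i = H i j" if "i \<le> j" "j < n" for i j
    unfolding H_def G[OF that] by simp
  then have "(\<Sum>i<Suc n. \<Sum>j<n. frag_cmul ((-1) ^ (i + j)) (H i j)) = 0"
    by (rule alternating_double_sum)
  moreover have "singular_boundary (Suc n) (singular_boundary n (cube_chain (n - 1))) \<sigma> =
      (\<Sum>i<Suc n. \<Sum>j<n. frag_cmul ((-1) ^ (i + j)) (H i j))"
    unfolding singular_boundary_def sum_subtractf[symmetric] frag_cmul_sum frag_cmul_cmul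
      frag_cmul_diff_right[symmetric] H_def G_def
    by (intro sum.cong refl) (simp add: frag_cmul_diff_right power_add)
  ultimately show ?thesis by simp
qed

section \<open>Boundaries of singular cubes\<close>

lemma singular_boundary_cong:
  assumes "\<And>i e. i < q \<Longrightarrow> e = 0 \<or> e = 1 \<Longrightarrow> h (\<sigma> \<circ> insert_coord i e) = h' (\<sigma>' \<circ> insert_coord i e)"
  shows "singular_boundary q h \<sigma> = singular_boundary q h' \<sigma>'"
  unfolding singular_boundary_def using assms by (intro sum.cong) simp_all

lemma frag_extend_singular_boundary:
  "frag_extend f (singular_boundary q h \<sigma>) = singular_boundary q (\<lambda>\<tau>. frag_extend f (h \<tau>)) \<sigma>"
  by (simp add: singular_boundary_def frag_extend_sum frag_extend_cmul frag_extend_diff del: power_Suc)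

lemma chain_boundary_singular_boundary:
  "chain_boundary (singular_boundary q h \<sigma>) = singular_boundary q (\<lambda>\<tau>. chain_boundary (h \<tau>)) \<sigma>"
  unfolding chain_boundary_def by (rule frag_extend_singular_boundary)

lemma cube_boundary_eq_singular_boundary:
  assumes K: "K \<subseteq> {..<dim_vec x}" "card K = Suc n"
  shows "cube_boundary (lattice_cube x K) = singular_boundary (Suc n) (cube_chain n) (chart x K)"
  using chain_boundary_presents[of n "chart x K" x K] presents_chart[OF K(1)] cube_chain_chart[OF K(1)] K(2)
  by (simp add: chain_boundary_def)

lemma cube_boundary_vertex: "finite K \<Longrightarrow> card K = 0 \<Longrightarrow> K \<subseteq> {..<dim_vec x} \<Longrightarrow> cube_boundary (lattice_cube x K) = 0"
  by (simp add: cube_boundary_lattice_cube)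

text \<open>A chart and all its faces are presented, so \<open>chain_boundary_presents\<close>
  applies at both levels. The commutation for arbitrary singular cubes would be circular here, as
  its proof rests on this lemma.\<close>

lemma chain_boundary_cube_boundary:
  assumes "elementary_cube q Q"
  shows "chain_boundary (cube_boundary Q) = 0"
proof -
  obtain x K where K: "K \<subseteq> {..<dim_vec x}" "card K = q" and Q: "Q = lattice_cube x K"
    using elementary_cubeE[OF assms] .
  have fin: "finite K" using K finite_subset by blast
  show ?thesis
  proof (cases q)
    case 0
    then show ?thesis
      using cube_boundary_vertex[OF fin _ K(1)] K(2) by (simp add: Q chain_boundary_def)
  next
    case (Suc n)
    have p: "presents (Suc n) (chart x K) x K (0\<^sub>v (Suc n)) id"
      using presents_chart[OF K(1)] K(2) Suc by simp
    have "chain_boundary (cube_boundary Q) =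
        singular_boundary (Suc n) (\<lambda>\<tau>. chain_boundary (cube_chain n \<tau>)) (chart x K)"
      unfolding Q cube_boundary_eq_singular_boundary[OF K(1) K(2)[unfolded Suc]]
      by (rule chain_boundary_singular_boundary)
    also have "\<dots> = 0"
    proof (cases n)
      case 0
      have "chain_boundary (cube_chain 0 (chart x K \<circ> insert_coord i e)) = 0"
        if i: "i < Suc 0" and e: "e = 0 \<or> e = 1" for i e
      proof -
        obtain k where k: "k \<in> K" "rank K k = i"
          using obtain_rank[OF fin, of i] i K(2) Suc 0 by auto
        from presents_face(1)[OF p e k(1)] have "presents 0 (chart x K \<circ> insert_coord i e)
            (shift x k ((0\<^sub>v (Suc n) $ i + e) mod 2)) (K - {k})
            (vec 0 (\<lambda>b. 0\<^sub>v (Suc n) $ insert_index i b)) (permutation_delete id i)"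
          unfolding k(2) 0 by simp
        moreover have "K - {k} \<subseteq> {..<dim_vec x}" using K(1) by blast
        ultimately show ?thesis
          using cube_boundary_vertex[of "K - {k}" "shift x k ((0\<^sub>v (Suc n) $ i + e) mod 2)"]
            fin K Suc 0 k(1) by (simp add: cube_chain_presents chain_boundary_def frag_extend_cmul)
      qed
      then show ?thesis
        unfolding 0 by (simp add: singular_boundary_def)
    next
      case (Suc m)
      have "singular_boundary (Suc n) (\<lambda>\<tau>. chain_boundary (cube_chain n \<tau>)) (chart x K) =
          singular_boundary (Suc n) (singular_boundary n (cube_chain (n - 1))) (chart x K)"
      proof (rule singular_boundary_cong)
        fix i :: nat and e :: int assume i: "i < Suc n" and e: "e = 0 \<or> e = 1"
        obtain k where k: "k \<in> K" "rank K k = i"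
          using obtain_rank[OF fin, of i] i K(2) \<open>q = Suc n\<close> by auto
        from presents_face(1)[OF p e k(1)]
        show "chain_boundary (cube_chain n (chart x K \<circ> insert_coord i e)) =
            singular_boundary n (cube_chain (n - 1)) (chart x K \<circ> insert_coord i e)"
          unfolding k(2) Suc by (simp add: chain_boundary_presents)
      qed
      then show ?thesis by (simp only: singular_boundary_boundary)
    qed
    finally show ?thesis .
  qed
qed

lemma frag_extend_compose_eq_0:
  assumes "\<And>Q. Q \<in> Poly_Mapping.keys c \<Longrightarrow> frag_extend g (f Q) = 0"
  shows "frag_extend g (frag_extend f c) = 0"
  unfolding frag_extend_def[of f] using assms
  by (simp add: frag_extend_sum frag_extend_cmul)

lemma chain_boundary_boundary:
  assumes "c \<in> carrier (chain_group q X)"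
  shows "chain_boundary (chain_boundary c) = 0"
  using assms chain_boundary_cube_boundary unfolding chain_group_def chain_boundary_def
  by (intro frag_extend_compose_eq_0) auto

section \<open>Faces of elementary cubes and cycles of small support\<close>

lemma keys_cube_boundary:
  assumes K: "K \<subseteq> {..<dim_vec x}" and R: "R \<in> Poly_Mapping.keys (cube_boundary (lattice_cube x K))"
  obtains l e where "l \<in> K" "e = 0 \<or> e = 1" "R = lattice_cube (shift x l e) (K - {l})"
proof -
  have "\<exists>l\<in>K. R \<in> Poly_Mapping.keys (frag_cmul ((-1) ^ Suc (rank K l))
       (frag_of (lattice_cube x (K - {l})) - frag_of (lattice_cube (shift x l 1) (K - {l}))))"
    using subsetD[OF keys_sum R[unfolded cube_boundary_lattice_cube[OF K]]] by (simp only: UN_iff)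
  then obtain l where l: "l \<in> K" "R \<in> Poly_Mapping.keys
       (frag_of (lattice_cube x (K - {l})) - frag_of (lattice_cube (shift x l 1) (K - {l})))"
    by auto
  then have "R = lattice_cube (shift x l 0) (K - {l}) \<or> R = lattice_cube (shift x l 1) (K - {l})"
    using keys_diff[of "frag_of (lattice_cube x (K - {l}))" "frag_of (lattice_cube (shift x l 1) (K - {l}))"]
    by auto
  then show thesis using that l(1) by blast
qed

lemma face_subset:
  assumes "l \<in> K" "e = 0 \<or> e = 1"
  shows "lattice_cube (shift x l e) (K - {l}) \<subseteq> lattice_cube x K"
proof
  fix y assume y: "y \<in> lattice_cube (shift x l e) (K - {l})"
  have "y $ i = x $ i \<or> i \<in> K \<and> y $ i = x $ i + 1" if "i < dim_vec x" for i
  proof -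
    have "y $ i = shift x l e $ i \<or> i \<in> K - {l} \<and> y $ i = shift x l e $ i + 1"
      using y that unfolding lattice_cube_def by simp
    then show ?thesis
      using that assms by (cases "i = l") (auto simp: shift_def)
  qed
  then show "y \<in> lattice_cube x K"
    using y unfolding lattice_cube_def by simp
qed

lemma shift_mem_lattice_cube:
  assumes "y \<in> lattice_cube x K" "k \<in> K" "k < dim_vec x" "y $ k = x $ k" "e = 0 \<or> e = 1"
  shows "shift y k e \<in> lattice_cube x K"
  unfolding lattice_cube_def
proof (intro CollectI conjI allI impI)
  show "shift y k e \<in> carrier_vec (dim_vec x)"
    using assms(1) unfolding lattice_cube_def by (simp add: shift_in_carrier)
  fix i assume i: "i < dim_vec x"
  then have "i < dim_vec y" "y $ i = x $ i \<or> i \<in> K \<and> y $ i = x $ i + 1"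
    using assms(1) unfolding lattice_cube_def by auto
  then show "shift y k e $ i = x $ i \<or> i \<in> K \<and> shift y k e $ i = x $ i + 1"
    using assms(2,4,5) by (cases "i = k") (auto simp: shift_def)
qed

text \<open>No other face coincides with this one: another front face lacks a different direction,
  and a back face has a different minimal vertex. Hence only one summand contributes.\<close>

lemma lookup_cube_boundary_front:
  assumes K: "K \<subseteq> {..<dim_vec x}" and k: "k \<in> K"
  shows "poly_mapping.lookup (cube_boundary (lattice_cube x K)) (lattice_cube x (K - {k})) = (-1) ^ Suc (rank K k)"
proof -
  have fin: "finite K" using K finite_subset by blast
  have "poly_mapping.lookup (cube_boundary (lattice_cube x K)) (lattice_cube x (K - {k})) =
    (\<Sum>l\<in>K. if l = k then (-1) ^ Suc (rank K l) else 0)"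
    unfolding cube_boundary_lattice_cube[OF K] lookup_sum
  proof (rule sum.cong[OF refl])
    fix l assume l: "l \<in> K"
    have "lattice_cube x (K - {k}) = lattice_cube x (K - {l}) \<longleftrightarrow> l = k"
      using K l k by (subst lattice_cube_eq_iff) auto
    moreover have "lattice_cube x (K - {k}) \<noteq> lattice_cube (shift x l 1) (K - {l})"
    proof
      assume "lattice_cube x (K - {k}) = lattice_cube (shift x l 1) (K - {l})"
      then have "x = shift x l 1"
        using K by (subst (asm) lattice_cube_eq_iff) auto
      from arg_cong[OF this, of "\<lambda>v. v $ l"] show False
        using l K by (auto simp: shift_def)
    qed
    ultimately show "poly_mapping.lookup (frag_cmul ((-1) ^ Suc (rank K l))
       (frag_of (lattice_cube x (K - {l})) - frag_of (lattice_cube (shift x l 1) (K - {l}))))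
       (lattice_cube x (K - {k})) = (if l = k then (-1) ^ Suc (rank K l) else 0)"
      by (simp add: lookup_minus del: power_Suc)
  qed
  also have "\<dots> = (-1) ^ Suc (rank K k)"
    using fin k by simp
  finally show ?thesis .
qed

lemma cube_boundary_nonzero:
  assumes "elementary_cube (Suc q) Q"
  shows "cube_boundary Q \<noteq> 0"
proof -
  obtain x K where K: "K \<subseteq> {..<dim_vec x}" "card K = Suc q" and Q: "Q = lattice_cube x K"
    using elementary_cubeE[OF assms] .
  then obtain k where "k \<in> K" by fastforce
  from lookup_cube_boundary_front[OF K(1) this] show ?thesis
    unfolding Q by auto
qed

text \<open>A face in a direction other than \<open>k\<close> extends in direction \<open>k\<close>
  as far as the whole cube, so it exceeds height \<open>a\<close> whenever the cube does. The back
  face in direction \<open>k\<close> lies at the top of the cube and exceeds \<open>a\<close> as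
  well, which leaves the front face.\<close>

lemma lower_face:
  assumes K: "K \<subseteq> {..<dim_vec x}" and R: "R \<in> Poly_Mapping.keys (cube_boundary (lattice_cube x K))"
    and low: "\<forall>y\<in>R. y $ k \<le> a" and high: "\<exists>y\<in>lattice_cube x K. a < y $ k" and k: "k < dim_vec x"
  shows "k \<in> K" "x $ k = a" "R = lattice_cube x (K - {k})"
proof -
  obtain l e where l: "l \<in> K" "e = 0 \<or> e = 1" and R: "R = lattice_cube (shift x l e) (K - {l})"
    using keys_cube_boundary[OF K R] .
  obtain y where y: "y \<in> lattice_cube x K" "a < y $ k" using high by blast
  have yk: "y $ k = x $ k \<or> k \<in> K \<and> y $ k = x $ k + 1"
    using y(1) k unfolding lattice_cube_def by blast
  have base: "shift x l e \<in> R"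
    unfolding R by (rule mem_lattice_cube_self)
  have "l = k"
  proof (rule ccontr)
    assume lk: "l \<noteq> k"
    then have "x $ k \<le> a"
      using low base k by (auto simp: shift_def)
    then have kK: "k \<in> K" "y $ k = x $ k + 1" using y(2) yk by auto
    have "shift (shift x l e) k 1 \<in> R"
      unfolding R using kK lk k by (intro shift_mem_lattice_cube mem_lattice_cube_self) auto
    then have "x $ k + 1 \<le> a"
      using low lk k by (force simp: shift_def)
    then show False using kK y(2) by simp
  qed
  then show "k \<in> K" using l by simp
  have "x $ k + e \<le> a"
    using low base k \<open>l = k\<close> by (auto simp: shift_def)
  then have "e = 0 \<and> x $ k = a"
    using yk y(2) l(2) by auto
  then show "x $ k = a" "R = lattice_cube x (K - {k})"
    using R \<open>l = k\<close> by simp_all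
qed

text \<open>The sum of the coefficients, with values in the free abelian group on one generator so
  that it is again a \<open>frag_extend\<close>. It replaces the cycle condition in dimension 0,
  where that condition is empty.\<close>

definition augmentation :: "c1_chain \<Rightarrow> (unit \<Rightarrow>\<^sub>0 int)" where
  "augmentation = frag_extend (\<lambda>_. frag_of ())"

lemma augmentation_chain_boundary:
  assumes "c \<in> carrier (chain_group q X)"
  shows "augmentation (chain_boundary c) = 0"
  unfolding augmentation_def chain_boundary_def
proof (rule frag_extend_compose_eq_0)
  fix Q assume "Q \<in> Poly_Mapping.keys c"
  then have "elementary_cube q Q" using assms by (auto simp: chain_group_def)
  then obtain x K where K: "K \<subseteq> {..<dim_vec x}" and Q: "Q = lattice_cube x K"
    by (rule elementary_cubeE)
  have "finite K" using K finite_subset by blast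
  then show "frag_extend (\<lambda>_. frag_of ()) (cube_boundary Q) = 0"
    unfolding Q cube_boundary_lattice_cube[OF K]
    by (simp add: frag_extend_sum frag_extend_cmul frag_extend_diff)
qed

lemma lookup_frag_extend:
  "poly_mapping.lookup (frag_extend f c) R =
    (\<Sum>Q\<in>Poly_Mapping.keys c. poly_mapping.lookup c Q * poly_mapping.lookup (f Q) R)"
  by (simp add: frag_extend_def lookup_sum)

lemma keys_chain_boundaryE:
  assumes "c \<in> carrier (chain_group q X)" "R \<in> Poly_Mapping.keys (chain_boundary c)"
  obtains x K where "K \<subseteq> {..<dim_vec x}" "card K = q" "lattice_cube x K \<in> Poly_Mapping.keys c"
    "lattice_cube x K \<subseteq> X" "R \<in> Poly_Mapping.keys (cube_boundary (lattice_cube x K))"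
proof -
  obtain Q where Q: "Q \<in> Poly_Mapping.keys c" "R \<in> Poly_Mapping.keys (cube_boundary Q)"
    using assms(2) keys_frag_extend[of cube_boundary c] unfolding chain_boundary_def by blast
  then have "elementary_cube q Q" "Q \<subseteq> X"
    using assms(1) by (auto simp: chain_group_def)
  then show thesis
    using that Q by (metis elementary_cubeE)
qed

text \<open>Cutting a cycle by the hyperplane \<open>x\<^sub>k = a\<close> yields a cycle of dimension one less. It lives on
  points \<open>y\<close> for which both \<open>y\<close> and its upper neighbour belong to the support, whence the factor
  \<open>2\<close> in the bound.\<close>

lemma small_support_cycle_eq_0:
  assumes "finite S" "S \<subseteq> carrier_vec m" "c \<in> carrier (chain_group q S)"
    "chain_boundary c = 0" "q = 0 \<Longrightarrow> augmentation c = 0" "card S < 2 ^ Suc q"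
  shows "c = 0"
  using assms
proof (induction q arbitrary: S c)
  case 0
  \<comment> \<open>Fewer than two points are available, so all of \<open>c\<close> sits on one
    vertex and the augmentation reads off its coefficient.\<close>
  have elem: "\<exists>x\<in>S. Q = {x} \<and> S = {x}" if Q: "Q \<in> Poly_Mapping.keys c" for Q
  proof -
    have "elementary_cube 0 Q" and QS: "Q \<subseteq> S"
      using 0(3) Q by (auto simp: chain_group_def)
    then obtain x K where K: "K \<subseteq> {..<dim_vec x}" "card K = 0" and Qx: "Q = lattice_cube x K"
      by (elim elementary_cubeE)
    have "K = {}" using K finite_subset[OF K(1)] by simp
    then have "Q = {x}"
      unfolding Qx by (auto simp: lattice_cube_def intro!: eq_vecI)
    moreover have "S = {x}"
    proof -
      have "card S \<le> 1" using 0(6) by simp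
      then show ?thesis
        using QS \<open>Q = {x}\<close> 0(1) card_le_Suc0_iff_eq[OF 0(1)] by auto
    qed
    ultimately show ?thesis by blast
  qed
  show ?case
  proof (rule ccontr)
    assume "c \<noteq> 0"
    then obtain Q where Q: "Q \<in> Poly_Mapping.keys c"
      by (metis all_not_in_conv keys_eq_empty)
    have "Q' = Q" if "Q' \<in> Poly_Mapping.keys c" for Q'
      using elem[OF Q] elem[OF that] by auto
    then have keys: "Poly_Mapping.keys c = {Q}"
      using Q by blast
    have "augmentation c = frag_cmul (poly_mapping.lookup c Q) (frag_of ())"
      by (simp add: augmentation_def frag_extend_def keys)
    then have "poly_mapping.lookup c Q = 0"
      using 0(5) by simp
    then show False using Q by (simp add: in_keys_iff)
  qed
next
  case (Suc q)
  show ?case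
  proof (rule ccontr)
    assume "c \<noteq> 0"
    then obtain Q0 where Q0: "Q0 \<in> Poly_Mapping.keys c"
      by (metis all_not_in_conv keys_eq_empty)
    then have "elementary_cube (Suc q) Q0" and Q0S: "Q0 \<subseteq> S"
      using Suc.prems(3) by (auto simp: chain_group_def)
    then obtain x0 K0 where K0: "K0 \<subseteq> {..<dim_vec x0}" "card K0 = Suc q" and Q0x: "Q0 = lattice_cube x0 K0"
      by (elim elementary_cubeE)
    have dimS: "dim_vec y = m" if "y \<in> S" for y
      using that Suc.prems(2) by auto
    have x0S: "x0 \<in> S" using Q0S mem_lattice_cube_self unfolding Q0x by blast
    obtain k where k: "k \<in> K0" using K0(2) by fastforce
    have km: "k < m" using k K0(1) dimS[OF x0S] by auto
    \<comment> \<open>The level is that of the minimal vertex of \<open>Q0\<close>, a cube extending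
      in direction \<open>k\<close>. Hence \<open>Q0\<close> rises above the level and belongs to
      \<open>v\<close>, which produces the contradiction at the end.\<close>
    define a where "a = x0 $ k"
    define L where "L = {Q :: int vec set. \<forall>y\<in>Q. y $ k \<le> a}"
    obtain u v where u: "Poly_Mapping.keys u \<subseteq> Poly_Mapping.keys c \<inter> L"
      and v: "Poly_Mapping.keys v \<subseteq> Poly_Mapping.keys c - L" and uv: "u + v = c"
      by (rule frag_split[of c "Poly_Mapping.keys c \<inter> L" "Poly_Mapping.keys c - L"]) auto
    have uS: "u \<in> carrier (chain_group (Suc q) S)" and vS: "v \<in> carrier (chain_group (Suc q) S)"
      using Suc.prems(3) u v by (auto simp: chain_group_def)
    have "chain_boundary u + chain_boundary v = 0"
      using Suc.prems(4) uv by (auto simp: chain_boundary_def frag_extend_add)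
    then have du: "chain_boundary u = - chain_boundary v"
      by (simp add: eq_neg_iff_add_eq_0)
    define T where "T = {y \<in> S. y $ k = a \<and> shift y k 1 \<in> S}"
    have T: "finite T" "T \<subseteq> carrier_vec m" "T \<subseteq> S"
      using Suc.prems(1,2) by (auto simp: T_def)
    \<comment> \<open>As a face of a cube in \<open>L\<close>, such an \<open>R\<close> lies at
      height at most \<open>a\<close>. As \<partial>u = -\<partial>v, it is also a face of a cube of
      \<open>v\<close>, which rises above \<open>a\<close>; \<open>lower_face\<close> then says
      which face it is.\<close>
    have "elementary_cube q R \<and> R \<subseteq> T" if R: "R \<in> Poly_Mapping.keys (chain_boundary u)" for R
    proof -
      have low: "\<forall>y\<in>R. y $ k \<le> a"
      proof -
        obtain x K where K: "K \<subseteq> {..<dim_vec x}" "lattice_cube x K \<in> Poly_Mapping.keys u"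
          and RK: "R \<in> Poly_Mapping.keys (cube_boundary (lattice_cube x K))"
          using keys_chain_boundaryE[OF uS R] by metis
        have "R \<subseteq> lattice_cube x K"
          using keys_cube_boundary[OF K(1) RK] face_subset by metis
        then show ?thesis using K(2) u by (auto simp: L_def)
      qed
      have "R \<in> Poly_Mapping.keys (chain_boundary v)"
        using R du by simp
      then obtain x K where K: "K \<subseteq> {..<dim_vec x}" "card K = Suc q" "lattice_cube x K \<in> Poly_Mapping.keys v"
          "lattice_cube x K \<subseteq> S" and RK: "R \<in> Poly_Mapping.keys (cube_boundary (lattice_cube x K))"
        using keys_chain_boundaryE[OF vS] by metis
      have kx: "k < dim_vec x"
        using dimS[of x] mem_lattice_cube_self K(4) km by blast
      have high: "\<exists>y\<in>lattice_cube x K. a < y $ k"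
        using K(3) v by (force simp: L_def not_le)
      note low = lower_face[OF K(1) RK low high kx]
      have fin: "finite K" using K finite_subset by blast
      have "elementary_cube q R"
        unfolding elementary_cube_iff low(3)
        using K low(1) fin by (intro exI[of _ x] exI[of _ "K - {k}"]) auto
      moreover have "R \<subseteq> T"
      proof
        fix y assume y: "y \<in> R"
        then have yK: "y \<in> lattice_cube x K"
          using face_subset[OF low(1), of 0 x] unfolding low(3) by auto
        have yk: "y $ k = x $ k"
          using y kx unfolding low(3) lattice_cube_def by blast
        then have "shift y k 1 \<in> lattice_cube x K"
          using yK low(1) kx by (intro shift_mem_lattice_cube) auto
        then show "y \<in> T"
          using yK yk low(2) K(4) by (auto simp: T_def)
      qed
      ultimately show ?thesis ..
    qed
    then have duT: "chain_boundary u \<in> carrier (chain_group q T)"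
      by (auto simp: chain_group_def)
    have "chain_boundary u = 0"
    proof (rule Suc.IH[OF T(1,2) duT])
      show "chain_boundary (chain_boundary u) = 0"
        by (rule chain_boundary_boundary[OF uS])
      \<comment> \<open>For q = 0 the cut is a 0-chain; its augmentation vanishes because it is a
        boundary.\<close>
      show "augmentation (chain_boundary u) = 0"
        by (rule augmentation_chain_boundary[OF uS])
      have "inj_on (\<lambda>y. shift y k 1) T"
      proof (rule inj_onI)
        fix y z assume yz: "y \<in> T" "z \<in> T" "shift y k 1 = shift z k 1"
        then have dim: "dim_vec y = m" "dim_vec z = m" using dimS T(3) by auto
        show "y = z"
        proof (rule eq_vecI)
          fix i assume "i < dim_vec z"
          then show "y $ i = z $ i"
            using arg_cong[OF yz(3), of "\<lambda>v. v $ i"] dim by (simp add: shift_def split: if_splits)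
        qed (simp add: dim)
      qed
      then have "card ((\<lambda>y. shift y k 1) ` T) = card T"
        by (rule card_image)
      moreover have "T \<inter> (\<lambda>y. shift y k 1) ` T = {}"
      proof -
        have "shift y k 1 $ k = a + 1" if "y \<in> T" for y
          using that dimS[of y] km by (simp add: T_def shift_def)
        moreover have "y $ k = a" if "y \<in> T" for y
          using that by (simp add: T_def)
        ultimately show ?thesis
          by (metis (no_types, lifting) add_cancel_left_right disjoint_iff imageE zero_neq_one)
      qed
      ultimately have "card (T \<union> (\<lambda>y. shift y k 1) ` T) = card T + card T"
        using T(1) by (simp add: card_Un_disjoint)
      moreover have "card (T \<union> (\<lambda>y. shift y k 1) ` T) \<le> card S"
        by (rule card_mono[OF Suc.prems(1)]) (auto simp: T_def)
      ultimately show "card T < 2 ^ Suc q"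
        using Suc.prems(6) by simp
    qed
    then have dv: "chain_boundary v = 0"
      using du by simp
    \<comment> \<open>The front face of \<open>Q0\<close> in direction \<open>k\<close> belongs to
      no other cube of \<open>v\<close>, since \<open>lower_face\<close> recovers minimal vertex and
      directions of the cube from it. So its coefficient in \<partial>v is, up to sign, that of
      \<open>Q0\<close> in \<open>c\<close>.\<close>
    let ?R0 = "lattice_cube x0 (K0 - {k})"
    have x0k: "k < dim_vec x0" using k K0(1) by auto
    have "shift x0 k 1 \<in> Q0"
      unfolding Q0x using k x0k by (intro shift_mem_lattice_cube mem_lattice_cube_self) auto
    moreover have "shift x0 k 1 $ k = a + 1"
      using x0k by (simp add: shift_def a_def)
    ultimately have "Q0 \<notin> L"
      by (force simp: L_def)
    then have "poly_mapping.lookup u Q0 = 0"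
      using u by (metis IntD2 in_keys_iff subsetD)
    then have v0: "poly_mapping.lookup v Q0 = poly_mapping.lookup c Q0"
      unfolding uv[symmetric] by (simp add: lookup_add)
    have Q0v: "Q0 \<in> Poly_Mapping.keys v"
      using v0 Q0 by (simp add: in_keys_iff)
    have low0: "\<forall>y\<in>?R0. y $ k \<le> a"
      using x0k unfolding lattice_cube_def a_def by auto
    have "poly_mapping.lookup v Q * poly_mapping.lookup (cube_boundary Q) ?R0 = 0"
      if Q: "Q \<in> Poly_Mapping.keys v - {Q0}" for Q
    proof (rule ccontr)
      assume "poly_mapping.lookup v Q * poly_mapping.lookup (cube_boundary Q) ?R0 \<noteq> 0"
      then have R: "?R0 \<in> Poly_Mapping.keys (cube_boundary Q)" by (simp add: in_keys_iff)
      have "elementary_cube (Suc q) Q" and QS: "Q \<subseteq> S"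
        using Q vS by (auto simp: chain_group_def)
      then obtain x K where K: "K \<subseteq> {..<dim_vec x}" and Qx: "Q = lattice_cube x K"
        by (elim elementary_cubeE)
      have kx: "k < dim_vec x"
        using dimS[of x] mem_lattice_cube_self QS km unfolding Qx by blast
      have high: "\<exists>y\<in>lattice_cube x K. a < y $ k"
        using Q v by (force simp: L_def not_le Qx)
      note low = lower_face[OF K R[unfolded Qx] low0 high kx]
      then have "x0 = x \<and> K0 - {k} = K - {k}"
        using K0(1) K by (subst (asm) lattice_cube_eq_iff) auto
      then have "Q = Q0"
        using k low(1) unfolding Qx Q0x by (metis insert_Diff)
      then show False using Q by simp
    qed
    then have "(\<Sum>Q\<in>Poly_Mapping.keys v - {Q0}.
        poly_mapping.lookup v Q * poly_mapping.lookup (cube_boundary Q) ?R0) = 0"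
      by (rule sum.neutral[OF ballI])
    then have "poly_mapping.lookup (chain_boundary v) ?R0 =
        poly_mapping.lookup v Q0 * poly_mapping.lookup (cube_boundary Q0) ?R0"
      unfolding chain_boundary_def lookup_frag_extend sum.remove[OF finite_keys Q0v] by simp
    also have "\<dots> \<noteq> 0"
      using Q0v lookup_cube_boundary_front[OF K0(1) k] unfolding Q0x by (simp add: in_keys_iff)
    finally show False using dv by simp
  qed
qed

section \<open>Commutation of \<beta> with the boundary\<close>

lemma cube_chain_in_chain_group:
  assumes "digitally_continuous (unit_cube q) Y \<sigma>"
  shows "cube_chain q \<sigma> \<in> carrier (chain_group q Y)"
proof (cases "inj_on \<sigma> (unit_cube q)")
  case True
  obtain x K z \<pi> where p: "presents q \<sigma> x K z \<pi>"
    by (rule injective_singular_cube_presents[OF assms True])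
  have "elementary_cube q (lattice_cube x K)"
    using p unfolding presents_def elementary_cube_iff by blast
  moreover have "lattice_cube x K \<subseteq> Y"
    unfolding presents_image[OF p, symmetric] using digitally_continuousD(1)[OF assms] by blast
  ultimately show ?thesis
    unfolding cube_chain_presents[OF p] chain_group_def by auto
qed (simp add: cube_chain_def chain_group_def)

lemma carrier_chain_group_closed:
  "0 \<in> carrier (chain_group q X)"
  "a \<in> carrier (chain_group q X) \<Longrightarrow> b \<in> carrier (chain_group q X) \<Longrightarrow> a + b \<in> carrier (chain_group q X)"
  "a \<in> carrier (chain_group q X) \<Longrightarrow> b \<in> carrier (chain_group q X) \<Longrightarrow> a - b \<in> carrier (chain_group q X)"
  "a \<in> carrier (chain_group q X) \<Longrightarrow> frag_cmul n a \<in> carrier (chain_group q X)"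
  using keys_add[of a b] keys_diff[of a b] keys_cmul[of n a] unfolding chain_group_def by auto

lemma singular_boundary_in_chain_group:
  assumes "\<And>i e. i < q \<Longrightarrow> e = 0 \<or> e = 1 \<Longrightarrow> h (\<sigma> \<circ> insert_coord i e) \<in> carrier (chain_group r X)"
  shows "singular_boundary q h \<sigma> \<in> carrier (chain_group r X)"
  unfolding singular_boundary_def using assms
  by (subst chain_group_def, intro sum_closed_free_Abelian_group, fold chain_group_def)
    (auto intro: carrier_chain_group_closed)

text \<open>A noninjective edge is handled directly, as its two ends coincide. The counting argument
  starts with squares, whose boundary has positive dimension, so that the augmentation condition of
  \<open>small_support_cycle_eq_0\<close> is void.\<close>

theorem chain_boundary_cube_chain:
  assumes "digitally_continuous (unit_cube (Suc n)) Y \<sigma>" "Y \<subseteq> carrier_vec m"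
  shows "chain_boundary (cube_chain (Suc n) \<sigma>) = singular_boundary (Suc n) (cube_chain n) \<sigma>"
  using assms(1)
proof (induction n arbitrary: \<sigma>)
  case (0 \<sigma>)
  show ?case
  proof (cases "inj_on \<sigma> (unit_cube (Suc 0))")
    case True
    then show ?thesis
      using injective_singular_cube_presents[OF 0 True] chain_boundary_presents by metis
  next
    case False
    then obtain s t where st: "s \<in> unit_cube (Suc 0)" "t \<in> unit_cube (Suc 0)" "\<sigma> s = \<sigma> t" "s \<noteq> t"
      by (auto simp: inj_on_def)
    have ins: "insert_coord 0 (w $ 0) r = w" if "w \<in> unit_cube (Suc 0)" "r \<in> unit_cube 0" for w r
      using dim_unit_cube[OF that(1)] dim_unit_cube[OF that(2)]
      by (intro eq_vecI) (auto simp: insert_coord_def)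
    have "s $ 0 \<noteq> t $ 0"
    proof
      assume "s $ 0 = t $ 0"
      then have "s = t"
        using dim_unit_cube[OF st(1)] dim_unit_cube[OF st(2)] by (intro eq_vecI) auto
      then show False using st(4) by simp
    qed
    then have "s $ 0 = 0 \<and> t $ 0 = 1 \<or> s $ 0 = 1 \<and> t $ 0 = 0"
      using unit_cubeD[OF st(1), of 0] unit_cubeD[OF st(2), of 0] by auto
    then have "\<sigma> (insert_coord 0 0 r) = \<sigma> (insert_coord 0 1 r)" if "r \<in> unit_cube 0" for r
      using ins[OF st(1) that] ins[OF st(2) that] st(3) by auto
    then have "cube_chain 0 (\<sigma> \<circ> insert_coord 0 0) = cube_chain 0 (\<sigma> \<circ> insert_coord 0 1)"
      by (intro cube_chain_cong) simp
    then show ?thesis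
      using False by (simp add: singular_boundary_def cube_chain_def[of "Suc 0"] chain_boundary_def)
  qed
next
  case (Suc n \<sigma>)
  show ?case
  proof (cases "inj_on \<sigma> (unit_cube (Suc (Suc n)))")
    case True
    then show ?thesis
      using injective_singular_cube_presents[OF Suc.prems True] chain_boundary_presents by metis
  next
    case False
    let ?w = "singular_boundary (Suc (Suc n)) (cube_chain (Suc n)) \<sigma>"
    let ?S = "\<sigma> ` unit_cube (Suc (Suc n))"
    \<comment> \<open>The faces are needed with target \<open>Y\<close> for the induction hypothesis
      and with target \<open>?S\<close> for the support bound.\<close>
    have face: "digitally_continuous (unit_cube (Suc n)) Y (\<sigma> \<circ> insert_coord i e)"
      "digitally_continuous (unit_cube (Suc n)) ?S (\<sigma> \<circ> insert_coord i e)"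
      if "i < Suc (Suc n)" "e = 0 \<or> e = 1" for i e
    proof -
      have "digitally_continuous (unit_cube (Suc (Suc n))) ?S \<sigma>"
        using Suc.prems unfolding digitally_continuous_def by blast
      then show "digitally_continuous (unit_cube (Suc n)) Y (\<sigma> \<circ> insert_coord i e)"
        "digitally_continuous (unit_cube (Suc n)) ?S (\<sigma> \<circ> insert_coord i e)"
        using Suc.prems that digitally_continuous_insert_coord[OF that(2), of i "Suc n"]
        by (auto intro: digitally_continuous_comp)
    qed
    have "chain_boundary ?w =
        singular_boundary (Suc (Suc n)) (\<lambda>\<tau>. chain_boundary (cube_chain (Suc n) \<tau>)) \<sigma>"
      by (rule chain_boundary_singular_boundary)
    also have "\<dots> = singular_boundary (Suc (Suc n)) (singular_boundary (Suc n) (cube_chain (Suc n - 1))) \<sigma>"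
      unfolding diff_Suc_1 by (rule singular_boundary_cong) (rule Suc.IH[OF face(1)])
    also have "\<dots> = 0"
      by (rule singular_boundary_boundary)
    finally have dw: "chain_boundary ?w = 0" .
    have "?w = 0"
    proof (rule small_support_cycle_eq_0[OF _ _ _ dw])
      show "?S \<subseteq> carrier_vec m"
        using digitally_continuousD(1)[OF Suc.prems] assms(2) by blast
      show "?w \<in> carrier (chain_group (Suc n) ?S)"
        by (intro singular_boundary_in_chain_group cube_chain_in_chain_group face(2))
      have "card ?S \<noteq> card (unit_cube (Suc (Suc n)))"
        using False eq_card_imp_inj_on[OF finite_unit_cube] by blast
      then show "card ?S < 2 ^ Suc (Suc n)"
        using card_image_le[OF finite_unit_cube, of \<sigma> "Suc (Suc n)"]
        unfolding card_unit_cube by linarith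
    qed simp_all
    then show ?thesis
      using False by (simp add: cube_chain_def[of "Suc (Suc n)"] chain_boundary_def)
  qed
qed

section \<open>Induced chain maps\<close>

lemma frag_extend_frag_extend:
  "frag_extend g (frag_extend f c) = frag_extend (\<lambda>Q. frag_extend g (f Q)) c"
  unfolding frag_extend_def[of f] frag_extend_def[of "\<lambda>Q. frag_extend g (f Q)"]
  by (simp add: frag_extend_sum frag_extend_cmul)

lemma cube_param_unit_cube:
  assumes "K \<subseteq> {..<dim_vec x}" "t \<in> unit_cube (card K)"
  shows "cube_param (lattice_cube x K) t = chart x K t"
  by (rule cube_param_lattice_cube[OF assms(1) unit_cube_carrier[OF assms(2)]])

lemma elementary_cube_param:
  assumes "elementary_cube q Q"
  shows "digitally_continuous (unit_cube q) Q (cube_param Q)"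
    and "inj_on (cube_param Q) (unit_cube q)"
    and "cube_param Q ` unit_cube q = Q"
    and "cube_chain q (cube_param Q) = frag_of Q"
proof -
  obtain x K where K: "K \<subseteq> {..<dim_vec x}" "card K = q" and Q: "Q = lattice_cube x K"
    using elementary_cubeE[OF assms] .
  have eq: "cube_param Q t = chart x K t" if "t \<in> unit_cube q" for t
    using cube_param_unit_cube[OF K(1)] that K(2) Q by simp
  note p = presents_chart[OF K(1), unfolded K(2)]
  show "digitally_continuous (unit_cube q) Q (cube_param Q)"
    using digitally_continuous_chart[OF K(1)] eq unfolding digitally_continuous_def K(2) Q
    by (simp add: Pi_iff)
  show "inj_on (cube_param Q) (unit_cube q)"
    using presents_inj_on[OF p] inj_on_cong[of "unit_cube q", OF eq] by simp
  show "cube_param Q ` unit_cube q = Q"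
  proof -
    have "cube_param Q ` unit_cube q = chart x K ` unit_cube q"
      by (rule image_cong[OF refl eq])
    then show ?thesis
      using presents_image[OF p] Q by simp
  qed
  show "cube_chain q (cube_param Q) = frag_of Q"
    using cube_chain_chart[OF K(1)] cube_chain_cong[OF eq] K(2) Q by simp
qed

text \<open>Translates values \<open>f\<close> on elementary cubes into values \<open>h\<close> on
  singular cubes, for chain maps and for the prism operator alike. It works because the standard
  parametrisation of a cube restricts on each face to the standard parametrisation of that face,
  without an intervening symmetry. The agreement is required only on the unit cube, where
  \<open>chart\<close> describes both.\<close>

lemma frag_extend_cube_boundary:
  assumes Q: "elementary_cube n Q"
    and face: "\<And>i e R. i < n \<Longrightarrow> e = 0 \<or> e = 1 \<Longrightarrow> elementary_cube (n - 1) R \<Longrightarrow> R \<subseteq> Q \<Longrightarrow>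
      (\<And>t. t \<in> unit_cube (n - 1) \<Longrightarrow> cube_param R t = cube_param Q (insert_coord i e t)) \<Longrightarrow>
      h (cube_param Q \<circ> insert_coord i e) = f R"
  shows "frag_extend f (cube_boundary Q) = singular_boundary n h (cube_param Q)"
proof -
  obtain x K where K: "K \<subseteq> {..<dim_vec x}" "card K = n" and Qx: "Q = lattice_cube x K"
    using elementary_cubeE[OF Q] .
  have fin: "finite K" using K finite_subset by blast
  have "frag_extend f (cube_boundary Q) = (\<Sum>k\<in>K. frag_cmul ((-1) ^ Suc (rank K k))
       (f (lattice_cube (shift x k 0) (K - {k})) - f (lattice_cube (shift x k 1) (K - {k}))))"
    unfolding Qx cube_boundary_lattice_cube[OF K(1)] using fin
    by (simp add: frag_extend_sum frag_extend_cmul frag_extend_diff del: power_Suc)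
  also have "\<dots> = (\<Sum>k\<in>K. frag_cmul ((-1) ^ Suc (rank K k))
      (h (cube_param Q \<circ> insert_coord (rank K k) 0) - h (cube_param Q \<circ> insert_coord (rank K k) 1)))"
  proof (rule sum.cong[OF refl])
    fix k assume k: "k \<in> K"
    have r: "rank K k < n" using rank_less[OF fin k] K(2) by simp
    have "h (cube_param Q \<circ> insert_coord (rank K k) e) = f (lattice_cube (shift x k e) (K - {k}))"
      if e: "e = 0 \<or> e = 1" for e
    proof (rule face[OF r e])
      have K': "K - {k} \<subseteq> {..<dim_vec (shift x k e)}" "card (K - {k}) = n - 1"
        using K k fin by auto
      then show "elementary_cube (n - 1) (lattice_cube (shift x k e) (K - {k}))"
        unfolding elementary_cube_iff by blast
      show "lattice_cube (shift x k e) (K - {k}) \<subseteq> Q"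
        unfolding Qx by (rule face_subset[OF k e])
      fix t assume t: "t \<in> unit_cube (n - 1)"
      have "insert_coord (rank K k) e t \<in> unit_cube n"
        using insert_coord_in_unit_cube[OF t e, of "rank K k"] r by simp
      then have "cube_param Q (insert_coord (rank K k) e t) = chart x K (insert_coord (rank K k) e t)"
        unfolding Qx using cube_param_unit_cube[OF K(1)] K(2) by simp
      also have "\<dots> = chart (shift x k e) (K - {k}) t"
        using chart_insert_coord[OF fin k] dim_unit_cube[OF t] K(2) by simp
      finally show "cube_param (lattice_cube (shift x k e) (K - {k})) t = cube_param Q (insert_coord (rank K k) e t)"
        using cube_param_unit_cube[OF K'(1)] t K'(2) by simp
    qed
    then show "frag_cmul ((-1) ^ Suc (rank K k))
       (f (lattice_cube (shift x k 0) (K - {k})) - f (lattice_cube (shift x k 1) (K - {k}))) =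
      frag_cmul ((-1) ^ Suc (rank K k))
      (h (cube_param Q \<circ> insert_coord (rank K k) 0) - h (cube_param Q \<circ> insert_coord (rank K k) 1))"
      by simp
  qed
  also have "\<dots> = singular_boundary n h (cube_param Q)"
    unfolding singular_boundary_def using sum.reindex_bij_betw[OF bij_betw_rank[OF fin],
      of "\<lambda>i. frag_cmul ((-1) ^ Suc i) (h (cube_param Q \<circ> insert_coord i 0) - h (cube_param Q \<circ> insert_coord i 1))"]
    unfolding K(2) .
  finally show ?thesis .
qed

lemma chain_groupD:
  assumes "c \<in> carrier (chain_group q X)" "Q \<in> Poly_Mapping.keys c"
  shows "elementary_cube q Q" "Q \<subseteq> X"
  using assms by (auto simp: chain_group_def)

lemma digitally_continuous_comp_cube_param:
  assumes f: "digitally_continuous X Y f" and Q: "elementary_cube q Q" "Q \<subseteq> X"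
  shows "digitally_continuous (unit_cube q) Y (f \<circ> cube_param Q)"
  by (rule digitally_continuous_comp[OF elementary_cube_param(1)[OF Q(1)]
    digitally_continuous_subset[OF f Q(2)]])

lemma frag_extend_in_chain_group:
  assumes "\<And>Q. Q \<in> Poly_Mapping.keys c \<Longrightarrow> f Q \<in> carrier (chain_group q X)"
  shows "frag_extend f c \<in> carrier (chain_group q X)"
  using assms keys_frag_extend[of f c] unfolding chain_group_def by fastforce

lemma chain_map_in_chain_group:
  assumes "digitally_continuous X Y f" "c \<in> carrier (chain_group q X)"
  shows "chain_map q f c \<in> carrier (chain_group q Y)"
  unfolding chain_map_def
  by (intro frag_extend_in_chain_group cube_chain_in_chain_group
    digitally_continuous_comp_cube_param[OF assms(1)] chain_groupD[OF assms(2)])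

text \<open>Here noninjective cubes enter: \<open>f \<circ> cube_param Q\<close> may be any singular
  cube in \<open>Y\<close>.\<close>

lemma chain_boundary_chain_map:
  assumes f: "digitally_continuous X Y f" and Y: "Y \<subseteq> carrier_vec m"
    and c: "c \<in> carrier (chain_group (Suc n) X)"
  shows "chain_boundary (chain_map (Suc n) f c) = chain_map n f (chain_boundary c)"
  unfolding chain_boundary_def chain_map_def frag_extend_frag_extend
proof (rule frag_extend_eq)
  fix Q assume Q: "Q \<in> Poly_Mapping.keys c"
  note elem = chain_groupD[OF c Q]
  have "frag_extend cube_boundary (cube_chain (Suc n) (f \<circ> cube_param Q)) =
      singular_boundary (Suc n) (cube_chain n) (f \<circ> cube_param Q)"
    using chain_boundary_cube_chain[OF digitally_continuous_comp_cube_param[OF f elem] Y]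
    unfolding chain_boundary_def .
  also have "\<dots> = singular_boundary (Suc n) (\<lambda>\<tau>. cube_chain n (f \<circ> \<tau>)) (cube_param Q)"
    unfolding singular_boundary_def o_assoc ..
  also have "\<dots> = frag_extend (\<lambda>R. cube_chain n (f \<circ> cube_param R)) (cube_boundary Q)"
    by (rule frag_extend_cube_boundary[OF elem(1), symmetric], rule cube_chain_cong) simp
  finally show "frag_extend cube_boundary (cube_chain (Suc n) (f \<circ> cube_param Q)) =
      frag_extend (\<lambda>R. cube_chain n (f \<circ> cube_param R)) (cube_boundary Q)" .
qed

lemma chain_map_cong:
  assumes "c \<in> carrier (chain_group q X)" "\<And>x. x \<in> X \<Longrightarrow> f x = g x"
  shows "chain_map q f c = chain_map q g c"
  unfolding chain_map_def
proof (rule frag_extend_eq, rule cube_chain_cong)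
  fix Q t assume Q: "Q \<in> Poly_Mapping.keys c" and t: "t \<in> unit_cube q"
  have "cube_param Q t \<in> X"
    using elementary_cube_param(3)[OF chain_groupD(1)[OF assms(1) Q]] chain_groupD(2)[OF assms(1) Q] t by blast
  then show "(f \<circ> cube_param Q) t = (g \<circ> cube_param Q) t"
    using assms(2) by simp
qed

lemma chain_map_id:
  assumes "c \<in> carrier (chain_group q X)"
  shows "chain_map q id c = c"
proof -
  have "chain_map q id c = frag_extend frag_of c"
    unfolding chain_map_def using elementary_cube_param(4) chain_groupD(1)[OF assms]
    by (intro frag_extend_eq) simp
  then show ?thesis using frag_expansion by metis
qed

lemma cube_chain_0: "cube_chain 0 \<sigma> = frag_of (\<sigma> ` unit_cube 0)"
proof -
  have p: "presents 0 \<sigma> (\<sigma> (0\<^sub>v 0)) {} (0\<^sub>v 0) id"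
    unfolding presents_def
  proof (intro conjI ballI)
    show "0\<^sub>v 0 \<in> unit_cube 0" by (rule unit_cubeI) simp_all
    fix t assume "t \<in> unit_cube 0"
    then have "t = 0\<^sub>v 0" using dim_unit_cube by (intro eq_vecI) auto
    then show "\<sigma> t = chart (\<sigma> (0\<^sub>v 0)) {} (add_mod2 (0\<^sub>v 0) (permute_coords id t))"
      by (intro eq_vecI) (simp_all add: chart_def)
  qed simp_all
  show ?thesis
    unfolding cube_chain_presents[OF p] presents_image[OF p] by (simp add: sym_sign_def)
qed

section \<open>Functoriality of the chain maps\<close>

text \<open>If \<tau> is injective with image \<open>Q\<close>, then both sides vanish unless
  \<open>g\<close> is injective on \<open>Q\<close>, and otherwise both are the cube g(Q) up to
  sign. Only the signs remain to be compared, which is left to the hypothesis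
  \<open>sign\<close>.\<close>

lemma chain_map_cube_chain_sign:
  assumes g: "digitally_continuous Y Z g" and \<tau>: "digitally_continuous (unit_cube q) Y \<tau>"
    and sign: "\<And>R s s'. elementary_cube q R \<Longrightarrow> chain_map q g (cube_chain q \<tau>) = frag_cmul s (frag_of R) \<Longrightarrow>
        cube_chain q (g \<circ> \<tau>) = frag_cmul s' (frag_of R) \<Longrightarrow> s = s'"
  shows "chain_map q g (cube_chain q \<tau>) = cube_chain q (g \<circ> \<tau>)"
proof (cases "inj_on \<tau> (unit_cube q)")
  case False
  then have "\<not> inj_on (g \<circ> \<tau>) (unit_cube q)"
    using inj_on_imageI2 by blast
  then show ?thesis
    using False by (simp add: cube_chain_def chain_map_def)
next
  case True
  obtain x K z \<pi> where p: "presents q \<tau> x K z \<pi>"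
    by (rule injective_singular_cube_presents[OF \<tau> True])
  define Q where "Q = lattice_cube x K"
  have Q: "elementary_cube q Q"
    using p unfolding presents_def elementary_cube_iff Q_def by blast
  have im: "\<tau> ` unit_cube q = Q"
    unfolding Q_def by (rule presents_image[OF p])
  have QY: "Q \<subseteq> Y"
    using im digitally_continuousD(1)[OF \<tau>] by blast
  have lhs: "chain_map q g (cube_chain q \<tau>) = frag_cmul (sym_sign q z \<pi>) (cube_chain q (g \<circ> cube_param Q))"
    unfolding cube_chain_presents[OF p] by (simp add: chain_map_def frag_extend_cmul Q_def)
  have i1: "inj_on (g \<circ> \<tau>) (unit_cube q) \<longleftrightarrow> inj_on g Q"
    using comp_inj_on_iff[OF True, of g] im by simp
  have i2: "inj_on (g \<circ> cube_param Q) (unit_cube q) \<longleftrightarrow> inj_on g Q"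
    using comp_inj_on_iff[OF elementary_cube_param(2)[OF Q], of g] elementary_cube_param(3)[OF Q] by simp
  show ?thesis
  proof (cases "inj_on g Q")
    case False
    then show ?thesis using i1 i2 lhs by (simp add: cube_chain_def)
  next
    case inj: True
    have c1: "digitally_continuous (unit_cube q) Z (g \<circ> \<tau>)"
      by (rule digitally_continuous_comp[OF \<tau> g])
    have c2: "digitally_continuous (unit_cube q) Z (g \<circ> cube_param Q)"
      by (rule digitally_continuous_comp_cube_param[OF g Q QY])
    obtain x1 K1 z1 \<pi>1 where p1: "presents q (g \<circ> \<tau>) x1 K1 z1 \<pi>1"
      using injective_singular_cube_presents[OF c1] i1 inj by blast
    obtain x2 K2 z2 \<pi>2 where p2: "presents q (g \<circ> cube_param Q) x2 K2 z2 \<pi>2"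
      using injective_singular_cube_presents[OF c2] i2 inj by blast
    have R1: "lattice_cube x1 K1 = g ` Q"
      using presents_image[OF p1] im by (simp only: image_comp[symmetric])
    have R2: "lattice_cube x2 K2 = g ` Q"
      using presents_image[OF p2] elementary_cube_param(3)[OF Q] by (simp only: image_comp[symmetric])
    have R: "elementary_cube q (g ` Q)"
      using p1 R1 unfolding presents_def elementary_cube_iff by metis
    have l: "chain_map q g (cube_chain q \<tau>) = frag_cmul (sym_sign q z \<pi> * sym_sign q z2 \<pi>2) (frag_of (g ` Q))"
      unfolding lhs cube_chain_presents[OF p2] R2 by simp
    have r: "cube_chain q (g \<circ> \<tau>) = frag_cmul (sym_sign q z1 \<pi>1) (frag_of (g ` Q))"
      unfolding cube_chain_presents[OF p1] R1 ..
    from sign[OF R l r] show ?thesis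
      unfolding l r by simp
  qed
qed

text \<open>Both sides are the same cube up to a sign, and since the boundary of a cube does not vanish,
  the sign is determined inductively by comparing boundaries.\<close>

lemma chain_map_cube_chain:
  assumes g: "digitally_continuous Y Z g" and Y: "Y \<subseteq> carrier_vec m" and Z: "Z \<subseteq> carrier_vec p"
    and \<tau>: "digitally_continuous (unit_cube q) Y \<tau>"
  shows "chain_map q g (cube_chain q \<tau>) = cube_chain q (g \<circ> \<tau>)"
  using \<tau>
proof (induction q arbitrary: \<tau>)
  case (0 \<tau>)
  have "elementary_cube 0 (\<tau> ` unit_cube 0)"
    using cube_chain_in_chain_group[OF 0] by (simp add: cube_chain_0 chain_group_def)
  from elementary_cube_param(3)[OF this] show ?case
    by (simp only: chain_map_def cube_chain_0 image_comp[symmetric] frag_extend_of)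
next
  case (Suc n \<tau>)
  show ?case
  proof (rule chain_map_cube_chain_sign[OF g Suc.prems])
    fix R s s'
    assume R: "elementary_cube (Suc n) R"
      and l: "chain_map (Suc n) g (cube_chain (Suc n) \<tau>) = frag_cmul s (frag_of R)"
      and r: "cube_chain (Suc n) (g \<circ> \<tau>) = frag_cmul s' (frag_of R)"
    have "chain_boundary (chain_map (Suc n) g (cube_chain (Suc n) \<tau>)) =
        chain_map n g (chain_boundary (cube_chain (Suc n) \<tau>))"
      by (rule chain_boundary_chain_map[OF g Z cube_chain_in_chain_group[OF Suc.prems]])
    also have "\<dots> = singular_boundary (Suc n) (\<lambda>\<rho>. chain_map n g (cube_chain n \<rho>)) \<tau>"
      unfolding chain_boundary_cube_chain[OF Suc.prems Y] chain_map_def by (rule frag_extend_singular_boundary)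
    also have "\<dots> = singular_boundary (Suc n) (cube_chain n) (g \<circ> \<tau>)"
    proof (rule singular_boundary_cong)
      fix i :: nat and e :: int assume "i < Suc n" "e = 0 \<or> e = 1"
      then have "digitally_continuous (unit_cube n) Y (\<tau> \<circ> insert_coord i e)"
        by (intro digitally_continuous_comp[OF digitally_continuous_insert_coord Suc.prems]) auto
      from Suc.IH[OF this] show "chain_map n g (cube_chain n (\<tau> \<circ> insert_coord i e)) =
          cube_chain n (g \<circ> \<tau> \<circ> insert_coord i e)"
        by (simp only: o_assoc)
    qed
    also have "\<dots> = chain_boundary (cube_chain (Suc n) (g \<circ> \<tau>))"
      by (rule chain_boundary_cube_chain[OF digitally_continuous_comp[OF Suc.prems g] Z, symmetric])
    finally have "frag_cmul s (cube_boundary R) = frag_cmul s' (cube_boundary R)"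
      unfolding l r by (simp add: chain_boundary_def frag_extend_cmul)
    then have "frag_cmul (s - s') (cube_boundary R) = 0"
      by (simp add: frag_cmul_diff_distrib)
    then show "s = s'"
      using cube_boundary_nonzero[OF R] by simp
  qed
qed

lemma chain_map_comp:
  assumes f: "digitally_continuous X Y f" and g: "digitally_continuous Y Z g"
    and Y: "Y \<subseteq> carrier_vec m" and Z: "Z \<subseteq> carrier_vec p"
    and c: "c \<in> carrier (chain_group q X)"
  shows "chain_map q g (chain_map q f c) = chain_map q (g \<circ> f) c"
proof -
  have "chain_map q g (chain_map q f c) =
      frag_extend (\<lambda>Q. chain_map q g (cube_chain q (f \<circ> cube_param Q))) c"
    unfolding chain_map_def by (rule frag_extend_frag_extend)
  also have "\<dots> = chain_map q (g \<circ> f) c"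
    unfolding chain_map_def[of q "g \<circ> f"]
  proof (rule frag_extend_eq)
    fix Q assume "Q \<in> Poly_Mapping.keys c"
    note Q = chain_groupD[OF c this]
    show "chain_map q g (cube_chain q (f \<circ> cube_param Q)) = cube_chain q (g \<circ> f \<circ> cube_param Q)"
      using chain_map_cube_chain[OF g Y Z digitally_continuous_comp_cube_param[OF f Q]]
      by (simp only: o_assoc)
  qed
  finally show ?thesis .
qed

section \<open>Chain homotopy\<close>

text \<open>The homotopy coordinate comes last. The faces in the first n coordinates are then prisms
  over the faces of \<tau> with the same numbers, so the side terms keep the signs of the boundary
  of \<tau>, and the two ends share the sign (-1)^(n + 1).\<close>

definition prism :: "nat \<Rightarrow> (int vec \<Rightarrow> int vec) \<Rightarrow> (int vec \<Rightarrow> int vec) \<Rightarrow> (int vec \<Rightarrow> int vec) \<Rightarrow> int vec \<Rightarrow> int vec" where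
  "prism n f g \<tau> t = (if t $ n = 0 then f else g) (\<tau> (vec n (($) t)))"

lemma truncate_in_unit_cube: "t \<in> unit_cube (Suc n) \<Longrightarrow> vec n (($) t) \<in> unit_cube n"
  by (rule unit_cubeI) (use unit_cubeD[of t "Suc n"] in auto)

lemma prism_end:
  assumes "t \<in> unit_cube n"
  shows "prism n f g \<tau> (insert_coord n e t) = (if e = 0 then f else g) (\<tau> t)"
proof -
  have "vec n (($) (insert_coord n e t)) = t"
    using dim_unit_cube[OF assms] by (intro eq_vecI) (auto simp: insert_coord_def)
  then show ?thesis
    using dim_unit_cube[OF assms] by (simp add: prism_def insert_coord_def)
qed

lemma prism_side:
  assumes "i < Suc n" "t \<in> unit_cube (Suc n)"
  shows "prism (Suc n) f g \<tau> (insert_coord i e t) = prism n f g (\<tau> \<circ> insert_coord i e) t"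
proof -
  have "vec (Suc n) (($) (insert_coord i e t)) = insert_coord i e (vec n (($) t))"
    using dim_unit_cube[OF assms(2)] assms(1) by (intro eq_vecI) (auto simp: insert_coord_def)
  moreover have "insert_coord i e t $ Suc n = t $ n"
    using dim_unit_cube[OF assms(2)] assms(1) by (simp add: insert_coord_def)
  ultimately show ?thesis by (simp add: prism_def)
qed

text \<open>Adjacent points of the unit cube differ in a single coordinate. If it is the last one,
  \<open>fg\<close> applies at one point of \<open>X\<close>; otherwise one of \<open>f\<close>,
  \<open>g\<close> is applied to equal or adjacent points. Diagonal steps do not occur.\<close>

lemma digitally_continuous_prism:
  assumes f: "digitally_continuous X Y f" and g: "digitally_continuous X Y g"
    and fg: "\<And>x. x \<in> X \<Longrightarrow> f x = g x \<or> c1_adjacent (f x) (g x)"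
    and \<tau>: "digitally_continuous (unit_cube n) X \<tau>"
  shows "digitally_continuous (unit_cube (Suc n)) Y (prism n f g \<tau>)"
  unfolding digitally_continuous_def
proof (intro conjI ballI impI)
  have \<tau>X: "\<tau> (vec n (($) t)) \<in> X" if "t \<in> unit_cube (Suc n)" for t
    by (rule digitally_continuousD(1)[OF \<tau> truncate_in_unit_cube[OF that]])
  show "prism n f g \<tau> \<in> unit_cube (Suc n) \<rightarrow> Y"
    using digitally_continuousD(1)[OF f \<tau>X] digitally_continuousD(1)[OF g \<tau>X]
    by (simp add: prism_def)
  fix s t assume s: "s \<in> unit_cube (Suc n)" and t: "t \<in> unit_cube (Suc n)" and "c1_adjacent s t"
  then obtain k d where k: "k < Suc n" "d = 1 \<or> d = -1" "t = shift s k d"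
    unfolding c1_adjacent_iff_shift dim_unit_cube[OF s] by blast
  show "prism n f g \<tau> s = prism n f g \<tau> t \<or> c1_adjacent (prism n f g \<tau> s) (prism n f g \<tau> t)"
  proof (cases "k = n")
    case True
    have "vec n (($) t) = vec n (($) s)"
      using k True dim_unit_cube[OF s] by (intro eq_vecI) (auto simp: shift_def)
    then show ?thesis
      using fg[OF \<tau>X[OF s]] by (auto simp: prism_def intro: c1_adjacent_sym)
  next
    case False
    then have "vec n (($) t) = shift (vec n (($) s)) k d"
      using k dim_unit_cube[OF s] by (intro eq_vecI) (auto simp: shift_def)
    then have "c1_adjacent (vec n (($) s)) (vec n (($) t))"
      using k False by (simp add: c1_adjacent_shift)
    then have \<tau>st: "\<tau> (vec n (($) s)) = \<tau> (vec n (($) t)) \<or> c1_adjacent (\<tau> (vec n (($) s))) (\<tau> (vec n (($) t)))"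
      by (rule digitally_continuousD(2)[OF \<tau> truncate_in_unit_cube[OF s] truncate_in_unit_cube[OF t]])
    have "s $ n = t $ n"
      using k False dim_unit_cube[OF s] by (simp add: shift_def)
    then show ?thesis
      using \<tau>st digitally_continuousD(2)[OF f \<tau>X[OF s] \<tau>X[OF t]]
        digitally_continuousD(2)[OF g \<tau>X[OF s] \<tau>X[OF t]]
      by (auto simp: prism_def)
  qed
qed

definition prism_operator :: "nat \<Rightarrow> (int vec \<Rightarrow> int vec) \<Rightarrow> (int vec \<Rightarrow> int vec) \<Rightarrow> c1_chain \<Rightarrow> c1_chain" where
  "prism_operator n f g = frag_extend (\<lambda>Q. cube_chain (Suc n) (prism n f g (cube_param Q)))"

text \<open>For n = 0 the truncated \<open>n - 1\<close> is the index of an operator applied to the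
  boundary of a 0-chain, which is 0.\<close>

lemma chain_boundary_prism_operator:
  assumes f: "digitally_continuous X Y f" and g: "digitally_continuous X Y g"
    and fg: "\<And>x. x \<in> X \<Longrightarrow> f x = g x \<or> c1_adjacent (f x) (g x)"
    and Y: "Y \<subseteq> carrier_vec m" and c: "c \<in> carrier (chain_group n X)"
  shows "chain_boundary (prism_operator n f g c) =
    frag_cmul ((-1) ^ Suc n) (chain_map n f c - chain_map n g c) +
    prism_operator (n - 1) f g (chain_boundary c)"
proof -
  have "chain_boundary (cube_chain (Suc n) (prism n f g (cube_param Q))) =
      frag_cmul ((-1) ^ Suc n) (cube_chain n (f \<circ> cube_param Q) - cube_chain n (g \<circ> cube_param Q)) +
      prism_operator (n - 1) f g (cube_boundary Q)"
    if "Q \<in> Poly_Mapping.keys c" for Q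
  proof -
    note Q = chain_groupD[OF c that]
    have \<tau>: "digitally_continuous (unit_cube n) X (cube_param Q)"
      using elementary_cube_param(1)[OF Q(1)] Q(2) unfolding digitally_continuous_def by blast
    let ?G = "prism n f g (cube_param Q)"
    have ends: "cube_chain n (?G \<circ> insert_coord n 0) = cube_chain n (f \<circ> cube_param Q)"
      "cube_chain n (?G \<circ> insert_coord n 1) = cube_chain n (g \<circ> cube_param Q)"
      by (rule cube_chain_cong, simp add: prism_end)+
    have "chain_boundary (cube_chain (Suc n) ?G) = singular_boundary (Suc n) (cube_chain n) ?G"
      by (rule chain_boundary_cube_chain[OF digitally_continuous_prism[OF f g fg \<tau>] Y])
    \<comment> \<open>Index n is the homotopy coordinate, so the ends split off as the last
      summand.\<close>
    also have "\<dots> = singular_boundary n (cube_chain n) ?G +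
        frag_cmul ((-1) ^ Suc n) (cube_chain n (f \<circ> cube_param Q) - cube_chain n (g \<circ> cube_param Q))"
      by (simp only: singular_boundary_def sum.lessThan_Suc ends)
    also have "singular_boundary n (cube_chain n) ?G =
        singular_boundary n (\<lambda>\<rho>. cube_chain n (prism (n - 1) f g \<rho>)) (cube_param Q)"
    proof (rule singular_boundary_cong, rule cube_chain_cong)
      fix i :: nat and e :: int and t assume "i < n" "t \<in> unit_cube n"
      then show "(?G \<circ> insert_coord i e) t = prism (n - 1) f g (cube_param Q \<circ> insert_coord i e) t"
        using prism_side[of i "n - 1" t f g "cube_param Q" e] by simp
    qed
    also have "\<dots> = prism_operator (n - 1) f g (cube_boundary Q)"
    proof -
      have "frag_extend (\<lambda>Q. cube_chain (Suc (n - 1)) (prism (n - 1) f g (cube_param Q))) (cube_boundary Q) =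
        singular_boundary n (\<lambda>\<rho>. cube_chain n (prism (n - 1) f g \<rho>)) (cube_param Q)"
      proof (rule frag_extend_cube_boundary[OF Q(1)])
        fix i :: nat and e :: int and R
        assume i: "i < n"
          and R: "\<And>t. t \<in> unit_cube (n - 1) \<Longrightarrow> cube_param R t = cube_param Q (insert_coord i e t)"
        have "cube_chain n (prism (n - 1) f g (cube_param Q \<circ> insert_coord i e)) =
            cube_chain n (prism (n - 1) f g (cube_param R))"
        proof (rule cube_chain_cong)
          fix t assume "t \<in> unit_cube n"
          then have "t \<in> unit_cube (Suc (n - 1))" using i by simp
          then show "prism (n - 1) f g (cube_param Q \<circ> insert_coord i e) t = prism (n - 1) f g (cube_param R) t"
            using R[OF truncate_in_unit_cube] by (simp add: prism_def)
        qed
        then show "cube_chain n (prism (n - 1) f g (cube_param Q \<circ> insert_coord i e)) =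
            cube_chain (Suc (n - 1)) (prism (n - 1) f g (cube_param R))"
          using i by simp
      qed
      then show ?thesis by (simp add: prism_operator_def)
    qed
    finally show ?thesis by (simp only: add.commute)
  qed
  then have "chain_boundary (prism_operator n f g c) = frag_extend (\<lambda>Q.
      frag_cmul ((-1) ^ Suc n) (cube_chain n (f \<circ> cube_param Q) - cube_chain n (g \<circ> cube_param Q)) +
      prism_operator (n - 1) f g (cube_boundary Q)) c"
    unfolding chain_boundary_def prism_operator_def[of n] frag_extend_frag_extend
    by (intro frag_extend_eq) simp
  also have "\<dots> = frag_cmul ((-1) ^ Suc n) (chain_map n f c - chain_map n g c) +
    prism_operator (n - 1) f g (chain_boundary c)"
  proof -
    have "prism_operator (n - 1) f g (chain_boundary c) =
        frag_extend (\<lambda>Q. prism_operator (n - 1) f g (cube_boundary Q)) c"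
      unfolding prism_operator_def chain_boundary_def by (rule frag_extend_frag_extend)
    then show ?thesis
      unfolding chain_map_def by (intro poly_mapping_eqI)
        (simp add: lookup_add lookup_minus lookup_frag_extend algebra_simps sum.distrib
          sum_subtractf sum_distrib_left sum_negf del: power_Suc)
  qed
  finally show ?thesis .
qed

section \<open>Homotopic maps send a cycle to homologous cycles\<close>

lemma boundariesI: "e \<in> carrier (chain_group (Suc q) X) \<Longrightarrow> chain_boundary e \<in> boundaries q X"
  by (simp add: boundaries_def)

lemma boundariesE:
  assumes "b \<in> boundaries q X"
  obtains e where "e \<in> carrier (chain_group (Suc q) X)" "b = chain_boundary e"
  using assms unfolding boundaries_def by blast

lemma zero_in_boundaries: "0 \<in> boundaries q X"
  using boundariesI[OF carrier_chain_group_closed(1)] by (simp add: chain_boundary_def)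

lemma add_in_boundaries:
  assumes "a \<in> boundaries q X" "b \<in> boundaries q X"
  shows "a + b \<in> boundaries q X"
proof -
  obtain e e' where "e \<in> carrier (chain_group (Suc q) X)" "e' \<in> carrier (chain_group (Suc q) X)"
    "a = chain_boundary e" "b = chain_boundary e'"
    using assms by (elim boundariesE)
  then show ?thesis
    using boundariesI[OF carrier_chain_group_closed(2)[of e "Suc q" X e']]
    by (simp add: chain_boundary_def frag_extend_add)
qed

lemma cmul_in_boundaries:
  assumes "a \<in> boundaries q X"
  shows "frag_cmul n a \<in> boundaries q X"
proof -
  obtain e where "e \<in> carrier (chain_group (Suc q) X)" "a = chain_boundary e"
    using assms by (elim boundariesE)
  then show ?thesis
    using boundariesI[OF carrier_chain_group_closed(4)[of e "Suc q" X n]]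
    by (simp add: chain_boundary_def frag_extend_cmul)
qed

lemma diff_in_boundaries:
  assumes "a \<in> boundaries q X" "b \<in> boundaries q X"
  shows "a - b \<in> boundaries q X"
  using add_in_boundaries[OF assms(1) cmul_in_boundaries[OF assms(2), of "-1"]] by simp

lemma chain_map_homologous_step:
  assumes f: "digitally_continuous X Y f" and g: "digitally_continuous X Y g"
    and fg: "\<And>x. x \<in> X \<Longrightarrow> f x = g x \<or> c1_adjacent (f x) (g x)"
    and Y: "Y \<subseteq> carrier_vec m" and c: "c \<in> cycles q X"
  shows "chain_map q f c - chain_map q g c \<in> boundaries q Y"
proof -
  have cX: "c \<in> carrier (chain_group q X)" and dc: "chain_boundary c = 0"
    using c by (auto simp: cycles_def)
  have "prism_operator q f g c \<in> carrier (chain_group (Suc q) Y)"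
    unfolding prism_operator_def
  proof (intro frag_extend_in_chain_group cube_chain_in_chain_group)
    fix Q assume "Q \<in> Poly_Mapping.keys c"
    note Q = chain_groupD[OF cX this]
    have "digitally_continuous (unit_cube q) X (cube_param Q)"
      using elementary_cube_param(1)[OF Q(1)] Q(2) unfolding digitally_continuous_def by blast
    from digitally_continuous_prism[OF f g fg this]
    show "digitally_continuous (unit_cube (Suc q)) Y (prism q f g (cube_param Q))" .
  qed
  then have "chain_boundary (prism_operator q f g c) \<in> boundaries q Y"
    by (rule boundariesI)
  moreover from chain_boundary_prism_operator[OF f g fg Y cX]
  have "chain_boundary (prism_operator q f g c) =
      frag_cmul ((-1) ^ Suc q) (chain_map q f c - chain_map q g c)"
    unfolding dc by (simp add: prism_operator_def[of "q - Suc 0"] del: power_Suc)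
  \<comment> \<open>The prism gives the difference up to sign; multiplying by the same sign once
    more removes it.\<close>
  ultimately have "frag_cmul ((-1) ^ Suc q) (frag_cmul ((-1) ^ Suc q) (chain_map q f c - chain_map q g c))
      \<in> boundaries q Y"
    using cmul_in_boundaries by metis
  then show ?thesis
    by (simp flip: power_add power_mult_distrib)
qed

text \<open>Telescoping over the levels 0, ..., k. Consecutive levels are pointwise equal or
  adjacent because t and t + 1 are adjacent in \<open>digital_interval k\<close>.\<close>

lemma chain_map_homologous:
  assumes fg: "digitally_homotopic X Y f g" and Y: "Y \<subseteq> carrier_vec m" and c: "c \<in> cycles q X"
  shows "chain_map q f c - chain_map q g c \<in> boundaries q Y"
proof -
  obtain k F where k: "k > 0" and F0: "\<And>x. x \<in> X \<Longrightarrow> F x 0 = f x" and Fk: "\<And>x. x \<in> X \<Longrightarrow> F x k = g x"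
    and path: "\<And>x. x \<in> X \<Longrightarrow> digitally_continuous (digital_interval k) Y (\<lambda>s. F x (s $ 0))"
    and level: "\<And>t. t \<in> {0..k} \<Longrightarrow> digitally_continuous X Y (\<lambda>x. F x t)"
    using fg unfolding digitally_homotopic_def by blast
  have cX: "c \<in> carrier (chain_group q X)"
    using c by (simp add: cycles_def)
  have step: "F x (int n) = F x (int n + 1) \<or> c1_adjacent (F x (int n)) (F x (int n + 1))"
    if "x \<in> X" "int n + 1 \<le> k" for x n
  proof -
    let ?s = "\<lambda>t::int. vec 1 (\<lambda>_. t)"
    have "?s (int n) \<in> digital_interval k" "?s (int n + 1) \<in> digital_interval k"
      using that(2) by (auto simp: digital_interval_def)
    moreover have "c1_adjacent (?s (int n)) (?s (int n + 1))"
      by (auto simp: c1_adjacent_def)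
    ultimately show ?thesis
      using digitally_continuousD(2)[OF path[OF that(1)], of "?s (int n)" "?s (int n + 1)"] by simp
  qed
  have "chain_map q f c - chain_map q (\<lambda>x. F x (int n)) c \<in> boundaries q Y" if "int n \<le> k" for n
    using that
  proof (induction n)
    case 0
    \<comment> \<open>The homotopy meets \<open>f\<close> only on \<open>X\<close>, and chain maps
      of chains in \<open>X\<close> see nothing else.\<close>
    have "chain_map q f c = chain_map q (\<lambda>x. F x (int 0)) c"
      using F0 by (intro chain_map_cong[OF cX]) simp
    then show ?case using zero_in_boundaries by simp
  next
    case (Suc n)
    have "chain_map q (\<lambda>x. F x (int n)) c - chain_map q (\<lambda>x. F x (int (Suc n))) c \<in> boundaries q Y"
      using Suc.prems step by (intro chain_map_homologous_step[OF level level _ Y c]) (auto simp: add.commute)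
    from add_in_boundaries[OF Suc.IH this] Suc.prems show ?case by simp
  qed
  from this[of "nat k"] have "chain_map q f c - chain_map q (\<lambda>x. F x k) c \<in> boundaries q Y"
    using k by simp
  moreover have "chain_map q (\<lambda>x. F x k) c = chain_map q g c"
    using Fk by (intro chain_map_cong[OF cX]) simp
  ultimately show ?thesis by simp
qed

section \<open>Induced maps on homology\<close>

abbreviation homology_class :: "nat \<Rightarrow> int vec set \<Rightarrow> c1_chain \<Rightarrow> c1_chain set" where
  "homology_class q X c \<equiv> boundaries q X #>\<^bsub>cycle_group q X\<^esub> c"

text \<open>The multiplication of \<open>free_Abelian_group\<close> is addition of finitely
  supported functions, so the coset is a plain translate.\<close>

lemma mem_homology_class: "d \<in> homology_class q X c \<longleftrightarrow> d - c \<in> boundaries q X"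
proof -
  have "d \<in> homology_class q X c \<longleftrightarrow> (\<exists>b\<in>boundaries q X. d = b + c)"
    by (simp add: r_coset_def cycle_group_def chain_group_def)
  also have "\<dots> \<longleftrightarrow> d - c \<in> boundaries q X"
    by (metis add_diff_cancel diff_add_cancel)
  finally show ?thesis .
qed

lemma homology_class_eq:
  assumes "c - d \<in> boundaries q X"
  shows "homology_class q X c = homology_class q X d"
proof (rule Set.set_eqI)
  fix e
  have "e - c \<in> boundaries q X" if "e - d \<in> boundaries q X"
    using diff_in_boundaries[OF that assms] by simp
  moreover have "e - d \<in> boundaries q X" if "e - c \<in> boundaries q X"
    using add_in_boundaries[OF that assms] by simp
  ultimately show "e \<in> homology_class q X c \<longleftrightarrow> e \<in> homology_class q X d"
    unfolding mem_homology_class by blast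
qed

lemma cycles_closed:
  assumes "c \<in> cycles q X" "d \<in> cycles q X"
  shows "c + d \<in> cycles q X" "c - d \<in> cycles q X"
  using assms carrier_chain_group_closed[where q = q and X = X]
  unfolding cycles_def chain_boundary_def by (auto simp: frag_extend_add frag_extend_diff)

text \<open>\<open>subgroup_generated\<close> closes its argument under the group operations; the
  cycles already form a subgroup, so nothing is added.\<close>

lemma carrier_cycle_group: "carrier (cycle_group q X) = cycles q X"
proof -
  interpret group "chain_group q X"
    unfolding chain_group_def by simp
  have zero: "0 \<in> cycles q X"
    by (simp add: cycles_def chain_boundary_def chain_group_def)
  have "subgroup (cycles q X) (chain_group q X)"
  proof
    show "cycles q X \<subseteq> carrier (chain_group q X)"
      by (auto simp: cycles_def)
    show "x \<otimes>\<^bsub>chain_group q X\<^esub> y \<in> cycles q X" if "x \<in> cycles q X" "y \<in> cycles q X" for x y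
      using cycles_closed(1)[OF that] by (simp add: chain_group_def)
    show "\<one>\<^bsub>chain_group q X\<^esub> \<in> cycles q X"
      using zero by (simp add: chain_group_def)
    show "inv\<^bsub>chain_group q X\<^esub> x \<in> cycles q X" if "x \<in> cycles q X" for x
    proof -
      have "x \<in> carrier (chain_group q X)" using that by (simp add: cycles_def)
      then have "inv\<^bsub>chain_group q X\<^esub> x = 0 - x"
        by (simp add: chain_group_def)
      then show ?thesis using cycles_closed(2)[OF zero that] by simp
    qed
  qed
  then show ?thesis
    unfolding cycle_group_def by (rule subgroup.carrier_subgroup_generated_subgroup)
qed

lemma carrier_c1_homology: "carrier (c1_homology q X) = homology_class q X ` cycles q X"
  by (auto simp: c1_homology_def FactGroup_def RCOSETS_def carrier_cycle_group)

lemma mult_c1_homology: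
  "homology_class q X c \<otimes>\<^bsub>c1_homology q X\<^esub> homology_class q X d = homology_class q X (c + d)"
proof (rule Set.set_eqI)
  fix e
  have "e \<in> homology_class q X c \<otimes>\<^bsub>c1_homology q X\<^esub> homology_class q X d \<longleftrightarrow>
      (\<exists>u v. u - c \<in> boundaries q X \<and> v - d \<in> boundaries q X \<and> e = u + v)"
    unfolding mem_homology_class[symmetric]
    by (auto simp: c1_homology_def FactGroup_def set_mult_def cycle_group_def chain_group_def)
  also have "\<dots> \<longleftrightarrow> e - (c + d) \<in> boundaries q X"
  proof
    assume "\<exists>u v. u - c \<in> boundaries q X \<and> v - d \<in> boundaries q X \<and> e = u + v"
    then obtain u v where uv: "u - c \<in> boundaries q X" "v - d \<in> boundaries q X" "e = u + v" by blast
    from add_in_boundaries[OF uv(1,2)] show "e - (c + d) \<in> boundaries q X"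
      by (simp add: uv(3) algebra_simps)
  next
    assume "e - (c + d) \<in> boundaries q X"
    \<comment> \<open>The whole deviation from \<open>c + d\<close> is put into the first
      summand.\<close>
    then show "\<exists>u v. u - c \<in> boundaries q X \<and> v - d \<in> boundaries q X \<and> e = u + v"
      using zero_in_boundaries[of q X] by (intro exI[of _ "e - d"] exI[of _ d]) (simp add: algebra_simps)
  qed
  finally show "e \<in> homology_class q X c \<otimes>\<^bsub>c1_homology q X\<^esub> homology_class q X d \<longleftrightarrow>
      e \<in> homology_class q X (c + d)"
    unfolding mem_homology_class .
qed

lemma chain_map_cycles:
  assumes f: "digitally_continuous X Y f" and Y: "Y \<subseteq> carrier_vec m" and c: "c \<in> cycles q X"
  shows "chain_map q f c \<in> cycles q Y"
proof -
  have cX: "c \<in> carrier (chain_group q X)" and dc: "chain_boundary c = 0"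
    using c by (auto simp: cycles_def)
  note fc = chain_map_in_chain_group[OF f cX]
  have "chain_boundary (chain_map q f c) = 0"
  proof (cases q)
    case 0
    have "cube_boundary Q = 0" if Q: "Q \<in> Poly_Mapping.keys (chain_map q f c)" for Q
    proof -
      obtain x K where K: "K \<subseteq> {..<dim_vec x}" "card K = q" "Q = lattice_cube x K"
        using elementary_cubeE[OF chain_groupD(1)[OF fc Q]] .
      then show ?thesis
        using cube_boundary_vertex[of K x] finite_subset[OF K(1)] 0 by simp
    qed
    then show ?thesis
      unfolding chain_boundary_def by (rule frag_extend_eq_0)
  next
    case (Suc n)
    then show ?thesis
      using chain_boundary_chain_map[OF f Y, of c n] cX dc by (simp add: chain_map_def[of n])
  qed
  then show ?thesis using fc by (simp add: cycles_def)
qed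

lemma chain_map_boundaries:
  assumes f: "digitally_continuous X Y f" and Y: "Y \<subseteq> carrier_vec m" and b: "b \<in> boundaries q X"
  shows "chain_map q f b \<in> boundaries q Y"
proof -
  obtain e where e: "e \<in> carrier (chain_group (Suc q) X)" "b = chain_boundary e"
    using boundariesE[OF b] .
  show ?thesis
    using boundariesI[OF chain_map_in_chain_group[OF f e(1)]] chain_boundary_chain_map[OF f Y e(1)] e(2)
    by simp
qed

text \<open>Representatives differ by boundaries, which are sent to boundaries, so the union
  defining \<open>induced_map\<close> runs over a constant nonempty family.\<close>

lemma induced_map_homology_class:
  assumes f: "digitally_continuous X Y f" and Y: "Y \<subseteq> carrier_vec m" and c: "c \<in> cycles q X"
  shows "induced_map q X Y f (homology_class q X c) = homology_class q Y (chain_map q f c)"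
proof -
  have eq: "homology_class q Y (chain_map q f d) = homology_class q Y (chain_map q f c)"
    if "d \<in> homology_class q X c" for d
  proof (rule homology_class_eq)
    have "chain_map q f d - chain_map q f c = chain_map q f (d - c)"
      by (simp add: chain_map_def frag_extend_diff)
    then show "chain_map q f d - chain_map q f c \<in> boundaries q Y"
      using chain_map_boundaries[OF f Y] that by (simp add: mem_homology_class)
  qed
  have "c \<in> homology_class q X c"
    using zero_in_boundaries by (simp add: mem_homology_class)
  then have "homology_class q X c \<noteq> {}" by blast
  moreover have "homology_class q X c \<in> carrier (c1_homology q X)"
    using c by (simp add: carrier_c1_homology)
  ultimately show ?thesis
    unfolding induced_map_def using SUP_eq_const[OF _ eq] by simp
qed

lemma induced_map_closed:
  assumes "digitally_continuous X Y f" "Y \<subseteq> carrier_vec m" "A \<in> carrier (c1_homology q X)"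
  shows "induced_map q X Y f A \<in> carrier (c1_homology q Y)"
  using assms(3) chain_map_cycles[OF assms(1,2)]
  unfolding carrier_c1_homology by (auto simp: induced_map_homology_class[OF assms(1,2)])

lemma induced_map_homotopic:
  assumes f: "digitally_continuous X Y f" and g: "digitally_continuous X Y g"
    and fg: "digitally_homotopic X Y f g" and Y: "Y \<subseteq> carrier_vec m"
  shows "induced_map q X Y f = induced_map q X Y g"
proof
  fix A
  show "induced_map q X Y f A = induced_map q X Y g A"
  proof (cases "A \<in> carrier (c1_homology q X)")
    case True
    then obtain c where c: "c \<in> cycles q X" "A = homology_class q X c"
      unfolding carrier_c1_homology by blast
    show ?thesis
      unfolding c(2) induced_map_homology_class[OF f Y c(1)] induced_map_homology_class[OF g Y c(1)]
      by (rule homology_class_eq[OF chain_map_homologous[OF fg Y c(1)]])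
  \<comment> \<open>Outside the homology group both restricted maps are
    \<open>undefined\<close>.\<close>
  qed (simp add: induced_map_def)
qed

text \<open>On representatives the composite is the chain map of \<open>g \<circ> f\<close>, which
  is homologous to that of \<open>id\<close>, and the latter fixes every chain. Exchanging
  \<open>f\<close> and \<open>g\<close> gives the other half of the isomorphism.\<close>

lemma induced_map_inverse:
  assumes f: "digitally_continuous X Y f" and g: "digitally_continuous Y X g"
    and gf: "digitally_homotopic X X (g \<circ> f) id"
    and X: "X \<subseteq> carrier_vec m" and Y: "Y \<subseteq> carrier_vec p" and c: "c \<in> cycles q X"
  shows "induced_map q Y X g (induced_map q X Y f (homology_class q X c)) = homology_class q X c"
proof -
  have cX: "c \<in> carrier (chain_group q X)"
    using c by (simp add: cycles_def)
  have "induced_map q Y X g (induced_map q X Y f (homology_class q X c)) =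
      homology_class q X (chain_map q (g \<circ> f) c)"
    by (simp add: induced_map_homology_class[OF f Y c]
      induced_map_homology_class[OF g X chain_map_cycles[OF f Y c]] chain_map_comp[OF f g Y X cX])
  also have "\<dots> = homology_class q X (chain_map q id c)"
    by (rule homology_class_eq[OF chain_map_homologous[OF gf X c]])
  finally show ?thesis
    unfolding chain_map_id[OF cX] .
qed

lemma c1_homology_homotopy_equivalent:
  assumes "digitally_homotopy_equivalent X Y" and X: "X \<subseteq> carrier_vec m" and Y: "Y \<subseteq> carrier_vec p"
  shows "c1_homology q X \<cong> c1_homology q Y"
proof -
  obtain f g where f: "digitally_continuous X Y f" and g: "digitally_continuous Y X g"
    and gf: "digitally_homotopic X X (g \<circ> f) id" and fg: "digitally_homotopic Y Y (f \<circ> g) id"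
    using assms(1) unfolding digitally_homotopy_equivalent_def by blast
  have "induced_map q X Y f \<in> hom (c1_homology q X) (c1_homology q Y)"
  proof (rule homI)
    fix A B assume "A \<in> carrier (c1_homology q X)" "B \<in> carrier (c1_homology q X)"
    then obtain c d where c: "c \<in> cycles q X" "A = homology_class q X c"
      and d: "d \<in> cycles q X" "B = homology_class q X d"
      unfolding carrier_c1_homology by blast
    show "induced_map q X Y f (A \<otimes>\<^bsub>c1_homology q X\<^esub> B) =
        induced_map q X Y f A \<otimes>\<^bsub>c1_homology q Y\<^esub> induced_map q X Y f B"
      unfolding c(2) d(2) mult_c1_homology induced_map_homology_class[OF f Y c(1)]
        induced_map_homology_class[OF f Y d(1)]
        induced_map_homology_class[OF f Y cycles_closed(1)[OF c(1) d(1)]]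
      by (simp add: chain_map_def frag_extend_add)
  qed (rule induced_map_closed[OF f Y])
  moreover have "bij_betw (induced_map q X Y f) (carrier (c1_homology q X)) (carrier (c1_homology q Y))"
  proof (rule bij_betwI[where g = "induced_map q Y X g"])
    show "induced_map q Y X g (induced_map q X Y f A) = A" if "A \<in> carrier (c1_homology q X)" for A
      using that induced_map_inverse[OF f g gf X Y] unfolding carrier_c1_homology by blast
    show "induced_map q X Y f (induced_map q Y X g A) = A" if "A \<in> carrier (c1_homology q Y)" for A
      using that induced_map_inverse[OF g f fg Y X] unfolding carrier_c1_homology by blast
  qed (use induced_map_closed[OF f Y] induced_map_closed[OF g X] in blast)+
  ultimately have "induced_map q X Y f \<in> iso (c1_homology q X) (c1_homology q Y)"
    by (simp add: iso_def)
  then show ?thesis by (rule is_isoI)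
qed

theorem theorem6p12:
  fixes X Y :: "int vec set"
  assumes "c1_digital_image X" and "c1_digital_image Y"
  shows "(\<forall>f g. digitally_continuous X Y f \<and> digitally_continuous X Y g \<and>
            digitally_homotopic X Y f g \<longrightarrow>
            (\<forall>q. induced_map q X Y f = induced_map q X Y g)) \<and>
         (digitally_homotopy_equivalent X Y \<longrightarrow> (\<forall>q. c1_homology q X \<cong> c1_homology q Y))"
proof -
  obtain m p where X: "X \<subseteq> carrier_vec m" and Y: "Y \<subseteq> carrier_vec p"
    using assms unfolding c1_digital_image_def by blast
  show ?thesis
    using induced_map_homotopic[OF _ _ _ Y] c1_homology_homotopy_equivalent[OF _ X Y] by blast
qed

end
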